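(* Let $0\le\underline{\sigma}\le\overline{\sigma}<\infty$ with $\overline{\sigma}>0$, and for $c\in[0,\infty)$ let $$p_1(c) = \lim_{n\to\infty}\ \sup_{\{\sigma_i\}\in\Sigma(\underline{\sigma},\overline{\sigma})} \mathsf{E}\left[\mathbf{1}\left(\sqrt n\,\bar X_n>c\right)\right],\qquad p_2(c) = \lim_{n\to\infty}\ \sup_{\{\sigma_i\}\in\Sigma(\underline{\sigma},\overline{\sigma})} \mathsf{E}\left[\mathbf{1}\left(\sqrt n\,|\bar X_n|>c\right)\right]$$ be the (one-sided and two-sided) tail capacities of the G-normal distribution with lower variance $\underline{\sigma}^2$ and upper variance $\overline{\sigma}^2$. As $c\to\infty$, we have $p_2(c)\sim 2p_1(c)$, with the relative error given by $$\frac{|p_2(c)-2p_1(c)|}{2p_1(c)}\ \lesssim\ \frac{1-\underline{\sigma}^2/\overline{\sigma}^2}{4}\exp\left(-\frac{3c^2}{2\overline{\sigma}^2}\right).$$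
   Context: Let $\epsilon_1,\epsilon_2,\dots$ be i.i.d. random variables with $\mathsf E(\epsilon_i)=0$, $\mathsf E(\epsilon_i^2)=1$, $\mathsf E(|\epsilon_i|^3)<\infty$, defined on a filtered probability space $(\Omega,\mathcal F,\mathsf P,\{\mathcal F_i\}_{i=0}^\infty)$, where $\mathcal F_i=\sigma(\epsilon_1,\dots,\epsilon_i)$ is the natural filtration ($\mathcal F_0$ trivial). $\Sigma(\underline{\sigma},\overline{\sigma})$ is the collection of all sequences $\{\sigma_i\}$ that are predictable with respect to this filtration (each $\sigma_i$ is $\mathcal F_{i-1}$-measurable) and always take values in $[\underline{\sigma},\overline{\sigma}]$. For such a sequence, $X_i=\sigma_i\epsilon_i$ and $\bar X_n=(X_1+\cdots+X_n)/n$. $\mathbf{1}(\cdot)$ is the indicator function. The notation $g\sim h$ denotes asymptotic equivalence, $g(c)/h(c)\to1$ as $c\to\infty$, and $g\lesssim h$ means "asymptotically less than", i.e. $g(c)\le(1+o(1))\,h(c)$ as $c\to\infty$. *)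

theory Defs
  imports "HOL-Probability.Probability" "HOL-Library.Landau_Symbols"
begin

(* Random sequences are indexed by 1, 2, ...; the entry at index 0 is never used. *)

definition iid_standard :: "'a measure \<Rightarrow> (nat \<Rightarrow> 'a \<Rightarrow> real) \<Rightarrow> bool" where
  "iid_standard M \<epsilon> \<longleftrightarrow>
     prob_space.indep_vars M (\<lambda>_. borel) \<epsilon> {1..} \<and>
     (\<forall>i\<ge>1. distr M borel (\<epsilon> i) = distr M borel (\<epsilon> 1)) \<and>
     (\<forall>i\<ge>1. integrable M (\<lambda>\<omega>. \<bar>\<epsilon> i \<omega>\<bar> ^ 3) \<and>
            (\<integral>\<omega>. \<epsilon> i \<omega> \<partial>M) = 0 \<and> (\<integral>\<omega>. (\<epsilon> i \<omega>)\<^sup>2 \<partial>M) = 1)"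

definition natural_filtration :: "'a measure \<Rightarrow> (nat \<Rightarrow> 'a \<Rightarrow> real) \<Rightarrow> nat \<Rightarrow> 'a measure" where
  "natural_filtration M \<epsilon> i =
     sigma (space M) {\<epsilon> j -` A \<inter> space M | j A. j \<in> {1..i} \<and> A \<in> sets borel}"

definition predictable_seqs ::
    "'a measure \<Rightarrow> (nat \<Rightarrow> 'a \<Rightarrow> real) \<Rightarrow> real \<Rightarrow> real \<Rightarrow> (nat \<Rightarrow> 'a \<Rightarrow> real) set" where
  "predictable_seqs M \<epsilon> lo hi =
     {\<sigma>. \<forall>i\<ge>1. \<sigma> i \<in> borel_measurable (natural_filtration M \<epsilon> (i - 1)) \<and>
                (\<forall>\<omega>\<in>space M. \<sigma> i \<omega> \<in> {lo..hi})}"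

definition sample_mean ::
    "(nat \<Rightarrow> 'a \<Rightarrow> real) \<Rightarrow> (nat \<Rightarrow> 'a \<Rightarrow> real) \<Rightarrow> nat \<Rightarrow> 'a \<Rightarrow> real" where
  "sample_mean \<epsilon> \<sigma> n \<omega> = (\<Sum>i=1..n. \<sigma> i \<omega> * \<epsilon> i \<omega>) / real n"

definition one_sided_sup ::
    "'a measure \<Rightarrow> (nat \<Rightarrow> 'a \<Rightarrow> real) \<Rightarrow> real \<Rightarrow> real \<Rightarrow> real \<Rightarrow> nat \<Rightarrow> real" where
  "one_sided_sup M \<epsilon> lo hi c n =
     (SUP \<sigma>\<in>predictable_seqs M \<epsilon> lo hi.
        \<integral>\<omega>. of_bool (sqrt (real n) * sample_mean \<epsilon> \<sigma> n \<omega> > c) \<partial>M)"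

definition two_sided_sup ::
    "'a measure \<Rightarrow> (nat \<Rightarrow> 'a \<Rightarrow> real) \<Rightarrow> real \<Rightarrow> real \<Rightarrow> real \<Rightarrow> nat \<Rightarrow> real" where
  "two_sided_sup M \<epsilon> lo hi c n =
     (SUP \<sigma>\<in>predictable_seqs M \<epsilon> lo hi.
        \<integral>\<omega>. of_bool (sqrt (real n) * \<bar>sample_mean \<epsilon> \<sigma> n \<omega>\<bar> > c) \<partial>M)"

definition tail_capacity1 ::
    "'a measure \<Rightarrow> (nat \<Rightarrow> 'a \<Rightarrow> real) \<Rightarrow> real \<Rightarrow> real \<Rightarrow> real \<Rightarrow> real" where
  "tail_capacity1 M \<epsilon> lo hi c = lim (one_sided_sup M \<epsilon> lo hi c)"

definition tail_capacity2 ::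
    "'a measure \<Rightarrow> (nat \<Rightarrow> 'a \<Rightarrow> real) \<Rightarrow> real \<Rightarrow> real \<Rightarrow> real \<Rightarrow> real" where
  "tail_capacity2 M \<epsilon> lo hi c = lim (two_sided_sup M \<epsilon> lo hi c)"

(* g(c) \<le> (1 + o(1)) h(c) as c tends to infinity; stated multiplicatively so that it makes
   sense when h vanishes identically, as happens below when lo = hi. *)
definition asymp_less :: "(real \<Rightarrow> real) \<Rightarrow> (real \<Rightarrow> real) \<Rightarrow> bool" (infix "\<lesssim>" 50) where
  "g \<lesssim> h \<longleftrightarrow> (\<exists>r. r \<in> o[at_top](\<lambda>_. 1) \<and> (\<forall>\<^sub>F c in at_top. g c \<le> (1 + r c) * h c))"

end

theory Submission
  imports Defs
begin

text \<open>By dynamic programming, the supremum over predictable volatilities of the expectation of a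
  Lipschitz function of the normalised walk is an iterate of a one-step Bellman operator. A third-order
  Taylor expansion shows that smooth sub- and supersolutions of the \<open>G\<close>-heat equation are preserved
  by the iterates up to an error of order \<open>n\<close> to the power \<open>-1/2\<close>.

  One-sided tail: the \<open>G\<close>-heat equation with the indicator of a half-line as initial datum has an
  explicit self-similar solution (a front), whence \<open>p1 c = 2 hi / (hi + lo) * Phi (- c / hi)\<close>.

  Two-sided tail: there is no closed form. The limit exists for Lipschitz data because the operator
  is a supremum of linear ones, so that mollifying a coarse value function gives a smooth approximate
  supersolution for all finer walks. Passing to indicators requires that little mass sits near \<open>\<plusminus>c\<close>:
  for \<open>lo > 0\<close> this follows from a Gaussian supersolution \<open>\<tau> powr (- p) * exp (- x\<^sup>2 / (2 hi\<^sup>2 \<tau>))\<close>, for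
  \<open>lo = 0\<close> from Brownian scaling. Finally \<open>p2 \<le> 2 p1\<close> by subadditivity, and the sum of the two fronts,
  minus a quadratic corrector, is a subsolution, which bounds \<open>2 p1 - p2\<close>.\<close>

subsection \<open>The Bellman operator\<close>

text \<open>The capacities are defined through walks, so all estimates concern iterates of
  \<open>bellman\<close>; no limiting diffusion or viscosity solution is constructed. The
  self-similar solutions are singular at time 0, so each comparison starts them at time
  \<open>\<delta>\<close> and shifts the level by a margin. The regularity constants then explode as
  \<open>\<delta>\<close> tends to 0, which forces the order of limits: n to infinity for fixed
  \<open>\<delta>\<close>, then \<open>\<delta>\<close> to 0. \<open>lim\<close> says nothing about
  a divergent sequence, so the two-sided limit must be shown to exist before an estimate of it has
  meaning. Origin of the error bound: where the near front asks for the low volatility, the far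
  front, centred at distance at least 2c, asks for the high one. Its curvature there is of the order
  of the Gaussian density at 2c/hi, against a tail at c/hi, and exp(-4v^2/2) / exp(-v^2/2) =
  exp(-3v^2/2). The factor (1 - lo^2/hi^2)/4 is what remains of
  \<open>(hi\<^sup>2 - lo\<^sup>2) / 2\<close> times this curvature, times the cost
  \<open>hi\<^sup>2 / (2 * c\<^sup>2)\<close> of the corrector, after division by
  \<open>2 * tail1 c\<close>.\<close>

definition bounded_lipschitz :: "real \<Rightarrow> real \<Rightarrow> (real \<Rightarrow> real) \<Rightarrow> bool" where
  "bounded_lipschitz B L f \<longleftrightarrow> (\<forall>x. \<bar>f x\<bar> \<le> B) \<and> (\<forall>x y. \<bar>f x - f y\<bar> \<le> L * \<bar>x - y\<bar>)"

lemma bounded_lipschitzD: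
  assumes "bounded_lipschitz B L f"
  shows "\<bar>f x\<bar> \<le> B" "f x \<le> B" "- B \<le> f x" "\<bar>f x - f y\<bar> \<le> L * \<bar>x - y\<bar>" "0 \<le> B" "0 \<le> L"
    "f x \<le> f y + L * \<bar>x - y\<bar>"
proof -
  show 1: "\<bar>f x\<bar> \<le> B" for x using assms by (auto simp: bounded_lipschitz_def)
  show "f x \<le> B" "- B \<le> f x" "0 \<le> B" using 1[of x] by auto
  show 2: "\<bar>f x - f y\<bar> \<le> L * \<bar>x - y\<bar>" for x y using assms by (auto simp: bounded_lipschitz_def)
  show "0 \<le> L" using 2[of 0 1] by simp
  show "f x \<le> f y + L * \<bar>x - y\<bar>" using 2[of x y] by simp
qed

lemma bounded_lipschitz_continuous:
  assumes "bounded_lipschitz B L f" shows "continuous_on A f"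
proof -
  have "L-lipschitz_on A f"
    using bounded_lipschitzD[OF assms] by (intro lipschitz_onI) (auto simp: dist_real_def)
  then show ?thesis by (rule lipschitz_on_continuous_on)
qed

lemma bounded_lipschitz_measurable:
  assumes "bounded_lipschitz B L f" shows "f \<in> borel_measurable borel"
  using bounded_lipschitz_continuous[OF assms] by (rule borel_measurable_continuous_onI)

lemma bounded_lipschitz_add:
  assumes "bounded_lipschitz B L f" "bounded_lipschitz B' L' g"
  shows "bounded_lipschitz (B + B') (L + L') (\<lambda>x. f x + g x)"
  unfolding bounded_lipschitz_def
proof (intro conjI allI)
  fix x y
  show "\<bar>f x + g x\<bar> \<le> B + B'"
    using bounded_lipschitzD(1)[OF assms(1), of x] bounded_lipschitzD(1)[OF assms(2), of x] by linarith
  show "\<bar>f x + g x - (f y + g y)\<bar> \<le> (L + L') * \<bar>x - y\<bar>"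
    using bounded_lipschitzD(4)[OF assms(1), of x y] bounded_lipschitzD(4)[OF assms(2), of x y]
    by (simp add: distrib_right)
qed

lemma bounded_lipschitz_scale:
  assumes "bounded_lipschitz B L f" "0 \<le> a" shows "bounded_lipschitz (a * B) (a * L) (\<lambda>x. a * f x)"
  unfolding bounded_lipschitz_def
proof (intro conjI allI)
  fix x y
  show "\<bar>a * f x\<bar> \<le> a * B"
    using bounded_lipschitzD(1)[OF assms(1)] assms(2) by (simp add: abs_mult mult_left_mono)
  have "\<bar>a * f x - a * f y\<bar> = a * \<bar>f x - f y\<bar>"
    using assms(2) by (simp add: abs_mult right_diff_distrib[symmetric])
  also have "\<dots> \<le> a * (L * \<bar>x - y\<bar>)"
    using bounded_lipschitzD(4)[OF assms(1)] assms(2) by (rule mult_left_mono)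
  finally show "\<bar>a * f x - a * f y\<bar> \<le> a * L * \<bar>x - y\<bar>" by (simp add: mult.assoc)
qed

text \<open>A Lipschitz second derivative replaces a bounded third one, because the fronts used
  later may have a kink in the second derivative. The remainder is
  \<open>(f2 t - f2 x) * y\<^sup>2 / 2\<close> at an intermediate point; the factor 1/2 is given
  away.\<close>

lemma taylor2_lipschitz:
  fixes f f1 f2 :: "real \<Rightarrow> real"
  assumes d1: "\<And>x. (f has_real_derivative f1 x) (at x)"
    and d2: "\<And>x. (f1 has_real_derivative f2 x) (at x)"
    and lip: "\<And>x y. \<bar>f2 x - f2 y\<bar> \<le> K * \<bar>x - y\<bar>"
  shows "\<bar>f (x + y) - f x - f1 x * y - f2 x * y\<^sup>2 / 2\<bar> \<le> K * \<bar>y\<bar> ^ 3"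
proof (cases "y = 0")
  case False
  define D where "D = (\<lambda>m::nat. if m = 0 then f else if m = 1 then f1 else f2)"
  have K: "0 \<le> K" using lip[of 0 1] by simp
  have "\<exists>t. (if x + y < x then x + y < t \<and> t < x else x < t \<and> t < x + y) \<and>
      f (x + y) = (\<Sum>m<2. (D m x / fact m) * (x + y - x)^m) + (D 2 t / fact 2) * (x + y - x)^2"
    by (rule Taylor[where a = "x - \<bar>y\<bar>" and b = "x + \<bar>y\<bar>"])
      (use d1 d2 False in \<open>auto simp: D_def less_Suc_eq numeral_2_eq_2\<close>)
  then obtain t where t: "\<bar>t - x\<bar> \<le> \<bar>y\<bar>" and "f (x + y) = f x + f1 x * y + f2 t / 2 * y\<^sup>2"
    apply (elim exE conjE)
    subgoal premises p for t using p(1)[of t] p(2,3) by (auto simp: D_def eval_nat_numeral split: if_splits)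
    done
  then have "\<bar>f (x + y) - f x - f1 x * y - f2 x * y\<^sup>2 / 2\<bar> = \<bar>f2 t - f2 x\<bar> / 2 * y\<^sup>2"
    by (simp add: abs_mult left_diff_distrib[symmetric] diff_divide_distrib[symmetric])
  also have "\<dots> \<le> (K * \<bar>y\<bar>) * y\<^sup>2"
  proof (rule mult_right_mono)
    have "K * \<bar>t - x\<bar> \<le> K * \<bar>y\<bar>" using t K by (rule mult_left_mono)
    then show "\<bar>f2 t - f2 x\<bar> / 2 \<le> K * \<bar>y\<bar>"
      using lip[of t x] abs_ge_zero[of "f2 t - f2 x"] by argo
  qed simp
  also have "\<dots> = K * \<bar>y\<bar> ^ 3" by (simp add: power3_eq_cube power2_eq_square)
  finally show ?thesis .
qed auto

text \<open>One operator serves twice: with \<open>M\<close> the noise law it is a step of the walk,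
  with \<open>M\<close> uniform on [0, 1] a moving average. That the two commute is then Fubini's
  theorem.\<close>

definition shifted_mean :: "real measure \<Rightarrow> real \<Rightarrow> (real \<Rightarrow> real) \<Rightarrow> real \<Rightarrow> real" where
  "shifted_mean M s f x = (\<integral>e. f (x + s * e) \<partial>M)"

context real_distribution
begin

lemma prob_UNIV [simp]: "prob UNIV = 1"
  using prob_space by simp

lemma integrable_bounded_lipschitz:
  assumes "bounded_lipschitz B L f" shows "integrable M (\<lambda>e. f (x + s * e))"
proof (rule integrable_const_bound[where B = B])
  have [measurable]: "f \<in> borel_measurable borel" using assms by (rule bounded_lipschitz_measurable)
  show "(\<lambda>e. f (x + s * e)) \<in> borel_measurable M" by measurable
qed (use bounded_lipschitzD(1)[OF assms] in auto)

lemma shifted_mean_mono: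
  assumes "integrable M (\<lambda>e. f (x + s * e))" "integrable M (\<lambda>e. g (x + s * e))" "\<And>y. f y \<le> g y"
  shows "shifted_mean M s f x \<le> shifted_mean M s g x"
  unfolding shifted_mean_def using assms by (intro integral_mono) auto

lemma shifted_mean_const [simp]: "shifted_mean M s (\<lambda>_. c) x = c"
  by (simp add: shifted_mean_def prob_space)

lemma shifted_mean_bounded_lipschitz:
  assumes f: "bounded_lipschitz B L f" shows "bounded_lipschitz B L (shifted_mean M s f)"
  unfolding bounded_lipschitz_def
proof (intro conjI allI)
  note int = integrable_bounded_lipschitz[OF f]
  show "\<bar>shifted_mean M s f x\<bar> \<le> B" for x
  proof (rule abs_leI)
    show "shifted_mean M s f x \<le> B" unfolding shifted_mean_def
      using bounded_lipschitzD(2)[OF f] by (intro integral_le_const int) auto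
    have "- B \<le> shifted_mean M s f x" unfolding shifted_mean_def
      using bounded_lipschitzD(3)[OF f] by (intro integral_ge_const int) auto
    then show "- shifted_mean M s f x \<le> B" by simp
  qed
  have 1: "shifted_mean M s f x \<le> shifted_mean M s f y + L * \<bar>x - y\<bar>" for x y
  proof -
    have "shifted_mean M s f x \<le> (\<integral>e. f (y + s * e) + L * \<bar>x - y\<bar> \<partial>M)"
      unfolding shifted_mean_def
    proof (rule integral_mono)
      show "f (x + s * e) \<le> f (y + s * e) + L * \<bar>x - y\<bar>" for e
        using bounded_lipschitzD(7)[OF f, of "x + s * e" "y + s * e"] by simp
    qed (use int in auto)
    also have "\<dots> = shifted_mean M s f y + L * \<bar>x - y\<bar>"
      unfolding shifted_mean_def using int by (simp add: prob_space)
    finally show ?thesis .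
  qed
  show "\<bar>shifted_mean M s f x - shifted_mean M s f y\<bar> \<le> L * \<bar>x - y\<bar>" for x y
    using 1[of x y] 1[of y x] by (simp add: abs_minus_commute abs_le_iff)
qed

end

section \<open>Moments of the noise and a single step of the walk\<close>

locale noise = real_distribution \<mu> for \<mu> :: "real measure" +
  assumes third_moment: "integrable \<mu> (\<lambda>e. \<bar>e\<bar> ^ 3)"
    and noise_mean: "(\<integral>e. e \<partial>\<mu>) = 0"
    and noise_variance: "(\<integral>e. e\<^sup>2 \<partial>\<mu>) = 1"
begin

abbreviation step :: "real \<Rightarrow> (real \<Rightarrow> real) \<Rightarrow> real \<Rightarrow> real" where
  "step \<equiv> shifted_mean \<mu>"

lemma integrable_noise [simp]: "integrable \<mu> (\<lambda>e. e)"
proof (rule Bochner_Integration.integrable_bound[where f = "\<lambda>e. 1 + \<bar>e\<bar> ^ 3"])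
  show "AE e in \<mu>. norm e \<le> norm (1 + \<bar>e\<bar> ^ 3)"
  proof (rule AE_I2)
    fix e :: real
    show "norm e \<le> norm (1 + \<bar>e\<bar> ^ 3)"
      using self_le_power[of "\<bar>e\<bar>" 3] zero_le_power[of "\<bar>e\<bar>" 3]
      by (cases "\<bar>e\<bar> \<le> 1") (simp_all add: add_increasing2)
  qed
qed (auto intro: third_moment)

lemma integrable_noise_square [simp]: "integrable \<mu> (\<lambda>e. e\<^sup>2)"
proof (rule Bochner_Integration.integrable_bound[where f = "\<lambda>e. 1 + \<bar>e\<bar> ^ 3"])
  show "AE e in \<mu>. norm (e\<^sup>2) \<le> norm (1 + \<bar>e\<bar> ^ 3)"
  proof (rule AE_I2)
    fix e :: real
    show "norm (e\<^sup>2) \<le> norm (1 + \<bar>e\<bar> ^ 3)"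
      using power_increasing[of 2 3 "\<bar>e\<bar>"] power_le_one[of "\<bar>e\<bar>" 2] zero_le_power[of "\<bar>e\<bar>" 3]
      by (cases "\<bar>e\<bar> \<le> 1") (simp_all add: add_increasing2)
  qed
qed (auto intro: third_moment)

definition third :: real where "third = (\<integral>e. \<bar>e\<bar> ^ 3 \<partial>\<mu>)"

lemma third_nonneg: "0 \<le> third"
  by (simp add: third_def)

text \<open>Since E|e| is at most 1, changing the scale from s to t moves the argument by at most |s
  - t| in the mean. This gives continuity in the volatility and, with t = 0, the time regularity of
  the iterates.\<close>

lemma step_lipschitz_scale:
  assumes f: "bounded_lipschitz B L f"
  shows "\<bar>step s f x - step t f x\<bar> \<le> L * \<bar>s - t\<bar>"
proof -
  note int = integrable_bounded_lipschitz[OF f]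
  have abs1: "(\<integral>e. \<bar>e\<bar> \<partial>\<mu>) \<le> 1"
  proof -
    have "(\<integral>e. \<bar>e\<bar> \<partial>\<mu>) \<le> (\<integral>e. (1 + e\<^sup>2) / 2 \<partial>\<mu>)"
    proof (rule integral_mono)
      show "\<bar>e\<bar> \<le> (1 + e\<^sup>2) / 2" for e :: real
        using zero_le_power2[of "\<bar>e\<bar> - 1"] by (simp add: power2_diff)
    qed auto
    also have "\<dots> = 1" by (simp add: noise_variance prob_space)
    finally show ?thesis .
  qed
  have "\<bar>step s f x - step t f x\<bar> = \<bar>\<integral>e. f (x + s * e) - f (x + t * e) \<partial>\<mu>\<bar>"
    unfolding shifted_mean_def using int by simp
  also have "\<dots> \<le> (\<integral>e. \<bar>f (x + s * e) - f (x + t * e)\<bar> \<partial>\<mu>)"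
    by (rule integral_abs_bound)
  also have "\<dots> \<le> (\<integral>e. L * \<bar>s - t\<bar> * \<bar>e\<bar> \<partial>\<mu>)"
  proof (rule integral_mono)
    show "\<bar>f (x + s * e) - f (x + t * e)\<bar> \<le> L * \<bar>s - t\<bar> * \<bar>e\<bar>" for e
      using bounded_lipschitzD(4)[OF f, of "x + s * e" "x + t * e"]
      by (simp add: abs_mult[symmetric] algebra_simps)
  qed (use int in auto)
  also have "\<dots> = L * \<bar>s - t\<bar> * (\<integral>e. \<bar>e\<bar> \<partial>\<mu>)" by simp
  also have "\<dots> \<le> L * \<bar>s - t\<bar> * 1"
    using bounded_lipschitzD(6)[OF f] by (intro mult_left_mono abs1) auto
  finally show ?thesis by simp
qed

text \<open>Mean zero removes the linear term, unit variance turns the quadratic one into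
  \<open>s\<^sup>2 * f2 x / 2\<close>, and the third moment bounds the rest. Integrability is part
  of the conclusion because barriers may be unbounded: one contains a quadratic corrector.\<close>

lemma step_taylor:
  assumes d1: "\<And>x. (f has_real_derivative f1 x) (at x)"
    and d2: "\<And>x. (f1 has_real_derivative f2 x) (at x)"
    and lip: "\<And>x y. \<bar>f2 x - f2 y\<bar> \<le> K * \<bar>x - y\<bar>"
  shows "integrable \<mu> (\<lambda>e. f (x + s * e))"
    and "\<bar>step s f x - f x - s\<^sup>2 * f2 x / 2\<bar> \<le> K * third * \<bar>s\<bar> ^ 3"
proof -
  have K: "0 \<le> K" using lip[of 0 1] by simp
  have "continuous_on UNIV f" using d1 DERIV_continuous_on by blast
  then have [measurable]: "f \<in> borel_measurable borel" by (rule borel_measurable_continuous_onI)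
  define P where "P e = f x + f1 x * (s * e) + f2 x * (s * e)\<^sup>2 / 2" for e
  define R where "R e = f (x + s * e) - P e" for e
  have P: "integrable \<mu> P" unfolding P_def by (auto simp: power_mult_distrib)
  have Rb: "\<bar>R e\<bar> \<le> K * \<bar>s\<bar> ^ 3 * \<bar>e\<bar> ^ 3" for e
    using taylor2_lipschitz[OF d1 d2 lip, of x "s * e"]
    by (simp add: R_def P_def abs_mult power_mult_distrib algebra_simps)
  have R: "integrable \<mu> R"
  proof (rule Bochner_Integration.integrable_bound[where f = "\<lambda>e. K * \<bar>s\<bar> ^ 3 * \<bar>e\<bar> ^ 3"])
    show "integrable \<mu> (\<lambda>e. K * \<bar>s\<bar> ^ 3 * \<bar>e\<bar> ^ 3)" using third_moment by simp
    show "R \<in> borel_measurable \<mu>" unfolding R_def P_def by measurable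
    show "AE e in \<mu>. norm (R e) \<le> norm (K * \<bar>s\<bar> ^ 3 * \<bar>e\<bar> ^ 3)"
    proof (rule AE_I2)
      fix e show "norm (R e) \<le> norm (K * \<bar>s\<bar> ^ 3 * \<bar>e\<bar> ^ 3)"
        using Rb[of e] abs_ge_self[of "K * \<bar>s\<bar> ^ 3 * \<bar>e\<bar> ^ 3"] unfolding real_norm_def by linarith
    qed
  qed
  have eq: "(\<lambda>e. f (x + s * e)) = (\<lambda>e. P e + R e)" by (auto simp: R_def)
  show "integrable \<mu> (\<lambda>e. f (x + s * e))" unfolding eq using P R by simp
  have "(\<integral>e. P e \<partial>\<mu>) = f x + s\<^sup>2 * f2 x / 2"
    unfolding P_def by (simp add: power_mult_distrib noise_mean noise_variance prob_space)
  then have "step s f x - f x - s\<^sup>2 * f2 x / 2 = (\<integral>e. R e \<partial>\<mu>)"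
    unfolding shifted_mean_def eq using P R by simp
  also have "\<bar>\<dots>\<bar> \<le> (\<integral>e. \<bar>R e\<bar> \<partial>\<mu>)" by (rule integral_abs_bound)
  also have "\<dots> \<le> (\<integral>e. K * \<bar>s\<bar> ^ 3 * \<bar>e\<bar> ^ 3 \<partial>\<mu>)"
    using R Rb third_moment by (intro integral_mono) auto
  also have "\<dots> = K * third * \<bar>s\<bar> ^ 3" by (simp add: third_def)
  finally show "\<bar>step s f x - f x - s\<^sup>2 * f2 x / 2\<bar> \<le> K * third * \<bar>s\<bar> ^ 3" .
qed

end

locale controlled_walk = noise \<mu> for \<mu> :: "real measure" +
  fixes lo hi :: real
  assumes lo_nonneg: "0 \<le> lo" and lo_le_hi: "lo \<le> hi" and hi_pos: "0 < hi"
begin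

text \<open>\<open>h\<close> is the duration of a step; \<open>sqrt h\<close> is the diffusive
  scaling, so n steps with h = 1/n fill the unit time interval.\<close>

definition bellman :: "real \<Rightarrow> (real \<Rightarrow> real) \<Rightarrow> real \<Rightarrow> real" where
  "bellman h f x = (SUP \<sigma>\<in>{lo..hi}. step (\<sigma> * sqrt h) f x)"

lemma bdd_above_step:
  assumes "bounded_lipschitz B L f" shows "bdd_above ((\<lambda>\<sigma>. step (\<sigma> * sqrt h) f x) ` {lo..hi})"
  using bounded_lipschitzD(2)[OF shifted_mean_bounded_lipschitz[OF assms]] by (auto intro!: bdd_aboveI2)

lemma step_le_bellman:
  assumes "bounded_lipschitz B L f" "\<sigma> \<in> {lo..hi}"
  shows "step (\<sigma> * sqrt h) f x \<le> bellman h f x"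
  unfolding bellman_def using assms by (intro cSUP_upper bdd_above_step)

lemma bellman_least:
  assumes "\<And>\<sigma>. \<sigma> \<in> {lo..hi} \<Longrightarrow> step (\<sigma> * sqrt h) f x \<le> c"
  shows "bellman h f x \<le> c"
  unfolding bellman_def using assms lo_le_hi by (intro cSUP_least) auto

text \<open>A supremum of functions sharing \<open>B\<close> and \<open>L\<close> keeps both
  constants. Hence every iterate has the constants of the initial function, whatever the number of
  steps.\<close>

lemma bellman_bounded_lipschitz:
  assumes f: "bounded_lipschitz B L f" shows "bounded_lipschitz B L (bellman h f)"
  unfolding bounded_lipschitz_def
proof (intro conjI allI)
  note st = bounded_lipschitzD[OF shifted_mean_bounded_lipschitz[OF f]]
  have hi: "hi \<in> {lo..hi}" using lo_le_hi by simp
  show "\<bar>bellman h f x\<bar> \<le> B" for x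
    using order_trans[OF st(3) step_le_bellman[OF f hi, of h x]] bellman_least[OF st(2), of h x] by auto
  have 1: "bellman h f x \<le> bellman h f y + L * \<bar>x - y\<bar>" for x y
  proof (rule bellman_least)
    fix \<sigma> assume "\<sigma> \<in> {lo..hi}"
    then show "step (\<sigma> * sqrt h) f x \<le> bellman h f y + L * \<bar>x - y\<bar>"
      using st(7)[of "\<sigma> * sqrt h" x y] step_le_bellman[OF f, of \<sigma> h y] by simp
  qed
  show "\<bar>bellman h f x - bellman h f y\<bar> \<le> L * \<bar>x - y\<bar>" for x y
    using 1[of x y] 1[of y x] by (simp add: abs_minus_commute abs_le_iff)
qed

lemma bellman_iter_bounded_lipschitz:
  assumes "bounded_lipschitz B L f" shows "bounded_lipschitz B L ((bellman h ^^ n) f)"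
  by (induction n) (auto intro: assms bellman_bounded_lipschitz)

text \<open>Discrete comparison principle: by monotonicity of \<open>step\<close>, an upper barrier
  that loses at most \<open>d\<close> per step for every volatility stays above the iterates, and
  the losses add up.\<close>

lemma bellman_iter_upper:
  assumes f: "bounded_lipschitz B L f"
    and init: "\<And>x. f x \<le> U 0 x"
    and int: "\<And>k x \<sigma>. k < n \<Longrightarrow> \<sigma> \<in> {lo..hi} \<Longrightarrow> integrable \<mu> (\<lambda>e. U k (x + \<sigma> * sqrt h * e))"
    and super: "\<And>k x \<sigma>. k < n \<Longrightarrow> \<sigma> \<in> {lo..hi} \<Longrightarrow> step (\<sigma> * sqrt h) (U k) x \<le> U (Suc k) x + d"
  shows "(bellman h ^^ n) f x \<le> U n x + real n * d"
proof -
  have "k \<le> n \<Longrightarrow> (bellman h ^^ k) f x \<le> U k x + real k * d" for k x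
  proof (induction k arbitrary: x)
    case (Suc k)
    let ?v = "(bellman h ^^ k) f"
    have v: "bounded_lipschitz B L ?v" by (rule bellman_iter_bounded_lipschitz[OF f])
    have "bellman h ?v x \<le> U (Suc k) x + real (Suc k) * d"
    proof (rule bellman_least)
      fix \<sigma> assume \<sigma>: "\<sigma> \<in> {lo..hi}"
      have k: "k < n" using Suc by simp
      have "step (\<sigma> * sqrt h) ?v x \<le> step (\<sigma> * sqrt h) (\<lambda>y. U k y + real k * d) x"
        using Suc int[OF k \<sigma>] by (intro shifted_mean_mono integrable_bounded_lipschitz[OF v]) auto
      also have "\<dots> = step (\<sigma> * sqrt h) (U k) x + real k * d"
        using int[OF k \<sigma>] by (simp add: shifted_mean_def prob_space)
      also have "\<dots> \<le> U (Suc k) x + real (Suc k) * d"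
        using super[OF k \<sigma>, of x] by (simp add: algebra_simps)
      finally show "step (\<sigma> * sqrt h) ?v x \<le> U (Suc k) x + real (Suc k) * d" .
    qed
    then show ?case by simp
  qed (simp add: init)
  then show ?thesis by simp
qed

text \<open>The lower counterpart asks less of the barrier: as \<open>bellman\<close> is a supremum,
  one good volatility at each point suffices.\<close>

lemma bellman_iter_lower:
  assumes f: "bounded_lipschitz B L f"
    and init: "\<And>x. U 0 x \<le> f x"
    and int: "\<And>k x \<sigma>. k < n \<Longrightarrow> \<sigma> \<in> {lo..hi} \<Longrightarrow> integrable \<mu> (\<lambda>e. U k (x + \<sigma> * sqrt h * e))"
    and sub: "\<And>k x. k < n \<Longrightarrow> \<exists>\<sigma>\<in>{lo..hi}. U (Suc k) x \<le> step (\<sigma> * sqrt h) (U k) x + d"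
  shows "U n x \<le> (bellman h ^^ n) f x + real n * d"
proof -
  have "k \<le> n \<Longrightarrow> U k x \<le> (bellman h ^^ k) f x + real k * d" for k x
  proof (induction k arbitrary: x)
    case (Suc k)
    let ?v = "(bellman h ^^ k) f"
    have v: "bounded_lipschitz B L ?v" by (rule bellman_iter_bounded_lipschitz[OF f])
    have k: "k < n" using Suc by simp
    obtain \<sigma> where \<sigma>: "\<sigma> \<in> {lo..hi}" and le: "U (Suc k) x \<le> step (\<sigma> * sqrt h) (U k) x + d"
      using sub[OF k] by blast
    have "step (\<sigma> * sqrt h) (U k) x \<le> step (\<sigma> * sqrt h) (\<lambda>y. ?v y + real k * d) x"
      using Suc int[OF k \<sigma>] integrable_bounded_lipschitz[OF v] by (intro shifted_mean_mono) auto
    also have "\<dots> = step (\<sigma> * sqrt h) ?v x + real k * d"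
      using integrable_bounded_lipschitz[OF v] by (simp add: shifted_mean_def prob_space)
    also have "\<dots> \<le> bellman h ?v x + real k * d"
      using step_le_bellman[OF v \<sigma>] by simp
    finally show ?case using le by (simp add: algebra_simps)
  qed (simp add: init)
  then show ?thesis by simp
qed

text \<open>The interval of volatilities is compact and \<open>step\<close> depends continuously on
  the scale. The exact maximiser is the starting point of the feedback controls and of the scaling
  lemma below.\<close>

lemma bellman_attained:
  assumes v: "bounded_lipschitz B L v"
  shows "\<exists>\<sigma>\<in>{lo..hi}. bellman h v x = step (\<sigma> * sqrt h) v x"
proof -
  have "continuous_on {lo..hi} (\<lambda>\<sigma>. step (\<sigma> * sqrt h) v x)"
  proof (rule lipschitz_on_continuous_on)
    show "(L * \<bar>sqrt h\<bar>)-lipschitz_on {lo..hi} (\<lambda>\<sigma>. step (\<sigma> * sqrt h) v x)"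
    proof (rule lipschitz_onI)
      fix s t
      have "\<bar>s * sqrt h - t * sqrt h\<bar> = \<bar>sqrt h\<bar> * \<bar>s - t\<bar>"
        by (simp add: left_diff_distrib[symmetric] abs_mult mult.commute)
      then show "dist (step (s * sqrt h) v x) (step (t * sqrt h) v x) \<le> L * \<bar>sqrt h\<bar> * dist s t"
        using step_lipschitz_scale[OF v, of "s * sqrt h" x "t * sqrt h"] by (simp add: dist_real_def mult.assoc)
    qed (use bounded_lipschitzD(6)[OF v] in simp)
  qed
  then obtain \<sigma> where \<sigma>: "\<sigma> \<in> {lo..hi}"
    and max: "\<And>t. t \<in> {lo..hi} \<Longrightarrow> step (t * sqrt h) v x \<le> step (\<sigma> * sqrt h) v x"
    using continuous_attains_sup[of "{lo..hi}" "\<lambda>\<sigma>. step (\<sigma> * sqrt h) v x"] lo_le_hi by auto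
  then have "bellman h v x = step (\<sigma> * sqrt h) v x"
    by (intro antisym bellman_least step_le_bellman[OF v])
  then show ?thesis using \<sigma> by blast
qed

lemma bellman_iter_ge_const:
  assumes f: "bounded_lipschitz B L f" and ge: "\<And>x. c \<le> f x"
  shows "c \<le> (bellman h ^^ n) f x"
proof -
  have "c \<le> (bellman h ^^ n) f x + real n * 0"
    by (rule bellman_iter_lower[OF f, where U = "\<lambda>_ _. c"]) (use ge lo_le_hi in auto)
  then show ?thesis by simp
qed

lemma bellman_mono:
  assumes f: "bounded_lipschitz B L f" and g: "bounded_lipschitz B' L' g" and le: "\<And>x. f x \<le> g x"
  shows "bellman h f x \<le> bellman h g x"
proof (rule bellman_least)
  fix \<sigma> assume \<sigma>: "\<sigma> \<in> {lo..hi}"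
  have "step (\<sigma> * sqrt h) f x \<le> step (\<sigma> * sqrt h) g x"
    using le by (intro shifted_mean_mono integrable_bounded_lipschitz[OF f] integrable_bounded_lipschitz[OF g])
  then show "step (\<sigma> * sqrt h) f x \<le> bellman h g x"
    using step_le_bellman[OF g \<sigma>, of h x] by simp
qed

lemma bellman_iter_mono:
  assumes f: "bounded_lipschitz B L f" and g: "bounded_lipschitz B' L' g" and le: "\<And>x. f x \<le> g x"
  shows "(bellman h ^^ n) f x \<le> (bellman h ^^ n) g x"
proof (induction n arbitrary: x)
  case (Suc n)
  then show ?case
    using bellman_mono[OF bellman_iter_bounded_lipschitz[OF f] bellman_iter_bounded_lipschitz[OF g]]
    by simp
qed (simp add: le)

lemma bellman_add:
  assumes f: "bounded_lipschitz B L f" and g: "bounded_lipschitz B' L' g"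
  shows "bellman h (\<lambda>x. f x + g x) x \<le> bellman h f x + bellman h g x"
proof (rule bellman_least)
  fix \<sigma> assume \<sigma>: "\<sigma> \<in> {lo..hi}"
  have "step (\<sigma> * sqrt h) (\<lambda>x. f x + g x) x = step (\<sigma> * sqrt h) f x + step (\<sigma> * sqrt h) g x"
    unfolding shifted_mean_def
    using integrable_bounded_lipschitz[OF f] integrable_bounded_lipschitz[OF g] by simp
  then show "step (\<sigma> * sqrt h) (\<lambda>x. f x + g x) x \<le> bellman h f x + bellman h g x"
    using step_le_bellman[OF f \<sigma>, of h x] step_le_bellman[OF g \<sigma>, of h x] by simp
qed

text \<open>Subadditivity of a supremum survives iteration by monotonicity. It splits a two-sided
  problem into two one-sided ones.\<close>

lemma bellman_iter_add:
  assumes f: "bounded_lipschitz B L f" and g: "bounded_lipschitz B' L' g"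
  shows "(bellman h ^^ n) (\<lambda>x. f x + g x) x \<le> (bellman h ^^ n) f x + (bellman h ^^ n) g x"
proof (induction n arbitrary: x)
  case (Suc n)
  let ?f = "(bellman h ^^ n) f" and ?g = "(bellman h ^^ n) g"
  note fn = bellman_iter_bounded_lipschitz[OF f, of n h] and gn = bellman_iter_bounded_lipschitz[OF g, of n h]
  have "bellman h ((bellman h ^^ n) (\<lambda>x. f x + g x)) x \<le> bellman h (\<lambda>x. ?f x + ?g x) x"
    using bellman_mono[OF bellman_iter_bounded_lipschitz[OF bounded_lipschitz_add[OF f g]]
        bounded_lipschitz_add[OF fn gn]] Suc by simp
  also have "\<dots> \<le> bellman h ?f x + bellman h ?g x" by (rule bellman_add[OF fn gn])
  finally show ?case by simp
qed simp

text \<open>The scaled iterates are their own lower barrier, with the maximiser of the unscaled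
  problem as volatility.\<close>

lemma bellman_iter_scale:
  assumes f: "bounded_lipschitz B L f" and a: "0 \<le> a"
  shows "a * (bellman h ^^ n) f x \<le> (bellman h ^^ n) (\<lambda>x. a * f x) x"
proof -
  have "a * (bellman h ^^ n) f x \<le> (bellman h ^^ n) (\<lambda>x. a * f x) x + real n * 0"
  proof (rule bellman_iter_lower[where U = "\<lambda>k x. a * (bellman h ^^ k) f x"])
    show "bounded_lipschitz (a * B) (a * L) (\<lambda>x. a * f x)" by (rule bounded_lipschitz_scale[OF f a])
    show "integrable \<mu> (\<lambda>e. a * (bellman h ^^ k) f (x + \<sigma> * sqrt h * e))" for k x \<sigma>
      using integrable_bounded_lipschitz[OF bellman_iter_bounded_lipschitz[OF f]] by simp
  next
    fix k x
    let ?v = "(bellman h ^^ k) f"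
    have v: "bounded_lipschitz B L ?v" by (rule bellman_iter_bounded_lipschitz[OF f])
    have st: "step s (\<lambda>x. a * ?v x) x = a * step s ?v x" for s by (simp add: shifted_mean_def)
    obtain \<sigma> where \<sigma>: "\<sigma> \<in> {lo..hi}" and max: "bellman h ?v x = step (\<sigma> * sqrt h) ?v x"
      using bellman_attained[OF v] by blast
    show "\<exists>\<sigma>\<in>{lo..hi}. a * (bellman h ^^ Suc k) f x \<le> step (\<sigma> * sqrt h) (\<lambda>x. a * ?v x) x + 0"
      using \<sigma> max by (intro bexI[of _ \<sigma>]) (auto simp: st)
  qed simp
  then show ?thesis by simp
qed

text \<open>Brownian scaling: a dilation of space by \<open>c\<close> turns the step size
  \<open>sqrt h\<close> into \<open>sqrt (c\<^sup>2 * h)\<close>.\<close>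

lemma bellman_iter_dilate:
  assumes "0 < c"
  shows "(bellman h ^^ n) (\<lambda>x. f (c * x)) x = (bellman (c\<^sup>2 * h) ^^ n) f (c * x)"
proof (induction n arbitrary: x)
  case (Suc n)
  have "(bellman h ^^ n) (\<lambda>x. f (c * x)) = (\<lambda>x. (bellman (c\<^sup>2 * h) ^^ n) f (c * x))"
    using Suc by blast
  moreover have "sqrt (c\<^sup>2 * h) = c * sqrt h" using assms by (simp add: real_sqrt_mult)
  moreover have "bellman h (\<lambda>x. g (c * x)) x = bellman (c\<^sup>2 * h) g (c * x)" for g
    unfolding bellman_def shifted_mean_def using calculation(2) by (simp add: algebra_simps)
  ultimately show ?case by simp
qed simp

end

subsection \<open>Parabolic barriers\<close>

text \<open>These bounds make a step of duration h match the equation up to order h * sqrt h: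
  Taylor's formula in space needs \<open>V2\<close> Lipschitz in x, the mean value theorem in time
  needs \<open>Vt\<close> Lipschitz in \<tau>. Times below \<open>\<delta>\<close> are left out
  since the self-similar barriers are singular at 0.\<close>

definition parabolic_regular ::
    "real \<Rightarrow> real \<Rightarrow> (real \<Rightarrow> real \<Rightarrow> real) \<Rightarrow> (real \<Rightarrow> real \<Rightarrow> real) \<Rightarrow> (real \<Rightarrow> real \<Rightarrow> real) \<Rightarrow>
      (real \<Rightarrow> real \<Rightarrow> real) \<Rightarrow> bool" where
  "parabolic_regular \<delta> K V V1 V2 Vt \<longleftrightarrow>
    (\<forall>\<tau>\<ge>\<delta>. \<forall>x. (V \<tau> has_real_derivative V1 \<tau> x) (at x) \<and> (V1 \<tau> has_real_derivative V2 \<tau> x) (at x) \<and>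
      ((\<lambda>\<tau>. V \<tau> x) has_real_derivative Vt \<tau> x) (at \<tau>)) \<and>
    (\<forall>\<tau>\<ge>\<delta>. \<forall>x y. \<bar>V2 \<tau> x - V2 \<tau> y\<bar> \<le> K * \<bar>x - y\<bar>) \<and>
    (\<forall>\<tau>\<ge>\<delta>. \<forall>\<tau>'\<ge>\<delta>. \<forall>x. \<bar>Vt \<tau> x - Vt \<tau>' x\<bar> \<le> K * \<bar>\<tau> - \<tau>'\<bar>)"

lemma parabolic_regularD:
  assumes "parabolic_regular \<delta> K V V1 V2 Vt" "\<delta> \<le> \<tau>"
  shows "(V \<tau> has_real_derivative V1 \<tau> x) (at x)" "(V1 \<tau> has_real_derivative V2 \<tau> x) (at x)"
    "((\<lambda>\<tau>. V \<tau> x) has_real_derivative Vt \<tau> x) (at \<tau>)"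
    "\<bar>V2 \<tau> x - V2 \<tau> y\<bar> \<le> K * \<bar>x - y\<bar>" "\<delta> \<le> \<tau>' \<Longrightarrow> \<bar>Vt \<tau> x - Vt \<tau>' x\<bar> \<le> K * \<bar>\<tau> - \<tau>'\<bar>" "0 \<le> K"
proof -
  show 1: "\<bar>V2 \<tau> x - V2 \<tau> y\<bar> \<le> K * \<bar>x - y\<bar>" for x y using assms unfolding parabolic_regular_def by blast
  show "0 \<le> K" using 1[of 0 1] by simp
qed (use assms in \<open>unfold parabolic_regular_def, blast+\<close>)

lemma parabolic_regular_add:
  assumes V: "parabolic_regular \<delta> K V V1 V2 Vt" and W: "parabolic_regular \<delta> K' W W1 W2 Wt"
  shows "parabolic_regular \<delta> (K + K') (\<lambda>\<tau> x. V \<tau> x + W \<tau> x) (\<lambda>\<tau> x. V1 \<tau> x + W1 \<tau> x)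
    (\<lambda>\<tau> x. V2 \<tau> x + W2 \<tau> x) (\<lambda>\<tau> x. Vt \<tau> x + Wt \<tau> x)"
  unfolding parabolic_regular_def
proof (intro conjI allI impI)
  fix \<tau> \<tau>' x y assume \<tau>: "\<delta> \<le> \<tau>"
  note V = parabolic_regularD[OF V \<tau>] and W = parabolic_regularD[OF W \<tau>]
  show "((\<lambda>x. V \<tau> x + W \<tau> x) has_real_derivative V1 \<tau> x + W1 \<tau> x) (at x)"
    "((\<lambda>x. V1 \<tau> x + W1 \<tau> x) has_real_derivative V2 \<tau> x + W2 \<tau> x) (at x)"
    "((\<lambda>\<tau>. V \<tau> x + W \<tau> x) has_real_derivative Vt \<tau> x + Wt \<tau> x) (at \<tau>)"
    by (intro DERIV_add V W)+
  show "\<bar>V2 \<tau> x + W2 \<tau> x - (V2 \<tau> y + W2 \<tau> y)\<bar> \<le> (K + K') * \<bar>x - y\<bar>"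
    using V(4)[of x y] W(4)[of x y] by (simp add: distrib_right)
  show "\<bar>Vt \<tau> x + Wt \<tau> x - (Vt \<tau>' x + Wt \<tau>' x)\<bar> \<le> (K + K') * \<bar>\<tau> - \<tau>'\<bar>" if "\<delta> \<le> \<tau>'"
    using V(5)[OF that, of x] W(5)[OF that, of x] by (simp add: distrib_right)
qed

context controlled_walk
begin

text \<open>Consistency of the walk with the generator: the Taylor error in space and the mean value
  error in time are both at most of order h * sqrt h.\<close>

lemma parabolic_step:
  assumes V: "parabolic_regular \<delta> K V V1 V2 Vt" and \<tau>: "\<delta> \<le> \<tau>" and h: "0 < h" "h \<le> 1"
    and \<sigma>: "\<sigma> \<in> {lo..hi}"
  shows "integrable \<mu> (\<lambda>e. V \<tau> (x + \<sigma> * sqrt h * e))"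
    and "\<bar>step (\<sigma> * sqrt h) (V \<tau>) x - V (\<tau> + h) x - h * (\<sigma>\<^sup>2 * V2 \<tau> x / 2 - Vt \<tau> x)\<bar>
      \<le> h * (K * (third * hi ^ 3 + 1) * sqrt h)"
proof -
  note V' = parabolic_regularD[OF V \<tau>]
  note K = V'(6)
  note taylor = step_taylor[OF V'(1) V'(2) V'(4)]
  show "integrable \<mu> (\<lambda>e. V \<tau> (x + \<sigma> * sqrt h * e))" by (rule taylor(1))
  have "\<bar>step (\<sigma> * sqrt h) (V \<tau>) x - V \<tau> x - (\<sigma> * sqrt h)\<^sup>2 * V2 \<tau> x / 2\<bar> \<le> K * third * \<bar>\<sigma> * sqrt h\<bar> ^ 3"
    by (rule taylor(2))
  also have "\<dots> \<le> K * third * (hi * sqrt h) ^ 3"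
    using \<sigma> lo_nonneg h K third_nonneg
    by (intro mult_left_mono power_mono) (auto simp: abs_mult mult_right_mono)
  also have "(hi * sqrt h) ^ 3 = hi ^ 3 * sqrt h * h"
    using h by (simp add: power_mult_distrib power3_eq_cube)
  finally have 1: "\<bar>step (\<sigma> * sqrt h) (V \<tau>) x - V \<tau> x - h * (\<sigma>\<^sup>2 * V2 \<tau> x / 2)\<bar> \<le> h * (K * (third * hi ^ 3) * sqrt h)"
    using h by (simp add: power_mult_distrib mult_ac)
  have "\<exists>s. \<tau> < s \<and> s < \<tau> + h \<and> V (\<tau> + h) x - V \<tau> x = (\<tau> + h - \<tau>) * Vt s x"
    using h \<tau> by (intro MVT2) (auto intro!: parabolic_regularD(3)[OF V])
  then obtain s where s: "\<tau> < s" "s < \<tau> + h" "V (\<tau> + h) x - V \<tau> x = h * Vt s x" by auto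
  have "\<bar>Vt s x - Vt \<tau> x\<bar> \<le> K * \<bar>s - \<tau>\<bar>"
    using parabolic_regularD(5)[OF V _ \<tau>, of s x] s \<tau> by simp
  also have "\<dots> \<le> K * h" using s K by (intro mult_left_mono) auto
  \<comment> \<open>The time error is of order h * h; with h at most 1 it is absorbed into the order
    h * sqrt h of the space error.\<close>
  also have "h \<le> sqrt h" using h by (intro real_le_rsqrt) (simp add: power2_eq_square mult_left_le)
  then have "K * h \<le> K * sqrt h" using K by (rule mult_left_mono)
  finally have "h * \<bar>Vt s x - Vt \<tau> x\<bar> \<le> h * (K * sqrt h)" using h by (intro mult_left_mono) auto
  then have 2: "\<bar>V (\<tau> + h) x - V \<tau> x - h * Vt \<tau> x\<bar> \<le> h * (K * sqrt h)"
    using h unfolding s(3) by (simp add: right_diff_distrib[symmetric] abs_mult)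
  show "\<bar>step (\<sigma> * sqrt h) (V \<tau>) x - V (\<tau> + h) x - h * (\<sigma>\<^sup>2 * V2 \<tau> x / 2 - Vt \<tau> x)\<bar>
      \<le> h * (K * (third * hi ^ 3 + 1) * sqrt h)"
    using 1 2 by (simp add: algebra_simps abs_le_iff)
qed

text \<open>The one-step errors sum to at most \<open>\<kappa> + C\<close> since n h is at most 1.
  The slack \<open>\<kappa>\<close> admits barriers that violate the supersolution inequality
  slightly; the fronts do so when their inner volatility exceeds \<open>lo\<close>.\<close>

lemma parabolic_upper:
  assumes V: "parabolic_regular \<delta> K V V1 V2 Vt" and f: "bounded_lipschitz B L f"
    and init: "\<And>x. f x \<le> V \<delta> x + e"
    and super: "\<And>\<tau> x \<sigma>. \<delta> \<le> \<tau> \<Longrightarrow> \<tau> \<le> \<delta> + 1 \<Longrightarrow> \<sigma> \<in> {lo..hi} \<Longrightarrow> \<sigma>\<^sup>2 * V2 \<tau> x / 2 \<le> Vt \<tau> x + \<kappa>"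
    and \<kappa>: "0 \<le> \<kappa>" and h: "0 < h" "h \<le> 1" and n: "real n * h \<le> 1"
  shows "(bellman h ^^ n) f x \<le> V (\<delta> + real n * h) x + e + \<kappa> + K * (third * hi ^ 3 + 1) * sqrt h"
proof -
  define C where "C = K * (third * hi ^ 3 + 1) * sqrt h"
  have C: "0 \<le> C"
    using parabolic_regularD(6)[OF V order_refl] third_nonneg hi_pos h by (simp add: C_def)
  have "(bellman h ^^ n) f x \<le> (V (\<delta> + real n * h) x + e) + real n * (h * (\<kappa> + C))"
  proof (rule bellman_iter_upper[OF f, where U = "\<lambda>k x. V (\<delta> + real k * h) x + e"])
    show "f x \<le> V (\<delta> + real 0 * h) x + e" for x using init by simp
    fix k x \<sigma> assume k: "k < n" and \<sigma>: "\<sigma> \<in> {lo..hi}"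
    have "real k * h \<le> real n * h" using k h by (intro mult_right_mono) auto
    then have "real k * h \<le> 1" using n by simp
    then have \<tau>: "\<delta> \<le> \<delta> + real k * h" "\<delta> + real k * h \<le> \<delta> + 1" using h by simp_all
    note st = parabolic_step[OF V \<tau>(1) h \<sigma>, of x]
    show "integrable \<mu> (\<lambda>ea. V (\<delta> + real k * h) (x + \<sigma> * sqrt h * ea) + e)"
      using st(1) by simp
    have "step (\<sigma> * sqrt h) (\<lambda>x. V (\<delta> + real k * h) x + e) x = step (\<sigma> * sqrt h) (V (\<delta> + real k * h)) x + e"
      using st(1) by (simp add: shifted_mean_def)
    moreover have "h * (\<sigma>\<^sup>2 * V2 (\<delta> + real k * h) x / 2 - Vt (\<delta> + real k * h) x) \<le> h * \<kappa>"
      using super[OF \<tau> \<sigma>, of x] h by (intro mult_left_mono) auto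
    ultimately show "step (\<sigma> * sqrt h) (\<lambda>x. V (\<delta> + real k * h) x + e) x \<le> V (\<delta> + real (Suc k) * h) x + e + h * (\<kappa> + C)"
      using st(2) unfolding C_def abs_le_iff by (simp add: algebra_simps)
  qed
  moreover have "real n * (h * (\<kappa> + C)) \<le> \<kappa> + C"
    using mult_right_mono[OF n, of "\<kappa> + C"] \<kappa> C by (simp add: mult.assoc)
  ultimately show ?thesis by (simp add: C_def)
qed

text \<open>Again one volatility per point is enough, and it may vary with time and place;
  \<open>e\<close> absorbs the mismatch of the initial data.\<close>

lemma parabolic_lower:
  assumes V: "parabolic_regular \<delta> K V V1 V2 Vt" and f: "bounded_lipschitz B L f"
    and init: "\<And>x. V \<delta> x \<le> f x + e"
    and sub: "\<And>\<tau> x. \<delta> \<le> \<tau> \<Longrightarrow> \<tau> \<le> \<delta> + 1 \<Longrightarrow> \<exists>\<sigma>\<in>{lo..hi}. Vt \<tau> x \<le> \<sigma>\<^sup>2 * V2 \<tau> x / 2"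
    and h: "0 < h" "h \<le> 1" and n: "real n * h \<le> 1"
  shows "V (\<delta> + real n * h) x \<le> (bellman h ^^ n) f x + e + K * (third * hi ^ 3 + 1) * sqrt h"
proof -
  define C where "C = K * (third * hi ^ 3 + 1) * sqrt h"
  have C: "0 \<le> C"
    using parabolic_regularD(6)[OF V order_refl] third_nonneg hi_pos h by (simp add: C_def)
  have "V (\<delta> + real n * h) x - e \<le> (bellman h ^^ n) f x + real n * (h * C)"
  proof (rule bellman_iter_lower[OF f, where U = "\<lambda>k x. V (\<delta> + real k * h) x - e"])
    show "V (\<delta> + real 0 * h) x - e \<le> f x" for x using init[of x] by simp
    fix k x assume k: "k < n"
    have "real k * h \<le> real n * h" using k h by (intro mult_right_mono) auto
    then have "real k * h \<le> 1" using n by simp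
    then have \<tau>: "\<delta> \<le> \<delta> + real k * h" "\<delta> + real k * h \<le> \<delta> + 1" using h by simp_all
    note st = parabolic_step[OF V \<tau>(1) h, of _ x]
    show "integrable \<mu> (\<lambda>ea. V (\<delta> + real k * h) (x + \<sigma> * sqrt h * ea) - e)" if "\<sigma> \<in> {lo..hi}" for \<sigma>
      using st(1)[OF that] by simp
    obtain \<sigma> where \<sigma>: "\<sigma> \<in> {lo..hi}"
      and le: "Vt (\<delta> + real k * h) x \<le> \<sigma>\<^sup>2 * V2 (\<delta> + real k * h) x / 2" using sub[OF \<tau>] by blast
    have "step (\<sigma> * sqrt h) (\<lambda>x. V (\<delta> + real k * h) x - e) x = step (\<sigma> * sqrt h) (V (\<delta> + real k * h)) x - e"
      using st(1)[OF \<sigma>] by (simp add: shifted_mean_def)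
    moreover have "0 \<le> h * (\<sigma>\<^sup>2 * V2 (\<delta> + real k * h) x / 2 - Vt (\<delta> + real k * h) x)"
      using le h by simp
    ultimately have "V (\<delta> + real (Suc k) * h) x - e \<le> step (\<sigma> * sqrt h) (\<lambda>x. V (\<delta> + real k * h) x - e) x + h * C"
      using st(2)[OF \<sigma>] unfolding C_def abs_le_iff by (simp add: algebra_simps)
    then show "\<exists>\<sigma>\<in>{lo..hi}. V (\<delta> + real (Suc k) * h) x - e \<le> step (\<sigma> * sqrt h) (\<lambda>x. V (\<delta> + real k * h) x - e) x + h * C"
      using \<sigma> by blast
  qed
  moreover have "real n * (h * C) \<le> C"
    using mult_right_mono[OF n, of C] C by (simp add: mult.assoc)
  ultimately show ?thesis by (simp add: C_def)
qed

end

subsection \<open>The standard normal distribution function\<close>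

interpretation std_normal: real_distribution std_normal_distribution
  by (rule real_dist_normal_dist)

definition Phi :: "real \<Rightarrow> real" where
  "Phi = cdf std_normal_distribution"

lemma DERIV_std_normal_density:
  "(std_normal_density has_real_derivative - x * std_normal_density x) (at x)"
proof -
  define c where "c = 1 / sqrt (2 * pi)"
  have "std_normal_density = (\<lambda>x. c * exp (- x\<^sup>2 / 2))"
    by (simp add: std_normal_density_def fun_eq_iff c_def)
  moreover have "((\<lambda>x. c * exp (- x\<^sup>2 / 2)) has_real_derivative - x * (c * exp (- x\<^sup>2 / 2))) (at x)"
    by (auto intro!: derivative_eq_intros)
  ultimately show ?thesis by simp
qed

lemma std_normal_density_minus [simp]: "std_normal_density (- x) = std_normal_density x"
  by (simp add: std_normal_density_def)

text \<open>\<open>Phi\<close> is the distribution function of a measure, so its increments are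
  compared with those of an antiderivative \<open>P\<close> of the density through the fundamental
  theorem of calculus.\<close>

lemma DERIV_Phi: "(Phi has_real_derivative std_normal_density x) (at x)"
proof -
  have cont: "isCont std_normal_density x" for x
    using DERIV_std_normal_density DERIV_isCont by blast
  obtain P where P: "\<And>x. (P has_vector_derivative std_normal_density x) (at x)"
    using einterval_antiderivative[of "-\<infinity>" "\<infinity>" std_normal_density] cont by auto
  then have P: "(P has_real_derivative std_normal_density x) (at x)" for x
    by (simp add: has_real_derivative_iff_has_vector_derivative)
  have inc: "Phi b - Phi a = P b - P a" if "a \<le> b" for a b
  proof (cases "a = b")
    case False
    let ?N = std_normal_distribution
    have cdf: "Phi b - Phi a = measure ?N {a<..b}"
      unfolding Phi_def using that False by (intro std_normal.cdf_diff_eq) auto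
    have "emeasure ?N {a<..b} = (\<integral>\<^sup>+x. ennreal (std_normal_density x * indicator {a..b} x) \<partial>lborel)"
    proof (subst emeasure_density)
      show "(\<integral>\<^sup>+x. ennreal (std_normal_density x) * indicator {a<..b} x \<partial>lborel) =
          (\<integral>\<^sup>+x. ennreal (std_normal_density x * indicator {a..b} x) \<partial>lborel)"
        using AE_lborel_singleton[of a]
        by (intro nn_integral_cong_AE) (auto simp: indicator_def split: if_splits)
    qed auto
    also have "\<dots> = ennreal (\<integral>x. std_normal_density x * indicator {a..b} x \<partial>lborel)"
      using has_bochner_integral_FTC_Icc_real[OF that P cont]
      by (intro nn_integral_eq_integral) (auto simp: has_bochner_integral_iff)
    also have "(\<integral>x. std_normal_density x * indicator {a..b} x \<partial>lborel) = P b - P a"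
      by (rule integral_FTC_Icc_real[OF that P cont])
    finally have "emeasure ?N {a<..b} = ennreal (P b - P a)" .
    moreover have "P a \<le> P b"
      by (rule DERIV_nonneg_imp_nondecreasing[OF that]) (use P in \<open>auto intro!: exI\<close>)
    ultimately show ?thesis using cdf by (simp add: measure_def)
  qed simp
  have "Phi y = P y + (Phi 0 - P 0)" for y using inc[of 0 y] inc[of y 0] by linarith
  then have "Phi = (\<lambda>y. P y + (Phi 0 - P 0))" by blast
  moreover have "((\<lambda>y. P y + (Phi 0 - P 0)) has_real_derivative std_normal_density x) (at x)"
    using DERIV_add[OF P DERIV_const] by simp
  ultimately show ?thesis by metis
qed

lemma Phi_at_top: "(Phi \<longlongrightarrow> 1) at_top" and Phi_at_bot: "(Phi \<longlongrightarrow> 0) at_bot"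
  and Phi_nonneg: "0 \<le> Phi x" and Phi_le_1: "Phi x \<le> 1"
  unfolding Phi_def by (rule std_normal.cdf_lim_at_top_prob std_normal.cdf_lim_at_bot
      std_normal.cdf_nonneg std_normal.cdf_bounded_prob)+

lemma Phi_mono: "x \<le> y \<Longrightarrow> Phi x \<le> Phi y"
  unfolding Phi_def by (rule std_normal.cdf_nondecreasing)

lemma isCont_Phi: "isCont Phi x"
  using DERIV_Phi DERIV_isCont by blast

text \<open>By symmetry of the density, Phi y + Phi (- y) has derivative 0; its constant value is
  read off at infinity.\<close>

lemma Phi_0: "Phi 0 = 1 / 2"
proof -
  have "((\<lambda>y. Phi y + Phi (- y)) has_real_derivative 0) (at y)" for y
    using DERIV_add[OF DERIV_Phi[of y] DERIV_chain2[OF DERIV_Phi DERIV_minus[OF DERIV_ident]]] by simp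
  then have "Phi y + Phi (- y) = Phi 0 + Phi (- 0)" for y
    using DERIV_isconst_all[of "\<lambda>y. Phi y + Phi (- y)"] by blast
  moreover have "((\<lambda>y. Phi y + Phi (- y)) \<longlongrightarrow> 1 + 0) at_top"
    by (intro tendsto_add Phi_at_top filterlim_compose[OF Phi_at_bot filterlim_uminus_at_bot_at_top])
  ultimately have "((\<lambda>y::real. 2 * Phi 0) \<longlongrightarrow> 1) at_top" by simp
  then show ?thesis by (simp add: tendsto_const_iff)
qed

lemma Phi_pos: "0 < Phi x"
proof (rule ccontr)
  assume "\<not> 0 < Phi x"
  then have 0: "Phi x = 0" using Phi_nonneg[of x] by simp
  have "Phi (x - 1) < Phi x"
    by (rule DERIV_pos_imp_increasing) (auto intro!: exI DERIV_Phi simp: normal_density_pos)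
  then show False using 0 Phi_nonneg[of "x - 1"] by simp
qed

text \<open>The right side minus the left tends to 0 at infinity and has derivative
  \<open>- (2 * std_normal_density y / (1 + y\<^sup>2)\<^sup>2)\<close>, so it decreases to 0. The
  bound later yields the factor \<open>1 + hi\<^sup>2 / c\<^sup>2\<close> of the relative
  error.\<close>

lemma Phi_mills_lower:
  assumes "0 < c" shows "std_normal_density c * (c / (1 + c\<^sup>2)) \<le> Phi (- c)"
proof -
  define D where "D = (\<lambda>c. Phi (- c) - std_normal_density c * (c / (1 + c\<^sup>2)))"
  have D: "(D has_real_derivative - (2 * std_normal_density y / (1 + y\<^sup>2)\<^sup>2)) (at y)" for y
  proof -
    have pos: "1 + y\<^sup>2 \<noteq> 0" using zero_le_power2[of y] by linarith
    have q: "((\<lambda>y. y / (1 + y\<^sup>2)) has_real_derivative (1 * (1 + y\<^sup>2) - y * (2 * y)) / ((1 + y\<^sup>2) * (1 + y\<^sup>2))) (at y)"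
      using pos by (intro DERIV_divide) (auto intro!: derivative_eq_intros)
    have p: "((\<lambda>y. Phi (- y)) has_real_derivative std_normal_density y * -1) (at y)"
      using DERIV_chain2[OF DERIV_Phi DERIV_minus[OF DERIV_ident], of y UNIV] by simp
    show ?thesis unfolding D_def
      by (rule DERIV_cong[OF DERIV_diff[OF p DERIV_mult[OF DERIV_std_normal_density q]]])
        (use pos in \<open>simp add: power2_eq_square divide_simps, simp add: algebra_simps\<close>)
  qed
  have "(D \<longlongrightarrow> 0 - 0) at_top"
    unfolding D_def
  proof (intro tendsto_diff)
    show "((\<lambda>c. Phi (- c)) \<longlongrightarrow> 0) at_top"
      by (rule filterlim_compose[OF Phi_at_bot filterlim_uminus_at_bot_at_top])
    show "((\<lambda>c. std_normal_density c * (c / (1 + c\<^sup>2))) \<longlongrightarrow> 0) at_top"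
      unfolding std_normal_density_def by real_asymp
  qed
  moreover have "eventually (\<lambda>y. D y \<le> D c) at_top"
    using eventually_ge_at_top[of c]
  proof eventually_elim
    case (elim y)
    show ?case
      by (rule DERIV_nonpos_imp_nonincreasing[OF elim]) (use D in \<open>auto intro!: exI[of _ "- _"]\<close>)
  qed
  ultimately have "0 \<le> D c" by (intro tendsto_upperbound[of D 0 at_top "D c"]) auto
  then show ?thesis by (simp add: D_def)
qed

subsection \<open>The fronts\<close>

lemma lipschitz_from_derivative:
  fixes f :: "real \<Rightarrow> real"
  assumes "\<And>x. x \<in> S \<Longrightarrow> (f has_real_derivative f' x) (at x)" "\<And>x. x \<in> S \<Longrightarrow> \<bar>f' x\<bar> \<le> K"
    and "convex S" "x \<in> S" "y \<in> S"
  shows "\<bar>f x - f y\<bar> \<le> K * \<bar>x - y\<bar>"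
proof -
  have "norm (f x - f y) \<le> K * norm (x - y)"
    by (rule field_differentiable_bound[of S f f' K]) (use assms in \<open>auto intro: has_field_derivative_at_within\<close>)
  then show ?thesis by simp
qed

text \<open>With t = z^2/2 the even powers follow from 1 + t + t^2/2 \<le> exp t. Odd powers are
  reduced to even ones by |z| \<le> (1 + z^2)/2; the constants are not sharp.\<close>

lemma gauss_moment_bounds:
  fixes z :: real
  shows "z\<^sup>2 * exp (- z\<^sup>2 / 2) \<le> 1" "z ^ 4 * exp (- z\<^sup>2 / 2) \<le> 8"
    "\<bar>z\<bar> * exp (- z\<^sup>2 / 2) \<le> 1" "\<bar>z\<bar> ^ 3 * exp (- z\<^sup>2 / 2) \<le> 5"
proof -
  define t where "t = z\<^sup>2 / 2"
  have t: "0 \<le> t" by (simp add: t_def)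
  have e: "1 + t + t\<^sup>2 / 2 \<le> exp t" using exp_lower_Taylor_quadratic[OF t] .
  have "0 \<le> (t - 1)\<^sup>2" by simp
  then have "2 * t \<le> exp t" using e t by (simp add: power2_eq_square algebra_simps)
  then have "2 * t * exp (- t) \<le> exp t * exp (- t)" by (intro mult_right_mono) auto
  then show 2: "z\<^sup>2 * exp (- z\<^sup>2 / 2) \<le> 1" by (simp add: t_def exp_add[symmetric])
  have "4 * t\<^sup>2 \<le> 8 * exp t" using e t by simp
  then have "4 * t\<^sup>2 * exp (- t) \<le> 8 * exp t * exp (- t)" by (intro mult_right_mono) auto
  then show 4: "z ^ 4 * exp (- z\<^sup>2 / 2) \<le> 8"
    by (simp add: t_def exp_add[symmetric] mult.assoc power_divide flip: power_mult)
  have 0: "exp (- z\<^sup>2 / 2) \<le> 1" by simp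
  have "\<bar>z\<bar> \<le> (1 + z\<^sup>2) / 2" using zero_le_power2[of "\<bar>z\<bar> - 1"] by (simp add: power2_diff)
  then have "\<bar>z\<bar> * exp (- z\<^sup>2 / 2) \<le> (1 + z\<^sup>2) / 2 * exp (- z\<^sup>2 / 2)" by (intro mult_right_mono) auto
  then show "\<bar>z\<bar> * exp (- z\<^sup>2 / 2) \<le> 1"
    using 0 2 unfolding distrib_right add_divide_distrib times_divide_eq_left mult_1 by argo
  have "\<bar>z\<bar> ^ 3 = \<bar>z\<bar> * z\<^sup>2" by (simp add: power3_eq_cube power2_eq_square)
  also have "\<dots> \<le> (1 + z\<^sup>2) / 2 * z\<^sup>2" using \<open>\<bar>z\<bar> \<le> (1 + z\<^sup>2) / 2\<close> by (intro mult_right_mono) auto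
  also have "\<dots> = (z\<^sup>2 + z ^ 4) / 2" by (simp add: power2_eq_square power4_eq_xxxx algebra_simps)
  finally have "\<bar>z\<bar> ^ 3 * exp (- z\<^sup>2 / 2) \<le> (z\<^sup>2 + z ^ 4) / 2 * exp (- z\<^sup>2 / 2)" by (intro mult_right_mono) auto
  then show "\<bar>z\<bar> ^ 3 * exp (- z\<^sup>2 / 2) \<le> 5" using 2 4 by (simp add: distrib_right)
qed

lemma std_normal_density_le_exp: "std_normal_density z \<le> exp (- z\<^sup>2 / 2)"
proof -
  have "1 \<le> sqrt (2 * pi)" using pi_ge_two by (simp add: real_le_rsqrt)
  then have "1 / sqrt (2 * pi) * exp (- z\<^sup>2 / 2) \<le> 1 * exp (- z\<^sup>2 / 2)"
    by (intro mult_right_mono) (auto simp: divide_le_eq)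
  then show ?thesis by (simp add: std_normal_density_def)
qed

text \<open>Minus the derivative of the Gaussian density, that is, the first Hermite polynomial
  times the density. Second space derivatives and time derivatives of the fronts are multiples of
  it.\<close>

definition hermite1 :: "real \<Rightarrow> real" where "hermite1 z = z * std_normal_density z"

lemma DERIV_hermite1: "(hermite1 has_real_derivative (1 - z\<^sup>2) * std_normal_density z) (at z)"
  unfolding hermite1_def[abs_def]
  by (rule DERIV_cong[OF DERIV_mult[OF DERIV_ident DERIV_std_normal_density]])
    (simp add: power2_eq_square algebra_simps)

lemma hermite1_bounds:
  shows "\<bar>hermite1 z\<bar> \<le> 1" "\<bar>(1 - z\<^sup>2) * std_normal_density z\<bar> \<le> 1"
    "\<bar>z * ((1 - z\<^sup>2) * std_normal_density z)\<bar> \<le> 6"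
proof -
  have nd: "0 \<le> std_normal_density z" by simp
  have m: "a * std_normal_density z \<le> a * exp (- z\<^sup>2 / 2)" if "0 \<le> a" for a
    using that std_normal_density_le_exp by (rule mult_left_mono[rotated])
  note g = gauss_moment_bounds[of z]
  show "\<bar>hermite1 z\<bar> \<le> 1" using m[of "\<bar>z\<bar>"] g by (simp add: hermite1_def abs_mult)
  have "exp (- z\<^sup>2 / 2) \<le> 1" by simp
  then have 1: "std_normal_density z \<le> 1" using m[of 1] by linarith
  have "z\<^sup>2 * std_normal_density z \<le> 1" using m[of "z\<^sup>2"] g by simp
  then show "\<bar>(1 - z\<^sup>2) * std_normal_density z\<bar> \<le> 1"
    using 1 nd mult_nonneg_nonneg[OF zero_le_power2 nd, of z]
    unfolding left_diff_distrib mult_1 abs_le_iff by linarith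
  have "\<bar>z * ((1 - z\<^sup>2) * std_normal_density z)\<bar> = \<bar>z - z ^ 3\<bar> * std_normal_density z"
  proof -
    have "z * ((1 - z\<^sup>2) * std_normal_density z) = (z - z ^ 3) * std_normal_density z"
      by (simp add: power3_eq_cube power2_eq_square algebra_simps)
    then show ?thesis using nd by (simp only: abs_mult abs_of_nonneg)
  qed
  also have "\<dots> \<le> (\<bar>z\<bar> + \<bar>z\<bar> ^ 3) * std_normal_density z"
    using nd by (intro mult_right_mono) (auto simp: abs_triangle_ineq4 power_abs[symmetric])
  also have "\<dots> \<le> (\<bar>z\<bar> + \<bar>z\<bar> ^ 3) * exp (- z\<^sup>2 / 2)" by (rule m) simp
  also have "\<dots> \<le> 6" using g by (simp add: distrib_right)
  finally show "\<bar>z * ((1 - z\<^sup>2) * std_normal_density z)\<bar> \<le> 6" .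
qed

lemma hermite1_lipschitz: "\<bar>hermite1 z - hermite1 w\<bar> \<le> \<bar>z - w\<bar>"
  using lipschitz_from_derivative[where S = UNIV and f = hermite1 and K = 1, OF DERIV_hermite1 hermite1_bounds(2)] by simp

text \<open>The time derivative of a front at a fixed point is a bounded multiple of
  \<open>hermite1 (w / sqrt \<tau>) / \<tau>\<close>, so this is the time regularity asked for by
  \<open>parabolic_regular\<close>.\<close>

lemma hermite1_time_lipschitz:
  assumes \<delta>: "0 < \<delta>" "\<delta> \<le> s" "\<delta> \<le> t"
  shows "\<bar>hermite1 (w / sqrt s) / s - hermite1 (w / sqrt t) / t\<bar> \<le> 4 / \<delta>\<^sup>2 * \<bar>s - t\<bar>"
proof (rule lipschitz_from_derivative[where S = "{\<delta>..}"])
  fix \<tau> assume "\<tau> \<in> {\<delta>..}"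
  then have \<tau>: "\<delta> \<le> \<tau>" "0 < \<tau>" using \<delta> by auto
  define v where "v = w / sqrt \<tau>"
  define D where "D = (1 - v\<^sup>2) * std_normal_density v"
  have "((\<lambda>\<tau>. w / sqrt \<tau>) has_real_derivative - v / (2 * \<tau>)) (at \<tau>)"
    using \<tau> by (auto intro!: derivative_eq_intros simp: v_def field_simps)
  then have "((\<lambda>\<tau>. hermite1 (w / sqrt \<tau>)) has_real_derivative D * (- v / (2 * \<tau>))) (at \<tau>)"
    unfolding D_def v_def by (rule DERIV_chain2[OF DERIV_hermite1])
  from DERIV_divide[OF this DERIV_ident]
  have "((\<lambda>\<tau>. hermite1 (w / sqrt \<tau>) / \<tau>) has_real_derivative
      (D * (- v / (2 * \<tau>)) * \<tau> - hermite1 (w / sqrt \<tau>) * 1) / (\<tau> * \<tau>)) (at \<tau>)"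
    using \<tau> by simp
  also have "(D * (- v / (2 * \<tau>)) * \<tau> - hermite1 (w / sqrt \<tau>) * 1) / (\<tau> * \<tau>) = - (v * D / 2 + hermite1 v) / \<tau>\<^sup>2"
    using \<tau> by (simp add: v_def power2_eq_square field_simps)
  finally show "((\<lambda>\<tau>. hermite1 (w / sqrt \<tau>) / \<tau>) has_real_derivative
      - ((w / sqrt \<tau>) * ((1 - (w / sqrt \<tau>)\<^sup>2) * std_normal_density (w / sqrt \<tau>)) / 2 + hermite1 (w / sqrt \<tau>)) / \<tau>\<^sup>2) (at \<tau>)"
    by (simp add: v_def D_def)
  \<comment> \<open>The two bounds from \<open>hermite1_bounds\<close> give 6/2 + 1.\<close>
  have "\<bar>v * D / 2 + hermite1 v\<bar> \<le> 4"
    using hermite1_bounds(1,3)[of v] by (simp add: D_def abs_le_iff)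
  then have "\<bar>v * D / 2 + hermite1 v\<bar> / \<tau>\<^sup>2 \<le> 4 / \<tau>\<^sup>2" by (rule divide_right_mono) simp
  also have "\<dots> \<le> 4 / \<delta>\<^sup>2" using \<tau> \<delta> by (intro divide_left_mono) auto
  finally show "\<bar>- ((w / sqrt \<tau>) * ((1 - (w / sqrt \<tau>)\<^sup>2) * std_normal_density (w / sqrt \<tau>)) / 2 + hermite1 (w / sqrt \<tau>)) / \<tau>\<^sup>2\<bar> \<le> 4 / \<delta>\<^sup>2"
    unfolding v_def[symmetric] D_def[symmetric] abs_divide abs_minus_cancel by simp
qed (use \<delta> in auto)

text \<open>At 0 the difference quotients from the left and from the right have the same limit. The
  lemma glues the branches of the profile and of its first derivative; the second derivative may
  have a kink and is only shown to be Lipschitz.\<close>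

lemma DERIV_If_le_0:
  fixes f g f' g' :: "real \<Rightarrow> real"
  assumes f: "\<And>y. y \<le> 0 \<Longrightarrow> (f has_real_derivative f' y) (at y)"
    and g: "\<And>y. 0 \<le> y \<Longrightarrow> (g has_real_derivative g' y) (at y)"
    and eq: "f 0 = g 0" "f' 0 = g' 0"
  shows "((\<lambda>y. if y \<le> 0 then f y else g y) has_real_derivative (if x \<le> 0 then f' x else g' x)) (at x)"
proof (cases "x = 0")
  case True
  let ?F = "\<lambda>y. if y \<le> 0 then f y else g y"
  have "((\<lambda>y. (?F y - ?F 0) / (y - 0)) \<longlongrightarrow> f' 0) (at_left 0)"
  proof (rule Lim_transform_eventually)
    show "((\<lambda>y. (f y - f 0) / (y - 0)) \<longlongrightarrow> f' 0) (at_left 0)"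
      using f[of 0] unfolding has_field_derivative_iff by (auto intro: tendsto_within_subset)
    show "\<forall>\<^sub>F y in at_left 0. (f y - f 0) / (y - 0) = (?F y - ?F 0) / (y - 0)"
      by (auto simp: eventually_at_filter)
  qed
  moreover have "((\<lambda>y. (?F y - ?F 0) / (y - 0)) \<longlongrightarrow> f' 0) (at_right 0)"
  proof (rule Lim_transform_eventually)
    show "((\<lambda>y. (g y - g 0) / (y - 0)) \<longlongrightarrow> f' 0) (at_right 0)"
      using g[of 0] eq unfolding has_field_derivative_iff by (auto intro: tendsto_within_subset)
    show "\<forall>\<^sub>F y in at_right 0. (g y - g 0) / (y - 0) = (?F y - ?F 0) / (y - 0)"
      using eq by (auto simp: eventually_at_filter)
  qed
  ultimately show ?thesis
    unfolding has_field_derivative_iff True by (simp add: filterlim_split_at)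
next
  case False
  then consider "x < 0" | "0 < x" by linarith
  then show ?thesis
  proof cases
    case 1
    then show ?thesis
      using has_field_derivative_transform_within_open[OF f[of x], of "{..<0}" "\<lambda>y. if y \<le> 0 then f y else g y"]
      by simp
  next
    case 2
    then show ?thesis
      using has_field_derivative_transform_within_open[OF g[of x], of "{0<..}" "\<lambda>y. if y \<le> 0 then f y else g y"]
      by simp
  qed
qed

text \<open>\<open>l\<close> plays the role of the lower volatility but must be positive, since the
  right half of the profile is scaled by \<open>1 / l\<close>. It may therefore exceed the true
  lower bound \<open>lo\<close>, which enters only in \<open>front_super\<close>.\<close>

locale volatility_pair =
  fixes hi l :: real
  assumes l_pos: "0 < l" and l_le_hi: "l \<le> hi"
begin

definition vol :: "real \<Rightarrow> real" where "vol y = (if y \<le> 0 then hi else l)"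

text \<open>The self-similar profile of the solution of the \<open>G\<close>-heat equation started from the indicator
  of the positive half-line: it is convex to the left of \<open>0\<close> and concave to the right.\<close>
definition profile :: "real \<Rightarrow> real" where
  "profile y = (if y \<le> 0 then 2 * hi / (hi + l) * Phi (y / hi)
     else (hi - l) / (hi + l) + 2 * l / (hi + l) * Phi (y / l))"

text \<open>Two half Gaussians of widths \<open>hi\<close> and \<open>l\<close> with a common peak.
  The normalisation \<open>2 / (hi + l)\<close> gives them the masses hi/(hi + l) and l/(hi + l),
  hence total mass 1.\<close>

definition profile1 :: "real \<Rightarrow> real" where
  "profile1 y = 2 / (hi + l) * std_normal_density (y / vol y)"

definition profile2 :: "real \<Rightarrow> real" where
  "profile2 y = - (2 / (hi + l) * (hermite1 (y / vol y) / vol y))"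

lemma hi_pos: "0 < hi"
  using l_pos l_le_hi by simp

lemma sum_pos: "0 < hi + l"
  using l_pos hi_pos by simp

lemma vol_bounds: "0 < vol y" "l \<le> vol y" "vol y \<le> hi"
  using l_pos l_le_hi by (auto simp: vol_def)

lemma DERIV_profile: "(profile has_real_derivative profile1 y) (at y)"
proof -
  have d: "((\<lambda>y. a + 2 * s / (hi + l) * Phi (y / s)) has_real_derivative 2 / (hi + l) * std_normal_density (y / s)) (at y)"
    if "0 < s" for a s y
  proof -
    have "((\<lambda>y. y / s) has_real_derivative 1 / s) (at y)" by (rule DERIV_cdivide[OF DERIV_ident])
    from DERIV_add[OF DERIV_const[of a] DERIV_cmult[OF DERIV_chain2[OF DERIV_Phi this], of "2 * s / (hi + l)"]]
    show ?thesis using that by simp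
  qed
  have "((\<lambda>y. if y \<le> 0 then 0 + 2 * hi / (hi + l) * Phi (y / hi) else (hi - l) / (hi + l) + 2 * l / (hi + l) * Phi (y / l))
      has_real_derivative (if y \<le> 0 then 2 / (hi + l) * std_normal_density (y / hi) else 2 / (hi + l) * std_normal_density (y / l))) (at y)"
    using l_pos hi_pos sum_pos by (intro DERIV_If_le_0 d) (auto simp: Phi_0 divide_simps, simp_all add: algebra_simps)
  moreover have "profile = (\<lambda>y. if y \<le> 0 then 0 + 2 * hi / (hi + l) * Phi (y / hi)
      else (hi - l) / (hi + l) + 2 * l / (hi + l) * Phi (y / l))"
    by (auto simp: profile_def)
  ultimately show ?thesis by (auto simp: profile1_def vol_def split: if_splits)
qed

lemma DERIV_profile1: "(profile1 has_real_derivative profile2 y) (at y)"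
proof -
  have d: "((\<lambda>y. 2 / (hi + l) * std_normal_density (y / s)) has_real_derivative - (2 / (hi + l) * (hermite1 (y / s) / s))) (at y)"
    for s y
  proof -
    have "((\<lambda>y. y / s) has_real_derivative 1 / s) (at y)" by (rule DERIV_cdivide[OF DERIV_ident])
    from DERIV_cmult[OF DERIV_chain2[OF DERIV_std_normal_density this], of "2 / (hi + l)"]
    show ?thesis by (rule DERIV_cong) (simp add: hermite1_def)
  qed
  have "((\<lambda>y. if y \<le> 0 then 2 / (hi + l) * std_normal_density (y / hi) else 2 / (hi + l) * std_normal_density (y / l))
      has_real_derivative (if y \<le> 0 then - (2 / (hi + l) * (hermite1 (y / hi) / hi)) else - (2 / (hi + l) * (hermite1 (y / l) / l)))) (at y)"
    by (intro DERIV_If_le_0 d) (auto simp: hermite1_def)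
  moreover have "profile1 = (\<lambda>y. if y \<le> 0 then 2 / (hi + l) * std_normal_density (y / hi) else 2 / (hi + l) * std_normal_density (y / l))"
    by (auto simp: profile1_def vol_def)
  ultimately show ?thesis by (auto simp: profile2_def vol_def split: if_splits)
qed

text \<open>On either side of 0 this is the Lipschitz bound of \<open>hermite1\<close>. Across 0 it
  still holds because \<open>profile2\<close> vanishes there and |y| + |z| = |y - z| for points on
  opposite sides.\<close>

lemma profile2_lipschitz: "\<bar>profile2 y - profile2 z\<bar> \<le> 2 / (hi + l) / l\<^sup>2 * \<bar>y - z\<bar>"
proof -
  define a where "a = 2 / (hi + l)"
  have a: "0 \<le> a" using l_pos hi_pos by (simp add: a_def)
  define G where "G = (\<lambda>y. hermite1 (y / vol y) / vol y)"
  have same: "\<bar>hermite1 (y / s) / s - hermite1 (z / s) / s\<bar> \<le> \<bar>y - z\<bar> / l\<^sup>2" if "l \<le> s" for y z s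
  proof -
    have s: "0 < s" using that l_pos by simp
    have "\<bar>hermite1 (y / s) / s - hermite1 (z / s) / s\<bar> = \<bar>hermite1 (y / s) - hermite1 (z / s)\<bar> / s"
      using s by (simp add: diff_divide_distrib[symmetric])
    also have "\<dots> \<le> \<bar>y / s - z / s\<bar> / s" using s hermite1_lipschitz by (intro divide_right_mono) auto
    also have "\<dots> = \<bar>y - z\<bar> / s\<^sup>2" using s by (simp add: diff_divide_distrib[symmetric] power2_eq_square)
    also have "\<dots> \<le> \<bar>y - z\<bar> / l\<^sup>2" using that l_pos s by (intro divide_left_mono power_mono) auto
    finally show ?thesis .
  qed
  have G0: "G 0 = 0" by (simp add: G_def hermite1_def)
  have "\<bar>G y - G z\<bar> \<le> \<bar>y - z\<bar> / l\<^sup>2"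
  proof (cases "vol y = vol z")
    case True
    then show ?thesis unfolding G_def using same vol_bounds by simp
  next
    case False
    then have opp: "\<bar>y\<bar> + \<bar>z\<bar> = \<bar>y - z\<bar>" by (auto simp: vol_def split: if_splits)
    have "\<bar>G x\<bar> \<le> \<bar>x\<bar> / l\<^sup>2" for x
      using same[OF vol_bounds(2)[of x], of x 0] by (simp add: G_def hermite1_def)
    then have "\<bar>G y\<bar> + \<bar>G z\<bar> \<le> \<bar>y\<bar> / l\<^sup>2 + \<bar>z\<bar> / l\<^sup>2" by (intro add_mono)
    also have "\<dots> = \<bar>y - z\<bar> / l\<^sup>2" by (simp only: add_divide_distrib[symmetric] opp)
    finally show ?thesis by simp
  qed
  then have "a * \<bar>G y - G z\<bar> \<le> a * (\<bar>y - z\<bar> / l\<^sup>2)" using a by (rule mult_left_mono)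
  moreover have "\<bar>profile2 y - profile2 z\<bar> = a * \<bar>G y - G z\<bar>"
  proof -
    have "profile2 y - profile2 z = - (a * (G y - G z))"
      by (simp add: profile2_def a_def G_def right_diff_distrib)
    then show ?thesis using a by (simp add: abs_mult)
  qed
  ultimately show ?thesis by (simp add: a_def)
qed

lemma profile_mono: "y \<le> z \<Longrightarrow> profile y \<le> profile z"
  by (rule DERIV_nonneg_imp_nondecreasing)
    (auto intro!: exI DERIV_profile simp: profile1_def mult_nonneg_nonneg less_imp_le[OF add_pos_pos[OF hi_pos l_pos]])

lemma profile_nonneg: "0 \<le> profile y"
  using l_pos l_le_hi Phi_nonneg by (auto simp: profile_def)

lemma profile_le_1: "profile y \<le> 1"
proof -
  have "profile y \<le> profile (max y 1)" by (rule profile_mono) simp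
  also have "\<dots> \<le> (hi - l) / (hi + l) + 2 * l / (hi + l) * 1"
    unfolding profile_def using l_pos hi_pos Phi_le_1 mult_left_mono[of "Phi (max y 1 / l)" 1 "2 * l / (hi + l)"] by simp
  also have "\<dots> = 1" using sum_pos by (simp add: divide_simps)
  finally show ?thesis .
qed

text \<open>Equality holds for y \<le> 0. To the right the difference of both sides starts at 0 and
  has a nonnegative derivative, the wider Gaussian being the larger one at equal peak
  height.\<close>

lemma profile_le_Phi: "profile y \<le> 2 * hi / (hi + l) * Phi (y / hi)"
proof (cases "y \<le> 0")
  case False
  define D where "D = (\<lambda>y. 2 * hi / (hi + l) * Phi (y / hi) - ((hi - l) / (hi + l) + 2 * l / (hi + l) * Phi (y / l)))"
  have "D 0 \<le> D y"
  proof (rule DERIV_nonneg_imp_nondecreasing[where f = D])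
    fix x :: real assume x: "0 \<le> x"
    have d: "((\<lambda>y. 2 * s / (hi + l) * Phi (y / s)) has_real_derivative 2 / (hi + l) * std_normal_density (x / s)) (at x)"
      if "0 < s" for s
    proof -
      have "((\<lambda>y. y / s) has_real_derivative 1 / s) (at x)" by (rule DERIV_cdivide[OF DERIV_ident])
      from DERIV_cmult[OF DERIV_chain2[OF DERIV_Phi this], of "2 * s / (hi + l)"]
      show ?thesis using that by simp
    qed
    have "(D has_real_derivative 2 / (hi + l) * std_normal_density (x / hi)
        - (0 + 2 / (hi + l) * std_normal_density (x / l))) (at x)"
      unfolding D_def by (intro DERIV_diff DERIV_add DERIV_const d hi_pos l_pos)
    moreover have "std_normal_density (x / l) \<le> std_normal_density (x / hi)"
    proof -
      have "(x / hi)\<^sup>2 \<le> (x / l)\<^sup>2" using x l_pos l_le_hi hi_pos by (intro power_mono divide_left_mono) auto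
      then show ?thesis by (simp add: std_normal_density_def divide_right_mono)
    qed
    then have "0 \<le> 2 / (hi + l) * std_normal_density (x / hi) - (0 + 2 / (hi + l) * std_normal_density (x / l))"
      using l_pos hi_pos by (simp add: divide_right_mono)
    ultimately show "\<exists>d. (D has_real_derivative d) (at x) \<and> 0 \<le> d" by blast
  qed (use False in simp)
  moreover have "D 0 = 0" using sum_pos by (simp add: D_def Phi_0 divide_simps)
  ultimately show ?thesis using False by (simp add: D_def profile_def)
qed (simp add: profile_def)

text \<open>To the right of 0 the deficit is \<open>2 * l / (hi + l)\<close>, at most 1, times a
  Gaussian tail of width \<open>l\<close>, which is no heavier than that of width \<open>hi\<close>.
  The bound is thus uniform in \<open>l\<close>.\<close>

lemma one_minus_profile_le:
  assumes y: "0 \<le> y" shows "1 - profile y \<le> 1 - Phi (y / hi)"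
proof -
  have "Phi (y / hi) \<le> Phi (y / l)"
    using y l_pos l_le_hi hi_pos by (intro Phi_mono divide_left_mono) auto
  moreover have "1 - profile y = 2 * l / (hi + l) * (1 - Phi (y / l))"
  proof -
    have "profile y = (hi - l) / (hi + l) + 2 * l / (hi + l) * Phi (y / l)"
      using y sum_pos by (cases "y = 0") (auto simp: profile_def Phi_0 divide_simps, simp_all add: algebra_simps)
    moreover have "1 - (hi - l) / (hi + l) = 2 * l / (hi + l)" using sum_pos by (simp add: divide_simps)
    ultimately show ?thesis by (simp add: right_diff_distrib)
  qed
  moreover have "2 * l / (hi + l) * (1 - Phi (y / l)) \<le> 1 * (1 - Phi (y / l))"
    using l_pos l_le_hi Phi_le_1[of "y / l"] by (intro mult_right_mono) auto
  ultimately show ?thesis by simp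
qed

text \<open>The sign \<open>s\<close>, 1 or -1, selects the half-line \<open>x > c\<close> or
  \<open>x < - c\<close> whose indicator is the datum at time 0.\<close>

definition front :: "real \<Rightarrow> real \<Rightarrow> real \<Rightarrow> real \<Rightarrow> real" where
  "front s c \<tau> x = profile ((s * x - c) / sqrt \<tau>)"

definition front1 :: "real \<Rightarrow> real \<Rightarrow> real \<Rightarrow> real \<Rightarrow> real" where
  "front1 s c \<tau> x = s / sqrt \<tau> * profile1 ((s * x - c) / sqrt \<tau>)"

definition front2 :: "real \<Rightarrow> real \<Rightarrow> real \<Rightarrow> real \<Rightarrow> real" where
  "front2 s c \<tau> x = profile2 ((s * x - c) / sqrt \<tau>) / \<tau>"

text \<open>The right-hand side of the equation with the volatility \<open>vol\<close>. That it is
  also the time derivative of \<open>front\<close> is proved in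
  \<open>front_parabolic\<close>.\<close>

definition front_t :: "real \<Rightarrow> real \<Rightarrow> real \<Rightarrow> real \<Rightarrow> real" where
  "front_t s c \<tau> x = (vol (s * x - c))\<^sup>2 * front2 s c \<tau> x / 2"

text \<open>The first summand bounds the variation of \<open>front2\<close> in space, the second
  that of \<open>front_t\<close> in time; both blow up as \<open>\<delta>\<close> tends to
  0.\<close>

definition front_bound :: "real \<Rightarrow> real" where
  "front_bound \<delta> = 2 / (hi + l) / l\<^sup>2 / (\<delta> * sqrt \<delta>) + 4 / \<delta>\<^sup>2"

lemma vol_scale: "0 < t \<Longrightarrow> vol (y / t) = vol y"
  by (simp add: vol_def divide_le_0_iff)

text \<open>One factor of \<open>vol\<close> cancels and the other moves inside
  \<open>hermite1\<close>, so that time enters only in the form treated by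
  \<open>hermite1_time_lipschitz\<close>.\<close>

lemma front_t_eq:
  assumes "0 < \<tau>"
  shows "front_t s c \<tau> x = - (vol (s * x - c) / (hi + l) * (hermite1 ((s * x - c) / vol (s * x - c) / sqrt \<tau>) / \<tau>))"
  using vol_bounds(1)[of "s * x - c"] assms
  by (simp add: front_t_def front2_def profile2_def vol_scale divide_divide_eq_left mult.commute power2_eq_square)

lemma front_parabolic:
  assumes \<delta>: "0 < \<delta>" and s: "s\<^sup>2 = 1"
  shows "parabolic_regular \<delta> (front_bound \<delta>) (front s c) (front1 s c) (front2 s c) (front_t s c)"
  unfolding parabolic_regular_def
proof (intro conjI allI impI)
  fix \<tau> \<tau>' x y assume \<tau>: "\<delta> \<le> \<tau>"
  then have \<tau>0: "0 < \<tau>" using \<delta> by simp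
  have s': "\<bar>s\<bar> = 1" using s by (simp add: abs_square_eq_1)
  have lin: "((\<lambda>x. (s * x - c) / sqrt \<tau>) has_real_derivative s / sqrt \<tau>) (at x)"
    by (rule DERIV_cdivide) (auto intro!: derivative_eq_intros)
  show "(front s c \<tau> has_real_derivative front1 s c \<tau> x) (at x)"
    unfolding front_def[abs_def] front1_def
    using DERIV_chain2[OF DERIV_profile lin] by (simp add: mult.commute)
  have "((\<lambda>x. s / sqrt \<tau> * profile1 ((s * x - c) / sqrt \<tau>)) has_real_derivative
      s / sqrt \<tau> * (profile2 ((s * x - c) / sqrt \<tau>) * (s / sqrt \<tau>))) (at x)"
    by (rule DERIV_cmult[OF DERIV_chain2[OF DERIV_profile1 lin]])
  moreover have "s / sqrt \<tau> * (profile2 ((s * x - c) / sqrt \<tau>) * (s / sqrt \<tau>)) = front2 s c \<tau> x"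
    using s \<tau>0 by (simp add: front2_def power2_eq_square)
  ultimately show "(front1 s c \<tau> has_real_derivative front2 s c \<tau> x) (at x)"
    unfolding front1_def[abs_def] by simp
  have "((\<lambda>\<tau>. (s * x - c) / sqrt \<tau>) has_real_derivative - ((s * x - c) / (2 * \<tau> * sqrt \<tau>))) (at \<tau>)"
    using \<tau>0 by (auto intro!: derivative_eq_intros simp: field_simps)
  from DERIV_chain2[OF DERIV_profile this]
  have "((\<lambda>\<tau>. front s c \<tau> x) has_real_derivative profile1 ((s * x - c) / sqrt \<tau>) * - ((s * x - c) / (2 * \<tau> * sqrt \<tau>))) (at \<tau>)"
    by (simp add: front_def)
  \<comment> \<open>The equation of the profile: \<open>profile2 z\<close> is
    \<open>- z / (vol z)\<^sup>2\<close> times \<open>profile1 z\<close>, so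
    \<open>(vol z)\<^sup>2 * profile2 z / (2 * \<tau>)\<close> equals
    \<open>- z / (2 * \<tau>)\<close> times \<open>profile1 z\<close>, which is what the chain rule
    in time produces.\<close>
  moreover have "profile1 ((s * x - c) / sqrt \<tau>) * - ((s * x - c) / (2 * \<tau> * sqrt \<tau>)) = front_t s c \<tau> x"
  proof -
    define y v a where "y = s * x - c" and "v = vol y" and "a = 2 / (hi + l)"
    define N where "N = std_normal_density (y / sqrt \<tau> / v)"
    have v: "0 < v" using vol_bounds by (simp add: v_def)
    have "a * N * - (y / (2 * \<tau> * sqrt \<tau>)) = v\<^sup>2 * (- (a * (y / sqrt \<tau> / v * N / v)) / \<tau>) / 2"
      using v \<tau>0 by (simp add: power2_eq_square divide_simps)
    moreover have "vol (y / sqrt \<tau>) = v" using \<tau>0 by (simp add: v_def vol_scale)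
    ultimately show ?thesis
      unfolding front_t_def front2_def profile1_def profile2_def hermite1_def
        y_def[symmetric] v_def[symmetric] a_def[symmetric] by (simp only: N_def)
  qed
  ultimately show "((\<lambda>\<tau>. front s c \<tau> x) has_real_derivative front_t s c \<tau> x) (at \<tau>)" by simp
  have fb: "2 / (hi + l) / l\<^sup>2 / (\<delta> * sqrt \<delta>) \<le> front_bound \<delta>" "4 / \<delta>\<^sup>2 \<le> front_bound \<delta>"
    using \<delta> l_pos hi_pos by (auto simp: front_bound_def)
  show "\<bar>front2 s c \<tau> x - front2 s c \<tau> y\<bar> \<le> front_bound \<delta> * \<bar>x - y\<bar>"
  proof -
    define a where "a = 2 / (hi + l) / l\<^sup>2"
    have a: "0 \<le> a" using l_pos hi_pos by (simp add: a_def)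
    have "\<bar>front2 s c \<tau> x - front2 s c \<tau> y\<bar> = \<bar>profile2 ((s * x - c) / sqrt \<tau>) - profile2 ((s * y - c) / sqrt \<tau>)\<bar> / \<tau>"
      using \<tau>0 by (simp add: front2_def diff_divide_distrib[symmetric])
    also have "\<dots> \<le> a * \<bar>(s * x - c) / sqrt \<tau> - (s * y - c) / sqrt \<tau>\<bar> / \<tau>"
      using \<tau>0 profile2_lipschitz unfolding a_def by (intro divide_right_mono) auto
    also have "\<bar>(s * x - c) / sqrt \<tau> - (s * y - c) / sqrt \<tau>\<bar> = \<bar>s * (x - y)\<bar> / sqrt \<tau>"
      using \<tau>0 by (simp add: diff_divide_distrib[symmetric] right_diff_distrib)
    also have "\<bar>s * (x - y)\<bar> = \<bar>x - y\<bar>" using s' by (simp add: abs_mult)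
    also have "a * (\<bar>x - y\<bar> / sqrt \<tau>) / \<tau> = a * \<bar>x - y\<bar> / (\<tau> * sqrt \<tau>)" by (simp add: field_simps)
    also have "\<dots> \<le> a * \<bar>x - y\<bar> / (\<delta> * sqrt \<delta>)"
      using \<tau> \<delta> a by (intro divide_left_mono mult_mono) auto
    also have "\<dots> = a / (\<delta> * sqrt \<delta>) * \<bar>x - y\<bar>" by simp
    also have "\<dots> \<le> front_bound \<delta> * \<bar>x - y\<bar>" using fb(1) unfolding a_def by (intro mult_right_mono) auto
    finally show ?thesis .
  qed
  show "\<bar>front_t s c \<tau> x - front_t s c \<tau>' x\<bar> \<le> front_bound \<delta> * \<bar>\<tau> - \<tau>'\<bar>" if \<tau>': "\<delta> \<le> \<tau>'"
  proof -
    have \<tau>'0: "0 < \<tau>'" using \<tau>' \<delta> by simp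
    define y where "y = s * x - c"
    define v where "v = vol y"
    have v: "0 \<le> v / (hi + l)" "v / (hi + l) \<le> 1" using vol_bounds[of y] l_pos by (auto simp: v_def)
    define A where "A = (\<lambda>\<tau>. hermite1 (y / v / sqrt \<tau>) / \<tau>)"
    have "\<bar>front_t s c \<tau> x - front_t s c \<tau>' x\<bar> = \<bar>v / (hi + l) * (A \<tau> - A \<tau>')\<bar>"
      unfolding front_t_eq[OF \<tau>0] front_t_eq[OF \<tau>'0] A_def v_def y_def[symmetric]
      by (simp add: right_diff_distrib abs_minus_commute)
    also have "\<dots> = v / (hi + l) * \<bar>A \<tau> - A \<tau>'\<bar>"
      unfolding abs_mult abs_of_nonneg[OF v(1)] ..
    also have "\<dots> \<le> \<bar>A \<tau> - A \<tau>'\<bar>" using v by (intro mult_left_le_one_le) auto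
    also have "\<dots> \<le> 4 / \<delta>\<^sup>2 * \<bar>\<tau> - \<tau>'\<bar>" unfolding A_def by (rule hermite1_time_lipschitz[OF \<delta> \<tau> \<tau>'])
    also have "\<dots> \<le> front_bound \<delta> * \<bar>\<tau> - \<tau>'\<bar>" using fb(2) by (intro mult_right_mono) auto
    finally show ?thesis .
  qed
qed

text \<open>Where the front is convex the best volatility is \<open>hi\<close>, the one built in.
  Where it is concave the best one is \<open>lo\<close> while the front uses \<open>l\<close>; the
  defect is \<open>(l\<^sup>2 - lo\<^sup>2) / 2\<close> times a curvature bounded through
  \<open>hermite1\<close>, and vanishes for l = lo.\<close>

lemma front_super:
  assumes \<delta>: "0 < \<delta>" "\<delta> \<le> \<tau>" and \<sigma>: "lo \<le> \<sigma>" "\<sigma> \<le> hi" and lo: "0 \<le> lo" "lo \<le> l"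
  shows "\<sigma>\<^sup>2 * front2 s c \<tau> x / 2 \<le> front_t s c \<tau> x + (l\<^sup>2 - lo\<^sup>2) / (l * \<delta> * hi)"
proof -
  define y where "y = s * x - c"
  have \<tau>: "0 < \<tau>" using \<delta> by simp
  have \<kappa>: "0 \<le> (l\<^sup>2 - lo\<^sup>2) / (l * \<delta> * hi)"
    using lo l_pos hi_pos \<delta> by (auto intro!: divide_nonneg_pos power_mono)
  have f2: "front2 s c \<tau> x = - (2 / (hi + l) * (hermite1 (y / sqrt \<tau> / vol y) / vol y) / \<tau>)"
    using \<tau> by (simp add: front2_def profile2_def y_def vol_scale)
  show ?thesis
  proof (cases "y \<le> 0")
    case True
    have "hermite1 (y / sqrt \<tau> / vol y) \<le> 0"
      using True \<tau> vol_bounds[of y] by (auto simp: hermite1_def intro!: mult_nonpos_nonneg divide_nonpos_pos)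
    then have "2 / (hi + l) * (hermite1 (y / sqrt \<tau> / vol y) / vol y) / \<tau> \<le> 0"
      using vol_bounds[of y] \<tau> l_pos hi_pos by (intro divide_nonpos_pos mult_nonneg_nonpos) auto
    then have "0 \<le> front2 s c \<tau> x" unfolding f2 by simp
    moreover have "\<sigma>\<^sup>2 \<le> hi\<^sup>2" using \<sigma> lo by (intro power_mono) auto
    ultimately have "\<sigma>\<^sup>2 * front2 s c \<tau> x \<le> hi\<^sup>2 * front2 s c \<tau> x" by (rule mult_right_mono[rotated])
    moreover have "front_t s c \<tau> x = hi\<^sup>2 * front2 s c \<tau> x / 2"
      using True by (simp add: front_t_def y_def[symmetric] vol_def)
    ultimately show ?thesis using \<kappa> by linarith
  next
    case False
    have v: "vol y = l" using False by (simp add: vol_def)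
    have h0: "0 \<le> hermite1 (y / sqrt \<tau> / l)" using False \<tau> l_pos by (simp add: hermite1_def)
    have "hermite1 (y / sqrt \<tau> / l) / l / \<tau> \<le> 1 / l / \<delta>"
      using hermite1_bounds(1)[of "y / sqrt \<tau> / l"] h0 l_pos \<delta>
      by (intro frac_le divide_right_mono) auto
    then have "2 / (hi + l) * (hermite1 (y / sqrt \<tau> / l) / l / \<tau>) \<le> 2 / hi * (1 / l / \<delta>)"
      using hi_pos l_pos h0 \<tau> by (intro mult_mono divide_left_mono) auto
    then have b: "- front2 s c \<tau> x \<le> 2 / (l * \<delta> * hi)" "0 \<le> - front2 s c \<tau> x"
      using h0 \<tau> hi_pos l_pos unfolding f2 v by (auto simp: mult_ac)
    have "(l\<^sup>2 - \<sigma>\<^sup>2) * (- front2 s c \<tau> x) \<le> (l\<^sup>2 - lo\<^sup>2) * (- front2 s c \<tau> x)"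
      using b \<sigma> lo by (intro mult_right_mono) (auto intro!: power_mono)
    also have "\<dots> \<le> (l\<^sup>2 - lo\<^sup>2) * (2 / (l * \<delta> * hi))"
      using b lo by (intro mult_left_mono) (auto intro!: power_mono)
    also have "\<dots> = 2 * ((l\<^sup>2 - lo\<^sup>2) / (l * \<delta> * hi))" by simp
    also have "(l\<^sup>2 - \<sigma>\<^sup>2) * (- front2 s c \<tau> x) = \<sigma>\<^sup>2 * front2 s c \<tau> x - l\<^sup>2 * front2 s c \<tau> x"
      by (simp add: algebra_simps)
    finally have "\<sigma>\<^sup>2 * front2 s c \<tau> x - l\<^sup>2 * front2 s c \<tau> x \<le> 2 * ((l\<^sup>2 - lo\<^sup>2) / (l * \<delta> * hi))" .
    moreover have "front_t s c \<tau> x = l\<^sup>2 * front2 s c \<tau> x / 2"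
      using v by (simp add: front_t_def y_def[symmetric])
    ultimately show ?thesis by linarith
  qed
qed

end

subsection \<open>Existence of limits by mollification\<close>

definition uniform01 :: "real measure" where
  "uniform01 = density lborel (\<lambda>t. ennreal (indicator {0..1} t))"

interpretation uniform01: real_distribution uniform01
proof (intro real_distribution.intro prob_spaceI)
  show "real_distribution_axioms uniform01" by standard (simp add: uniform01_def)
  show "emeasure uniform01 (space uniform01) = 1"
    by (simp add: uniform01_def emeasure_density ennreal_indicator)
qed

lemma integral_uniform01:
  fixes f :: "real \<Rightarrow> real"
  assumes [measurable]: "f \<in> borel_measurable borel"
  shows "(\<integral>t. f t \<partial>uniform01) = (\<integral>t. f t * indicator {0..1} t \<partial>lborel)"
  unfolding uniform01_def
  by (subst integral_density) (auto simp: mult.commute)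

abbreviation average :: "real \<Rightarrow> (real \<Rightarrow> real) \<Rightarrow> real \<Rightarrow> real" where
  "average \<equiv> shifted_mean uniform01"

text \<open>An average over [x, x + r] is a difference quotient of an antiderivative, so averaging
  gains one derivative and two averages make a continuous function twice differentiable.\<close>

lemma average_has_derivative:
  assumes f: "continuous_on UNIV f" and r: "0 < r"
  shows "(average r f has_real_derivative (f (x + r) - f x) / r) (at x)"
proof -
  have cont: "isCont f x" for x using f by (simp add: continuous_on_eq_continuous_at)
  have [measurable]: "f \<in> borel_measurable borel" using f by (rule borel_measurable_continuous_onI)
  obtain F where F: "\<And>x. (F has_vector_derivative f x) (at x)"
    using einterval_antiderivative[of "-\<infinity>" "\<infinity>" f] cont by auto
  then have F': "(F has_real_derivative f x) (at x)" for x
    by (simp add: has_real_derivative_iff_has_vector_derivative)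
  have "average r f y = (F (y + r) - F y) / r" for y
  proof -
    have "average r f y = (\<integral>t. f (y + r * t) * indicator {0..1} t \<partial>lborel)"
      unfolding shifted_mean_def by (rule integral_uniform01) measurable
    also have "\<dots> = F (y + r * 1) / r - F (y + r * 0) / r"
    proof (rule integral_FTC_Icc_real)
      show "((\<lambda>t. F (y + r * t) / r) has_real_derivative f (y + r * t)) (at t)" for t
      proof -
        have "((\<lambda>t. y + r * t) has_real_derivative r) (at t)" by (auto intro!: derivative_eq_intros)
        from DERIV_cdivide[OF DERIV_chain2[OF F' this], of r] show ?thesis using r by simp
      qed
      show "isCont (\<lambda>t. f (y + r * t)) t" for t
        by (rule isCont_o2[where f = "\<lambda>t. y + r * t", OF _ cont]) simp
    qed simp
    finally show ?thesis by (simp add: diff_divide_distrib)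
  qed
  moreover have "((\<lambda>y. (F (y + r) - F y) / r) has_real_derivative (f (x + r) - f x) / r) (at x)"
  proof -
    have "((\<lambda>y. y + r) has_real_derivative 1) (at x)" by (auto intro!: derivative_eq_intros)
    from DERIV_cdivide[OF DERIV_diff[OF DERIV_chain2[OF F' this] F'], of r] show ?thesis by simp
  qed
  ultimately show ?thesis by presburger
qed

lemma average_close:
  assumes f: "bounded_lipschitz B L f" and r: "0 \<le> r"
  shows "\<bar>average r f x - f x\<bar> \<le> L * r"
proof -
  note int = uniform01.integrable_bounded_lipschitz[OF f]
  have AE: "AE t in uniform01. t \<in> {0..1}"
    unfolding uniform01_def by (subst AE_density) (auto simp: indicator_def)
  have b: "\<bar>f (x + r * t) - f x\<bar> \<le> L * r" if "t \<in> {0..1}" for t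
  proof -
    have "L * \<bar>r * t\<bar> \<le> L * r"
      using that r bounded_lipschitzD(6)[OF f] by (intro mult_left_mono) (auto simp: mult_left_le abs_mult)
    then show ?thesis using bounded_lipschitzD(4)[OF f, of "x + r * t" x] by simp
  qed
  have "average r f x - f x = (\<integral>t. f (x + r * t) - f x \<partial>uniform01)"
    unfolding shifted_mean_def using int by simp
  also have "\<bar>\<dots>\<bar> \<le> (\<integral>t. \<bar>f (x + r * t) - f x\<bar> \<partial>uniform01)"
    by (rule integral_abs_bound)
  also have "\<dots> \<le> (\<integral>t. L * r \<partial>uniform01)"
    using int AE b by (intro integral_mono_AE) (auto intro!: Bochner_Integration.integrable_diff integrable_abs)
  finally show ?thesis by simp
qed

lemma (in real_distribution) shifted_mean_average:
  assumes f: "bounded_lipschitz B L f"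
  shows "shifted_mean M s (average r f) x = average r (shifted_mean M s f) x"
proof -
  interpret P: pair_prob_space uniform01 M ..
  have [measurable]: "f \<in> borel_measurable borel" using f by (rule bounded_lipschitz_measurable)
  have "integrable (uniform01 \<Otimes>\<^sub>M M) (\<lambda>(t, e). f (x + s * e + r * t))"
    using bounded_lipschitzD(1)[OF f] by (intro P.integrable_const_bound[where B = B]) (auto, measurable)
  from P.Fubini_integral[OF this]
  show ?thesis unfolding shifted_mean_def by (simp add: algebra_simps)
qed

text \<open>Two box averages suffice as a smoothing kernel: the second derivative is then exactly
  \<open>second_diff\<close>, whose Lipschitz constant and dependence on \<open>f\<close> are
  explicit.\<close>

definition mollify :: "real \<Rightarrow> (real \<Rightarrow> real) \<Rightarrow> real \<Rightarrow> real" where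
  "mollify r f = average r (average r f)"

definition second_diff :: "real \<Rightarrow> (real \<Rightarrow> real) \<Rightarrow> real \<Rightarrow> real" where
  "second_diff r f x = (f (x + 2 * r) - 2 * f (x + r) + f x) / r\<^sup>2"

lemma mollify_derivatives:
  assumes f: "bounded_lipschitz B L f" and r: "0 < r"
  shows "(mollify r f has_real_derivative (average r f (x + r) - average r f x) / r) (at x)"
    and "((\<lambda>x. (average r f (x + r) - average r f x) / r) has_real_derivative second_diff r f x) (at x)"
proof -
  note a = uniform01.shifted_mean_bounded_lipschitz[OF f]
  note d = average_has_derivative[OF bounded_lipschitz_continuous[OF f] r]
  show "(mollify r f has_real_derivative (average r f (x + r) - average r f x) / r) (at x)"
    unfolding mollify_def by (rule average_has_derivative[OF bounded_lipschitz_continuous[OF a] r])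
  have "((\<lambda>x. average r f (x + r)) has_real_derivative (f (x + r + r) - f (x + r)) / r) (at x)"
  proof -
    have "((\<lambda>y. y + r) has_real_derivative 1) (at x)" by (auto intro!: derivative_eq_intros)
    from DERIV_chain2[OF d this] show ?thesis by simp
  qed
  from DERIV_cdivide[OF DERIV_diff[OF this d], of r]
  show "((\<lambda>x. (average r f (x + r) - average r f x) / r) has_real_derivative second_diff r f x) (at x)"
    by (rule DERIV_cong) (use r in \<open>simp add: second_diff_def power2_eq_square field_simps\<close>)
qed

lemma second_diff_lipschitz:
  assumes f: "bounded_lipschitz B L f" and r: "0 < r"
  shows "\<bar>second_diff r f x - second_diff r f y\<bar> \<le> 4 * L / r\<^sup>2 * \<bar>x - y\<bar>"
proof -
  have "\<bar>(f (x + 2 * r) - 2 * f (x + r) + f x) - (f (y + 2 * r) - 2 * f (y + r) + f y)\<bar> \<le> 4 * L * \<bar>x - y\<bar>"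
    using bounded_lipschitzD(4)[OF f, of "x + 2 * r" "y + 2 * r"] bounded_lipschitzD(4)[OF f, of "x + r" "y + r"]
      bounded_lipschitzD(4)[OF f, of x y] by simp
  then have "\<bar>(f (x + 2 * r) - 2 * f (x + r) + f x) - (f (y + 2 * r) - 2 * f (y + r) + f y)\<bar> / r\<^sup>2
      \<le> 4 * L * \<bar>x - y\<bar> / r\<^sup>2"
    by (rule divide_right_mono) simp
  then show ?thesis by (simp add: second_diff_def diff_divide_distrib[symmetric])
qed

lemma second_diff_close:
  assumes "\<And>x. \<bar>f x - g x\<bar> \<le> d" and r: "0 < r"
  shows "\<bar>second_diff r f x - second_diff r g x\<bar> \<le> 4 * d / r\<^sup>2"
proof -
  have "\<bar>(f (x + 2 * r) - 2 * f (x + r) + f x) - (g (x + 2 * r) - 2 * g (x + r) + g x)\<bar> \<le> 4 * d"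
    using assms(1)[of "x + 2 * r"] assms(1)[of "x + r"] assms(1)[of x] by simp
  then have "\<bar>(f (x + 2 * r) - 2 * f (x + r) + f x) - (g (x + 2 * r) - 2 * g (x + r) + g x)\<bar> / r\<^sup>2 \<le> 4 * d / r\<^sup>2"
    by (rule divide_right_mono) simp
  then show ?thesis by (simp add: second_diff_def diff_divide_distrib[symmetric])
qed

lemma mollify_close:
  assumes f: "bounded_lipschitz B L f" and r: "0 < r"
  shows "\<bar>mollify r f x - f x\<bar> \<le> 2 * L * r"
  using average_close[OF f, of r x] average_close[OF uniform01.shifted_mean_bounded_lipschitz[OF f], of r r x] r
  by (simp add: mollify_def)

lemma mollify_mono:
  assumes f: "bounded_lipschitz B L f" and g: "bounded_lipschitz B' L' g" and "\<And>x. f x \<le> g x"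
  shows "mollify r f x \<le> mollify r g x"
  unfolding mollify_def
  by (intro uniform01.shifted_mean_mono uniform01.integrable_bounded_lipschitz
      uniform01.shifted_mean_bounded_lipschitz f g assms(3) | rule f g)+

text \<open>Extends a value function from the coarse time grid to the times visited by a finer
  walk.\<close>

definition interpolate :: "(nat \<Rightarrow> real) \<Rightarrow> real \<Rightarrow> real" where
  "interpolate a t = (let k = nat \<lfloor>t\<rfloor>; \<theta> = t - real k in (1 - \<theta>) * a k + \<theta> * a (Suc k))"

lemma interpolate_of_nat [simp]: "interpolate a (real k) = a k"
  by (simp add: interpolate_def)

text \<open>A time shift of at most one grid length meets at most two cells, and \<open>q\<close>
  bounds the slope from below on both.\<close>

lemma interpolate_increment:
  assumes t: "0 \<le> t" and d: "0 \<le> d" "d \<le> 1"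
    and k: "k = nat \<lfloor>t\<rfloor>" and q: "q \<le> a (Suc k) - a k" "q \<le> a (Suc (Suc k)) - a (Suc k)"
  shows "d * q \<le> interpolate a (t + d) - interpolate a t"
proof -
  have kt: "real k \<le> t" "t < real k + 1" using t k by (simp_all add: le_floor_iff)
  show ?thesis
  proof (cases "t + d < real k + 1")
    case True
    then have "nat \<lfloor>t + d\<rfloor> = k" using kt d t by (simp add: nat_eq_iff floor_eq_iff)
    then have "interpolate a (t + d) - interpolate a t = d * (a (Suc k) - a k)"
      by (simp add: interpolate_def Let_def k[symmetric] algebra_simps)
    then show ?thesis using q(1) d by (simp add: mult_left_mono)
  next
    case False
    then have "nat \<lfloor>t + d\<rfloor> = Suc k" using kt d t by (simp add: nat_eq_iff floor_eq_iff)
    then have "interpolate a (t + d) - interpolate a t =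
        (real k + 1 - t) * (a (Suc k) - a k) + (t + d - real k - 1) * (a (Suc (Suc k)) - a (Suc k))"
      by (simp add: interpolate_def Let_def k[symmetric] algebra_simps)
    moreover have "(real k + 1 - t) * q \<le> (real k + 1 - t) * (a (Suc k) - a k)"
      using q kt by (intro mult_left_mono) auto
    moreover have "(t + d - real k - 1) * q \<le> (t + d - real k - 1) * (a (Suc (Suc k)) - a (Suc k))"
      using q False by (intro mult_left_mono) auto
    ultimately show ?thesis by (simp add: algebra_simps)
  qed
qed

context controlled_walk
begin

text \<open>One step moves the argument by at most \<open>hi * sqrt h\<close> in the mean, so for
  Lipschitz data consecutive iterates differ by that order.\<close>

lemma bellman_iter_increment:
  assumes f: "bounded_lipschitz B L f" and h: "0 \<le> h"
  shows "\<bar>(bellman h ^^ Suc k) f x - (bellman h ^^ k) f x\<bar> \<le> L * (hi * sqrt h)"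
proof -
  let ?v = "(bellman h ^^ k) f"
  note v = bellman_iter_bounded_lipschitz[OF f, of k h]
  have st: "\<bar>step (\<sigma> * sqrt h) ?v x - ?v x\<bar> \<le> L * (hi * sqrt h)" if "\<sigma> \<in> {lo..hi}" for \<sigma>
  proof -
    have "L * \<bar>\<sigma> * sqrt h\<bar> \<le> L * (hi * sqrt h)"
      using that lo_nonneg h bounded_lipschitzD(6)[OF f]
      by (intro mult_left_mono) (auto simp: abs_mult mult_right_mono)
    then show ?thesis
      using step_lipschitz_scale[OF v, of "\<sigma> * sqrt h" x 0] by (simp add: shifted_mean_def)
  qed
  have hi: "hi \<in> {lo..hi}" using lo_le_hi by simp
  have "bellman h ?v x \<le> ?v x + L * (hi * sqrt h)"
    using st by (intro bellman_least) (auto simp: abs_le_iff algebra_simps)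
  moreover have "?v x - L * (hi * sqrt h) \<le> bellman h ?v x"
    using st[OF hi] step_le_bellman[OF v hi, of h x] by (simp add: abs_le_iff)
  ultimately show ?thesis by (simp add: abs_le_iff)
qed

text \<open>For fixed \<sigma> the operator \<open>step\<close> commutes with averaging, and inside
  the average it is below \<open>bellman\<close>. Here it matters that \<open>bellman\<close> is a
  supremum of linear operators; the argument gives no inequality in the other direction.\<close>

lemma step_mollify_le:
  assumes f: "bounded_lipschitz B L f" and \<sigma>: "\<sigma> \<in> {lo..hi}"
  shows "step (\<sigma> * sqrt h) (mollify r ((bellman h ^^ k) f)) x \<le> mollify r ((bellman h ^^ Suc k) f) x"
proof -
  let ?v = "(bellman h ^^ k) f"
  note v = bellman_iter_bounded_lipschitz[OF f, of k h]
  have "step (\<sigma> * sqrt h) (average r ?v) = average r (step (\<sigma> * sqrt h) ?v)"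
    using shifted_mean_average[OF v] by blast
  then have "step (\<sigma> * sqrt h) (mollify r ?v) x = mollify r (step (\<sigma> * sqrt h) ?v) x"
    using shifted_mean_average[OF uniform01.shifted_mean_bounded_lipschitz[OF v]]
    by (simp add: mollify_def)
  also have "\<dots> \<le> mollify r (bellman h ?v) x"
    by (rule mollify_mono[OF shifted_mean_bounded_lipschitz[OF v] bellman_bounded_lipschitz[OF v]])
      (rule step_le_bellman[OF v \<sigma>])
  finally show ?thesis by simp
qed

text \<open>Taylor's formula for the smoothed value function, inserted into
  \<open>step_mollify_le\<close>: over one coarse step it grows, up to the Taylor error, at least as
  the equation demands for every volatility.\<close>

lemma mollify_increment:
  assumes f: "bounded_lipschitz B L f" and r: "0 < r" and h: "0 \<le> h" and \<sigma>: "\<sigma> \<in> {lo..hi}"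
  shows "h * (\<sigma>\<^sup>2 * second_diff r ((bellman h ^^ k) f) x / 2 - 4 * L / r\<^sup>2 * third * hi ^ 3 * sqrt h)
    \<le> mollify r ((bellman h ^^ Suc k) f) x - mollify r ((bellman h ^^ k) f) x"
proof -
  let ?v = "(bellman h ^^ k) f"
  note v = bellman_iter_bounded_lipschitz[OF f, of k h]
  have L: "0 \<le> L" using bounded_lipschitzD(6)[OF f] .
  have "\<bar>step (\<sigma> * sqrt h) (mollify r ?v) x - mollify r ?v x - (\<sigma> * sqrt h)\<^sup>2 * second_diff r ?v x / 2\<bar>
      \<le> 4 * L / r\<^sup>2 * third * \<bar>\<sigma> * sqrt h\<bar> ^ 3"
    by (rule step_taylor(2)[OF mollify_derivatives[OF v r] second_diff_lipschitz[OF v r]])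
  also have "\<dots> \<le> 4 * L / r\<^sup>2 * third * (hi * sqrt h) ^ 3"
    using \<sigma> lo_nonneg h L third_nonneg
    by (intro mult_left_mono power_mono) (auto simp: abs_mult mult_right_mono)
  also have "(hi * sqrt h) ^ 3 = hi ^ 3 * sqrt h * h"
    using h by (simp add: power_mult_distrib power3_eq_cube)
  finally show ?thesis
    using step_mollify_le[OF f \<sigma>, of h r k x] h by (simp add: power_mult_distrib algebra_simps abs_le_iff)
qed

text \<open>The coarse, smoothed and interpolated value function is an approximate supersolution for
  every finer walk. The error per unit time is of order \<open>sqrt h\<close> with the coarse
  \<open>h\<close>, however small \<open>h'\<close> is.\<close>

lemma interpolated_supersolution:
  assumes f: "bounded_lipschitz B L f" and r: "0 < r" and h: "0 < h" and h': "0 \<le> h'" "h' \<le> h"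
    and s: "0 \<le> s" and \<sigma>: "\<sigma> \<in> {lo..hi}"
  defines "U \<equiv> \<lambda>s x. interpolate (\<lambda>k. mollify r ((bellman h ^^ k) f) x) (s / h)"
  shows "integrable \<mu> (\<lambda>e. U s (x + \<sigma> * sqrt h' * e))"
    and "step (\<sigma> * sqrt h') (U s) x \<le> U (s + h') x + h' * (4 * L / r\<^sup>2 * hi ^ 3 * (1 + 2 * third) * sqrt h)"
proof -
  define k where "k = nat \<lfloor>s / h\<rfloor>"
  define \<theta> where "\<theta> = s / h - real k"
  define v where "v = (\<lambda>k. (bellman h ^^ k) f)"
  define K where "K = 4 * L / r\<^sup>2"
  define w1 where "w1 = (\<lambda>k x. (average r (v k) (x + r) - average r (v k) x) / r)"
  have v: "bounded_lipschitz B L (v k)" for k unfolding v_def by (rule bellman_iter_bounded_lipschitz[OF f])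
  have L: "0 \<le> L" using bounded_lipschitzD(6)[OF f] .
  have K: "0 \<le> K" using L by (simp add: K_def)
  have \<theta>: "0 \<le> \<theta>" "\<theta> \<le> 1"
    using s h unfolding \<theta>_def k_def by (auto simp: le_floor_iff) linarith+
  define S where "S = (\<lambda>x. (1 - \<theta>) * second_diff r (v k) x + \<theta> * second_diff r (v (Suc k)) x)"
  have U: "U s = (\<lambda>x. (1 - \<theta>) * mollify r (v k) x + \<theta> * mollify r (v (Suc k)) x)"
    unfolding U_def interpolate_def Let_def k_def[symmetric] \<theta>_def[symmetric] v_def ..
  have d1: "(U s has_real_derivative (1 - \<theta>) * w1 k x + \<theta> * w1 (Suc k) x) (at x)" for x
    unfolding U w1_def by (intro DERIV_add DERIV_cmult mollify_derivatives(1)[OF v r])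
  have d2: "((\<lambda>x. (1 - \<theta>) * w1 k x + \<theta> * w1 (Suc k) x) has_real_derivative S x) (at x)" for x
    unfolding S_def w1_def by (intro DERIV_add DERIV_cmult mollify_derivatives(2)[OF v r])
  have lip: "\<bar>S x - S y\<bar> \<le> K * \<bar>x - y\<bar>" for x y
  proof -
    have "S x - S y = (1 - \<theta>) * (second_diff r (v k) x - second_diff r (v k) y)
        + \<theta> * (second_diff r (v (Suc k)) x - second_diff r (v (Suc k)) y)"
      by (simp add: S_def algebra_simps)
    also have "\<bar>\<dots>\<bar> \<le> (1 - \<theta>) * \<bar>second_diff r (v k) x - second_diff r (v k) y\<bar>
        + \<theta> * \<bar>second_diff r (v (Suc k)) x - second_diff r (v (Suc k)) y\<bar>"
      using \<theta> by (intro order_trans[OF abs_triangle_ineq]) (simp add: abs_mult)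
    also have "\<dots> \<le> (1 - \<theta>) * (K * \<bar>x - y\<bar>) + \<theta> * (K * \<bar>x - y\<bar>)"
      using \<theta> unfolding K_def by (intro add_mono mult_left_mono second_diff_lipschitz[OF v r]) auto
    finally show ?thesis by (simp add: algebra_simps)
  qed
  note taylor = step_taylor[OF d1 d2 lip]
  show "integrable \<mu> (\<lambda>e. U s (x + \<sigma> * sqrt h' * e))" by (rule taylor(1))
  \<comment> \<open>Bound for the change of \<open>second_diff\<close> from one coarse time level to
    the next; the interpolation mixes two levels.\<close>
  define c where "c = K * hi * sqrt h"
  have inc: "\<bar>second_diff r (v (Suc k)) x - second_diff r (v k) x\<bar> \<le> c" for k
    using second_diff_close[of "v (Suc k)" "v k" "L * (hi * sqrt h)" r x] r
      bellman_iter_increment[OF f, of h k] h by (simp add: v_def c_def K_def)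
  have c: "0 \<le> c" using K hi_pos h by (simp add: c_def)
  have \<sigma>2: "\<sigma>\<^sup>2 \<le> hi\<^sup>2" using \<sigma> lo_nonneg by (intro power_mono) auto
  define Q where "Q = \<sigma>\<^sup>2 * second_diff r (v k) x / 2"
  define e where "e = K * third * hi ^ 3 * sqrt h"
  have \<sigma>c: "\<sigma>\<^sup>2 * c / 2 \<le> hi\<^sup>2 * c / 2" using \<sigma>2 c by (simp add: mult_right_mono)
  have SQ: "\<sigma>\<^sup>2 * S x / 2 \<le> Q + hi\<^sup>2 * c / 2"
  proof -
    have "S x - second_diff r (v k) x = \<theta> * (second_diff r (v (Suc k)) x - second_diff r (v k) x)"
      by (simp add: S_def algebra_simps)
    also have "\<dots> \<le> \<theta> * c" using inc[of k] \<theta> by (intro mult_left_mono) auto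
    also have "\<dots> \<le> c" using \<theta> c by (simp add: mult_left_le_one_le)
    finally have "S x \<le> second_diff r (v k) x + c" by simp
    then have "\<sigma>\<^sup>2 * S x / 2 \<le> \<sigma>\<^sup>2 * (second_diff r (v k) x + c) / 2" by (simp add: mult_left_mono)
    then show ?thesis using \<sigma>c by (simp add: Q_def algebra_simps)
  qed
  have "\<bar>step (\<sigma> * sqrt h') (U s) x - U s x - (\<sigma> * sqrt h')\<^sup>2 * S x / 2\<bar> \<le> K * third * \<bar>\<sigma> * sqrt h'\<bar> ^ 3"
    by (rule taylor(2))
  also have "\<dots> \<le> K * third * (hi * sqrt h') ^ 3"
    using \<sigma> lo_nonneg h' K third_nonneg
    by (intro mult_left_mono power_mono) (auto simp: abs_mult mult_right_mono)
  also have "(hi * sqrt h') ^ 3 = hi ^ 3 * sqrt h' * h'"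
    using h' by (simp add: power_mult_distrib power3_eq_cube)
  also have "K * third * (hi ^ 3 * sqrt h' * h') \<le> K * third * (hi ^ 3 * sqrt h * h')"
    using h' K third_nonneg hi_pos by (intro mult_left_mono mult_right_mono) auto
  finally have 1: "step (\<sigma> * sqrt h') (U s) x \<le> U s x + h' * (\<sigma>\<^sup>2 * S x / 2) + h' * e"
    using h' by (simp add: power_mult_distrib e_def abs_le_iff algebra_simps)
  \<comment> \<open>The growth rate is bounded below on the current and on the following coarse
    cell, since the fine step may end in the latter.\<close>
  have 2: "h' * (Q - hi\<^sup>2 * c / 2 - e) \<le> U (s + h') x - U s x"
  proof -
    have "(h' / h) * (h * (Q - hi\<^sup>2 * c / 2 - e)) \<le> U (s + h') x - U s x"
      unfolding U_def add_divide_distrib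
    proof (rule interpolate_increment[OF _ _ _ k_def])
      have "h * (Q - hi\<^sup>2 * c / 2 - e) \<le> h * (Q - e)" using h c by (intro mult_left_mono) auto
      also have "\<dots> \<le> mollify r (v (Suc k)) x - mollify r (v k) x"
        using mollify_increment[OF f r _ \<sigma>, of h k x] h by (simp add: Q_def e_def K_def v_def)
      finally show "h * (Q - hi\<^sup>2 * c / 2 - e) \<le> mollify r ((bellman h ^^ Suc k) f) x - mollify r ((bellman h ^^ k) f) x"
        by (simp add: v_def)
      have "\<sigma>\<^sup>2 * second_diff r (v k) x / 2 \<le> \<sigma>\<^sup>2 * (second_diff r (v (Suc k)) x + c) / 2"
        using inc[of k] by (intro divide_right_mono mult_left_mono) auto
      then have "Q - hi\<^sup>2 * c / 2 \<le> \<sigma>\<^sup>2 * second_diff r (v (Suc k)) x / 2"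
        using \<sigma>c by (simp add: Q_def algebra_simps)
      then have "h * (Q - hi\<^sup>2 * c / 2 - e) \<le> h * (\<sigma>\<^sup>2 * second_diff r (v (Suc k)) x / 2 - e)"
        using h by (intro mult_left_mono) auto
      also have "\<dots> \<le> mollify r (v (Suc (Suc k))) x - mollify r (v (Suc k)) x"
        using mollify_increment[OF f r _ \<sigma>, of h "Suc k" x] h by (simp add: e_def K_def v_def)
      finally show "h * (Q - hi\<^sup>2 * c / 2 - e) \<le>
          mollify r ((bellman h ^^ Suc (Suc k)) f) x - mollify r ((bellman h ^^ Suc k) f) x"
        by (simp add: v_def)
    qed (use s h h' in auto)
    then show ?thesis using h by simp
  qed
  have "h' * (\<sigma>\<^sup>2 * S x / 2) \<le> h' * (Q + hi\<^sup>2 * c / 2)" using SQ h' by (intro mult_left_mono) auto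
  \<comment> \<open>\<open>c\<close> enters once through \<open>SQ\<close> and once through the
    interpolation, each time halved; \<open>e\<close> is the Taylor error of the fine and of the
    coarse step.\<close>
  then have "step (\<sigma> * sqrt h') (U s) x \<le> U (s + h') x + h' * (hi\<^sup>2 * c + 2 * e)"
    using 1 2 by (simp add: algebra_simps)
  also have "hi\<^sup>2 * c + 2 * e = K * hi ^ 3 * (1 + 2 * third) * sqrt h"
    by (simp add: c_def e_def power2_eq_square power3_eq_cube algebra_simps)
  finally show "step (\<sigma> * sqrt h') (U s) x \<le> U (s + h') x + h' * (4 * L / r\<^sup>2 * hi ^ 3 * (1 + 2 * third) * sqrt h)"
    by (simp add: K_def)
qed

text \<open>The fine walk is compared with the coarse supersolution. Smoothing costs
  \<open>2 * L * r\<close> at each end; the last term involves only the coarse \<open>n\<close>, so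
  refining a fine enough grid hardly increases the value.\<close>

lemma bellman_refine:
  assumes f: "bounded_lipschitz B L f" and r: "0 < r" and n: "0 < n" "n \<le> N"
  shows "(bellman (1 / real N) ^^ N) f x \<le> (bellman (1 / real n) ^^ n) f x
    + 4 * L * r + 4 * L / r\<^sup>2 * hi ^ 3 * (1 + 2 * third) * sqrt (1 / real n)"
proof -
  define h where "h = 1 / real n"
  define h' where "h' = 1 / real N"
  have h: "0 < h" "0 \<le> h'" "h' \<le> h" using n by (auto simp: h_def h'_def field_simps)
  define W where "W = (\<lambda>s x. interpolate (\<lambda>k. mollify r ((bellman h ^^ k) f) x) (s / h))"
  define C where "C = 4 * L / r\<^sup>2 * hi ^ 3 * (1 + 2 * third) * sqrt h"
  have sup: "integrable \<mu> (\<lambda>e. W s (x + \<sigma> * sqrt h' * e))"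
    "step (\<sigma> * sqrt h') (W s) x \<le> W (s + h') x + h' * C" if "0 \<le> s" "\<sigma> \<in> {lo..hi}" for s x \<sigma>
    unfolding W_def C_def using interpolated_supersolution[OF f r h that, of x] by simp_all
  have "(bellman h' ^^ N) f x \<le> (W (real N * h') x + 2 * L * r) + real N * (h' * C)"
  proof (rule bellman_iter_upper[OF f, where U = "\<lambda>k x. W (real k * h') x + 2 * L * r"])
    show "f x \<le> W (real 0 * h') x + 2 * L * r" for x
      using mollify_close[OF f r, of x] interpolate_of_nat[of _ 0] by (simp add: W_def abs_le_iff)
    fix k x \<sigma> assume \<sigma>: "\<sigma> \<in> {lo..hi}"
    have k: "0 \<le> real k * h'" using h by simp
    show int: "integrable \<mu> (\<lambda>e. W (real k * h') (x + \<sigma> * sqrt h' * e) + 2 * L * r)"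
      using sup(1)[OF k \<sigma>] by simp
    have "step (\<sigma> * sqrt h') (\<lambda>x. W (real k * h') x + 2 * L * r) x = step (\<sigma> * sqrt h') (W (real k * h')) x + 2 * L * r"
      using sup(1)[OF k \<sigma>] by (simp add: shifted_mean_def)
    then show "step (\<sigma> * sqrt h') (\<lambda>x. W (real k * h') x + 2 * L * r) x \<le> W (real (Suc k) * h') x + 2 * L * r + h' * C"
      using sup(2)[OF k \<sigma>, of x] by (simp add: algebra_simps)
  qed
  also have "real N * h' = 1" using n by (simp add: h'_def)
  also have "real N * (h' * C) = C" using n by (simp add: h'_def)
  also have "W 1 x = mollify r ((bellman h ^^ n) f) x"
    using interpolate_of_nat[of "\<lambda>k. mollify r ((bellman h ^^ k) f) x" n] by (simp add: W_def h_def)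
  also have "\<dots> \<le> (bellman h ^^ n) f x + 2 * L * r"
    using mollify_close[OF bellman_iter_bounded_lipschitz[OF f] r, of n h x] by (simp add: abs_le_iff)
  finally show ?thesis by (simp add: h_def h'_def C_def)
qed

end

text \<open>Boundedness provides a convergent subsequence. Its earlier members bound the tail of the
  whole sequence from above, its later members bound each term from below.\<close>

lemma convergent_if_eventually_decreasing:
  fixes a :: "nat \<Rightarrow> real"
  assumes bd: "\<And>n. \<bar>a n\<bar> \<le> B"
    and dec: "\<And>e. 0 < e \<Longrightarrow> \<exists>n0. \<forall>n\<ge>n0. \<forall>N\<ge>n. a N \<le> a n + e"
  shows "convergent a"
proof -
  have "bounded (range a)" using bd by (auto simp: bounded_iff)
  then obtain l \<rho> where \<rho>: "strict_mono \<rho>" and lim: "(a \<circ> \<rho>) \<longlonglongrightarrow> l"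
    using bounded_imp_convergent_subsequence by blast
  have "a \<longlonglongrightarrow> l"
  proof (rule LIMSEQ_I)
    fix e :: real assume e: "0 < e"
    obtain n0 where n0: "\<And>n N. n0 \<le> n \<Longrightarrow> n \<le> N \<Longrightarrow> a N \<le> a n + e / 3"
      using dec[of "e / 3"] e by auto
    obtain j0 where j0: "\<And>j. j0 \<le> j \<Longrightarrow> \<bar>a (\<rho> j) - l\<bar> < e / 3"
      using LIMSEQ_D[OF lim, of "e / 3"] e by auto
    define j where "j = max j0 n0"
    have j: "n0 \<le> \<rho> j" using seq_suble[OF \<rho>, of j] by (simp add: j_def)
    show "\<exists>no. \<forall>n\<ge>no. norm (a n - l) < e"
    proof (intro exI allI impI)
      fix n assume n: "\<rho> j \<le> n"
      have "n \<le> \<rho> (max j n)" using seq_suble[OF \<rho>, of "max j n"] by simp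
      then have "a (\<rho> (max j n)) \<le> a n + e / 3" using n0[of n "\<rho> (max j n)"] n j by simp
      moreover have "\<bar>a (\<rho> (max j n)) - l\<bar> < e / 3" by (rule j0) (simp add: j_def)
      moreover have "a n \<le> a (\<rho> j) + e / 3" using n0[OF j n] .
      moreover have "\<bar>a (\<rho> j) - l\<bar> < e / 3" by (rule j0) (simp add: j_def)
      ultimately show "norm (a n - l) < e" unfolding real_norm_def by linarith
    qed
  qed
  then show ?thesis by (rule convergentI)
qed

theorem (in controlled_walk) bellman_convergent:
  assumes f: "bounded_lipschitz B L f"
  shows "convergent (\<lambda>n. (bellman (1 / real n) ^^ n) f x)"
proof (rule convergent_if_eventually_decreasing)
  show "\<bar>(bellman (1 / real n) ^^ n) f x\<bar> \<le> B" for n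
    by (rule bounded_lipschitzD(1)[OF bellman_iter_bounded_lipschitz[OF f]])
  fix e :: real assume e: "0 < e"
  have L: "0 \<le> L" using bounded_lipschitzD(6)[OF f] .
  \<comment> \<open>\<open>L + 1\<close> instead of \<open>L\<close> avoids a division by zero.
    \<open>r\<close> is fixed before \<open>n\<close>, so the term with \<open>1 / r\<^sup>2\<close>
    still tends to 0.\<close>
  define r where "r = e / (8 * (L + 1))"
  have r: "0 < r" using e L by (simp add: r_def)
  have "4 * L * r \<le> 4 * (L + 1) * r" using r by simp
  also have "\<dots> = e / 2" using L by (simp add: r_def field_simps)
  finally have Lr: "4 * L * r \<le> e / 2" .
  define C where "C = 4 * L / r\<^sup>2 * hi ^ 3 * (1 + 2 * third)"
  have "(\<lambda>n. C * sqrt (1 / real n)) \<longlonglongrightarrow> C * sqrt 0"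
    by (intro tendsto_intros lim_1_over_n)
  then obtain n0 where n0: "\<And>n. n0 \<le> n \<Longrightarrow> C * sqrt (1 / real n) < e / 2"
    using order_tendstoD(2)[of _ "C * sqrt 0" sequentially "e / 2"] e by (auto simp: eventually_sequentially)
  show "\<exists>n0. \<forall>n\<ge>n0. \<forall>N\<ge>n. (bellman (1 / real N) ^^ N) f x \<le> (bellman (1 / real n) ^^ n) f x + e"
  proof (intro exI allI impI)
    fix n N assume n: "max 1 n0 \<le> n" and N: "n \<le> N"
    show "(bellman (1 / real N) ^^ N) f x \<le> (bellman (1 / real n) ^^ n) f x + e"
      using bellman_refine[OF f r _ N, of x] n0[of n] n Lr by (simp add: C_def)
  qed
qed

subsection \<open>The control problem and its dynamic programming equation\<close>

lemma space_natural_filtration [simp]: "space (natural_filtration M \<epsilon> k) = space M"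
  by (subst natural_filtration_def, rule space_measure_of) auto

lemma sets_natural_filtration:
  "sets (natural_filtration M \<epsilon> k) =
    sigma_sets (space M) (\<Union>j\<in>{1..k}. {\<epsilon> j -` A \<inter> space M | A. A \<in> sets borel})"
proof -
  have "{\<epsilon> j -` A \<inter> space M | j A. j \<in> {1..k} \<and> A \<in> sets borel} =
      (\<Union>j\<in>{1..k}. {\<epsilon> j -` A \<inter> space M | A. A \<in> sets borel})" by blast
  then show ?thesis unfolding natural_filtration_def by (subst sets_measure_of) auto
qed

lemma natural_filtration_mono:
  assumes "k \<le> k'" "X \<in> measurable (natural_filtration M \<epsilon> k) N"
  shows "X \<in> measurable (natural_filtration M \<epsilon> k') N"
proof -
  have "sets (natural_filtration M \<epsilon> k) \<subseteq> sets (natural_filtration M \<epsilon> k')"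
    unfolding sets_natural_filtration by (rule sigma_sets_mono', rule UN_mono) (use assms(1) in auto)
  then show ?thesis using assms(2) by (auto simp: measurable_def)
qed

lemma noise_measurable_natural_filtration:
  assumes "1 \<le> j" "j \<le> k" shows "\<epsilon> j \<in> borel_measurable (natural_filtration M \<epsilon> k)"
proof (rule measurableI)
  fix A :: "real set" assume "A \<in> sets borel"
  then show "\<epsilon> j -` A \<inter> space (natural_filtration M \<epsilon> k) \<in> sets (natural_filtration M \<epsilon> k)"
    using assms unfolding sets_natural_filtration space_natural_filtration
    by (intro sigma_sets.Basic UN_I[of j]) auto
qed simp

locale iid_noise = prob_space M for M :: "'a measure" +
  fixes \<epsilon> :: "nat \<Rightarrow> 'a \<Rightarrow> real" and lo hi :: real
  assumes iid: "iid_standard M \<epsilon>"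
    and range: "0 \<le> lo" "lo \<le> hi" "0 < hi"
begin

lemma iidD:
  "indep_vars (\<lambda>_. borel) \<epsilon> {1..}"
  "1 \<le> i \<Longrightarrow> distr M borel (\<epsilon> i) = distr M borel (\<epsilon> 1)"
  "1 \<le> i \<Longrightarrow> integrable M (\<lambda>\<omega>. \<bar>\<epsilon> i \<omega>\<bar> ^ 3)"
  "1 \<le> i \<Longrightarrow> (\<integral>\<omega>. \<epsilon> i \<omega> \<partial>M) = 0"
  "1 \<le> i \<Longrightarrow> (\<integral>\<omega>. (\<epsilon> i \<omega>)\<^sup>2 \<partial>M) = 1"
  using iid unfolding iid_standard_def by blast+

definition law :: "real measure" where "law = distr M borel (\<epsilon> 1)"

lemma noise_measurable [measurable]: "1 \<le> i \<Longrightarrow> \<epsilon> i \<in> borel_measurable M"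
  using iidD(1) unfolding indep_vars_def2 by simp

lemma distr_noise: "1 \<le> i \<Longrightarrow> distr M borel (\<epsilon> i) = law"
  unfolding law_def by (rule iidD(2))

sublocale W: controlled_walk law lo hi
proof -
  have [measurable]: "\<epsilon> 1 \<in> borel_measurable M" by (rule noise_measurable) simp
  have "integrable M (\<lambda>\<omega>. \<bar>\<epsilon> 1 \<omega>\<bar> ^ 3)" "(\<integral>\<omega>. \<epsilon> 1 \<omega> \<partial>M) = 0" "(\<integral>\<omega>. (\<epsilon> 1 \<omega>)\<^sup>2 \<partial>M) = 1"
    using iidD(3-5)[of 1] by simp_all
  then have "noise law"
    unfolding noise_def noise_axioms_def real_distribution_def real_distribution_axioms_def law_def
    by (simp add: prob_space_distr integrable_distr_eq integral_distr)
  then show "controlled_walk law lo hi"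
    using range by (simp add: controlled_walk_def controlled_walk_axioms_def)
qed

lemma measurable_from_natural_filtration:
  assumes "X \<in> measurable (natural_filtration M \<epsilon> k) N" shows "X \<in> measurable M N"
proof -
  have "sets (natural_filtration M \<epsilon> k) \<subseteq> sets M"
    unfolding sets_natural_filtration
  proof (rule sets.sigma_sets_subset, rule UN_least, rule subsetI)
    fix j B assume j: "j \<in> {1..k}" and "B \<in> {\<epsilon> j -` A \<inter> space M | A. A \<in> sets borel}"
    then obtain A where "B = \<epsilon> j -` A \<inter> space M" "A \<in> sets borel" by blast
    then show "B \<in> sets M" using measurable_sets[OF noise_measurable, of j A] j by simp
  qed
  then show ?thesis using assms by (auto simp: measurable_def)
qed

text \<open>The events of a single noise variable form an intersection-stable family, so
  independence passes to the sigma-algebras generated by disjoint blocks of indices, here 1, ..., k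
  and k + 1.\<close>

lemma indep_next_noise:
  "indep_set (sets (natural_filtration M \<epsilon> k)) {\<epsilon> (Suc k) -` A \<inter> space M | A. A \<in> sets borel}"
proof -
  define E where "E = (\<lambda>i. {\<epsilon> i -` A \<inter> space M | A. A \<in> sets (borel :: real measure)})"
  define I where "I = case_bool {1..k} {Suc k}"
  have "indep_sets E {1..}"
    using iidD(1) unfolding indep_vars_def2 E_def by blast
  then have "indep_sets E (\<Union>j\<in>UNIV. I j)"
    by (rule indep_sets_mono_index[rotated]) (auto simp: I_def split: bool.splits)
  then have "indep_sets (\<lambda>j. sigma_sets (space M) (\<Union>i\<in>I j. E i)) UNIV"
  proof (rule indep_sets_collect_sigma)
    show "Int_stable (E i)" for i
      unfolding E_def Int_stable_def
    proof clarify
      fix A B :: "real set" assume "A \<in> sets borel" "B \<in> sets borel"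
      then show "\<exists>C. \<epsilon> i -` A \<inter> space M \<inter> (\<epsilon> i -` B \<inter> space M) = \<epsilon> i -` C \<inter> space M \<and> C \<in> sets borel"
        by (intro exI[of _ "A \<inter> B"]) auto
    qed
    show "disjoint_family_on I UNIV"
      by (auto simp: disjoint_family_on_def I_def split: bool.splits)
  qed
  then show ?thesis
    unfolding indep_set_def
  proof (rule indep_sets_mono_sets)
    show "(case j of True \<Rightarrow> sets (natural_filtration M \<epsilon> k)
        | False \<Rightarrow> {\<epsilon> (Suc k) -` A \<inter> space M | A. A \<in> sets borel}) \<subseteq> sigma_sets (space M) (\<Union>i\<in>I j. E i)" for j
      by (cases j) (auto simp: I_def E_def sets_natural_filtration)
  qed
qed

lemma distr_next_noise:
  assumes X: "X \<in> measurable (natural_filtration M \<epsilon> k) N"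
  shows "distr M N X \<Otimes>\<^sub>M law = distr M (N \<Otimes>\<^sub>M borel) (\<lambda>\<omega>. (X \<omega>, \<epsilon> (Suc k) \<omega>))"
proof -
  have [measurable]: "X \<in> measurable M N" using X by (rule measurable_from_natural_filtration)
  interpret X: prob_space "distr M N X" by (rule prob_space_distr) measurable
  show ?thesis
  proof (rule pair_measure_eqI)
    show "sigma_finite_measure (distr M N X)" "sigma_finite_measure law" by standard+
    show "sets (distr M N X \<Otimes>\<^sub>M law) = sets (distr M (N \<Otimes>\<^sub>M borel) (\<lambda>\<omega>. (X \<omega>, \<epsilon> (Suc k) \<omega>)))"
      unfolding sets_distr by (rule sets_pair_measure_cong) simp_all
    fix A B assume "A \<in> sets (distr M N X)" "B \<in> sets law"
    then have A [measurable]: "A \<in> sets N" and B [measurable]: "B \<in> sets borel" by simp_all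
    have "prob ((X -` A \<inter> space M) \<inter> (\<epsilon> (Suc k) -` B \<inter> space M)) =
        prob (X -` A \<inter> space M) * prob (\<epsilon> (Suc k) -` B \<inter> space M)"
      by (rule indep_setD[OF indep_next_noise]) (use measurable_sets[OF X A] B in auto)
    moreover have "(\<lambda>\<omega>. (X \<omega>, \<epsilon> (Suc k) \<omega>)) -` (A \<times> B) \<inter> space M =
        (X -` A \<inter> space M) \<inter> (\<epsilon> (Suc k) -` B \<inter> space M)" by auto
    moreover have "emeasure law B = emeasure M (\<epsilon> (Suc k) -` B \<inter> space M)"
      unfolding distr_noise[of "Suc k", simplified, symmetric] using B by (intro emeasure_distr) simp_all
    ultimately show "emeasure (distr M N X) A * emeasure law B =
        emeasure (distr M (N \<Otimes>\<^sub>M borel) (\<lambda>\<omega>. (X \<omega>, \<epsilon> (Suc k) \<omega>))) (A \<times> B)"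
      by (simp add: emeasure_distr emeasure_eq_measure ennreal_mult)
  qed
qed

text \<open>Freezing lemma: given the past, \<open>X\<close> and \<open>Y\<close> act as constants
  and only the next noise is averaged. As the joint law is a product, this is Fubini's
  theorem.\<close>

lemma expectation_next_noise:
  fixes v :: "real \<Rightarrow> real"
  assumes v: "bounded_lipschitz B L v"
    and X: "X \<in> borel_measurable (natural_filtration M \<epsilon> k)"
    and Y: "Y \<in> borel_measurable (natural_filtration M \<epsilon> k)"
  shows "(\<integral>\<omega>. v (X \<omega> + Y \<omega> * \<epsilon> (Suc k) \<omega>) \<partial>M) = (\<integral>\<omega>. W.step (Y \<omega>) v (X \<omega>) \<partial>M)"
    and "integrable M (\<lambda>\<omega>. W.step (Y \<omega>) v (X \<omega>))"
proof -
  have [measurable]: "v \<in> borel_measurable borel" by (rule bounded_lipschitz_measurable[OF v])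
  have [measurable]: "X \<in> borel_measurable M" "Y \<in> borel_measurable M"
    using measurable_from_natural_filtration[OF X] measurable_from_natural_filtration[OF Y] .
  define Z where "Z = (\<lambda>\<omega>. (X \<omega>, Y \<omega>))"
  have [measurable]: "Z \<in> M \<rightarrow>\<^sub>M borel \<Otimes>\<^sub>M borel" unfolding Z_def by measurable
  have "Z \<in> natural_filtration M \<epsilon> k \<rightarrow>\<^sub>M borel \<Otimes>\<^sub>M borel" unfolding Z_def using X Y by measurable
  note eq = distr_next_noise[OF this]
  interpret Z: prob_space "distr M (borel \<Otimes>\<^sub>M borel) Z" by (rule prob_space_distr) measurable
  interpret P: pair_prob_space "distr M (borel \<Otimes>\<^sub>M borel) Z" law ..
  define g :: "(real \<times> real) \<times> real \<Rightarrow> real" where "g = (\<lambda>z. v (fst (fst z) + snd (fst z) * snd z))"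
  have [measurable]: "g \<in> borel_measurable ((borel \<Otimes>\<^sub>M borel) \<Otimes>\<^sub>M borel)" unfolding g_def by measurable
  have gB: "norm (g z) \<le> B" for z
    using bounded_lipschitzD(1)[OF v] by (simp add: g_def)
  have g: "integrable (distr M (borel \<Otimes>\<^sub>M borel) Z \<Otimes>\<^sub>M law) g"
  proof (rule P.integrable_const_bound[where B = B])
    show "g \<in> borel_measurable (distr M (borel \<Otimes>\<^sub>M borel) Z \<Otimes>\<^sub>M law)" by measurable
  qed (rule AE_I2, rule gB)
  define G where "G = (\<lambda>z. \<integral>e. g (z, e) \<partial>law)"
  have "case_prod (\<lambda>z e. g (z, e)) \<in> borel_measurable ((borel \<Otimes>\<^sub>M borel) \<Otimes>\<^sub>M law)" by simp
  then have G [measurable]: "G \<in> borel_measurable (borel \<Otimes>\<^sub>M borel)"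
    unfolding G_def by (rule W.borel_measurable_lebesgue_integral)
  have GZ: "G (Z \<omega>) = W.step (Y \<omega>) v (X \<omega>)" for \<omega>
    by (simp add: G_def g_def Z_def shifted_mean_def)
  have "(\<integral>\<omega>. v (X \<omega> + Y \<omega> * \<epsilon> (Suc k) \<omega>) \<partial>M) = (\<integral>\<omega>. g (Z \<omega>, \<epsilon> (Suc k) \<omega>) \<partial>M)"
    by (simp add: g_def Z_def)
  also have "\<dots> = (\<integral>p. g p \<partial>distr M ((borel \<Otimes>\<^sub>M borel) \<Otimes>\<^sub>M borel) (\<lambda>\<omega>. (Z \<omega>, \<epsilon> (Suc k) \<omega>)))"
    by (rule integral_distr[symmetric]) simp_all
  also have "\<dots> = (\<integral>p. g p \<partial>(distr M (borel \<Otimes>\<^sub>M borel) Z \<Otimes>\<^sub>M law))"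
    unfolding eq ..
  also have "\<dots> = (\<integral>z. G z \<partial>distr M (borel \<Otimes>\<^sub>M borel) Z)"
    unfolding G_def by (rule P.integral_fst'[OF g, symmetric])
  also have "\<dots> = (\<integral>\<omega>. G (Z \<omega>) \<partial>M)" by (rule integral_distr) simp_all
  finally show "(\<integral>\<omega>. v (X \<omega> + Y \<omega> * \<epsilon> (Suc k) \<omega>) \<partial>M) = (\<integral>\<omega>. W.step (Y \<omega>) v (X \<omega>) \<partial>M)"
    by (simp only: GZ)
  have "(\<lambda>\<omega>. G (Z \<omega>)) \<in> borel_measurable M" by measurable
  then have "(\<lambda>\<omega>. W.step (Y \<omega>) v (X \<omega>)) \<in> borel_measurable M" by (simp only: GZ)
  then show "integrable M (\<lambda>\<omega>. W.step (Y \<omega>) v (X \<omega>))"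
    using bounded_lipschitzD(1)[OF W.shifted_mean_bounded_lipschitz[OF v]]
    by (intro integrable_const_bound[where B = B]) auto
qed

lemma integrable_bounded_lipschitz_comp:
  assumes v: "bounded_lipschitz B L v" and [measurable]: "X \<in> borel_measurable M"
  shows "integrable M (\<lambda>\<omega>. v (X \<omega>))"
proof (rule integrable_const_bound[where B = B])
  have [measurable]: "v \<in> borel_measurable borel" by (rule bounded_lipschitz_measurable[OF v])
  show "(\<lambda>\<omega>. v (X \<omega>)) \<in> borel_measurable M" by measurable
qed (use bounded_lipschitzD(1)[OF v] in auto)

definition walk :: "real \<Rightarrow> (nat \<Rightarrow> 'a \<Rightarrow> real) \<Rightarrow> nat \<Rightarrow> 'a \<Rightarrow> real" where
  "walk h \<sigma> k \<omega> = (\<Sum>i=1..k. \<sigma> i \<omega> * sqrt h * \<epsilon> i \<omega>)"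

lemma walk_Suc: "walk h \<sigma> (Suc k) \<omega> = walk h \<sigma> k \<omega> + \<sigma> (Suc k) \<omega> * sqrt h * \<epsilon> (Suc k) \<omega>"
  by (simp add: walk_def)

lemma walk_eq_sample_mean: "walk (1 / real n) \<sigma> n \<omega> = sqrt (real n) * sample_mean \<epsilon> \<sigma> n \<omega>"
proof (cases "n = 0")
  case False
  then have "sqrt (1 / real n) = sqrt (real n) / real n"
    by (simp add: real_sqrt_divide real_div_sqrt field_simps)
  then show ?thesis
    by (simp add: walk_def sample_mean_def sum_distrib_left sum_divide_distrib mult_ac)
qed (simp add: walk_def)

lemma predictableD:
  assumes "\<sigma> \<in> predictable_seqs M \<epsilon> lo hi"
  shows "\<sigma> (Suc k) \<in> borel_measurable (natural_filtration M \<epsilon> k)"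
    and "\<omega> \<in> space M \<Longrightarrow> \<sigma> (Suc k) \<omega> \<in> {lo..hi}"
  using assms unfolding predictable_seqs_def by (auto dest: spec[of _ "Suc k"])

lemma walk_measurable:
  assumes "\<sigma> \<in> predictable_seqs M \<epsilon> lo hi"
  shows "walk h \<sigma> k \<in> borel_measurable (natural_filtration M \<epsilon> k)"
proof (induction k)
  case (Suc k)
  have [measurable]: "walk h \<sigma> k \<in> borel_measurable (natural_filtration M \<epsilon> (Suc k))"
    "\<sigma> (Suc k) \<in> borel_measurable (natural_filtration M \<epsilon> (Suc k))"
    using Suc predictableD(1)[OF assms, of k] by (auto intro: natural_filtration_mono[of k])
  have [measurable]: "\<epsilon> (Suc k) \<in> borel_measurable (natural_filtration M \<epsilon> (Suc k))"
    by (rule noise_measurable_natural_filtration) auto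
  have "(\<lambda>\<omega>. walk h \<sigma> k \<omega> + \<sigma> (Suc k) \<omega> * sqrt h * \<epsilon> (Suc k) \<omega>) \<in> borel_measurable (natural_filtration M \<epsilon> (Suc k))"
    by measurable
  then show ?case by (simp add: walk_Suc[abs_def])
qed (simp add: walk_def)

lemma expectation_walk_Suc:
  assumes v: "bounded_lipschitz B L v" and \<sigma>: "\<sigma> \<in> predictable_seqs M \<epsilon> lo hi"
  shows "(\<integral>\<omega>. v (walk h \<sigma> (Suc k) \<omega>) \<partial>M) = (\<integral>\<omega>. W.step (\<sigma> (Suc k) \<omega> * sqrt h) v (walk h \<sigma> k \<omega>) \<partial>M)"
    and "integrable M (\<lambda>\<omega>. W.step (\<sigma> (Suc k) \<omega> * sqrt h) v (walk h \<sigma> k \<omega>))"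
proof -
  note [measurable] = predictableD(1)[OF \<sigma>, of k]
  have "(\<lambda>\<omega>. \<sigma> (Suc k) \<omega> * sqrt h) \<in> borel_measurable (natural_filtration M \<epsilon> k)" by measurable
  note * = expectation_next_noise[OF v walk_measurable[OF \<sigma>] this]
  show "(\<integral>\<omega>. v (walk h \<sigma> (Suc k) \<omega>) \<partial>M) = (\<integral>\<omega>. W.step (\<sigma> (Suc k) \<omega> * sqrt h) v (walk h \<sigma> k \<omega>) \<partial>M)"
    using *(1) by (simp add: walk_Suc)
  show "integrable M (\<lambda>\<omega>. W.step (\<sigma> (Suc k) \<omega> * sqrt h) v (walk h \<sigma> k \<omega>))" using *(2) .
qed

text \<open>Induction on the number of remaining steps: no control beats the supremum taken anew at
  each step.\<close>

lemma expectation_walk_le: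
  assumes f: "bounded_lipschitz B L f" and \<sigma>: "\<sigma> \<in> predictable_seqs M \<epsilon> lo hi"
  shows "(\<integral>\<omega>. f (walk h \<sigma> n \<omega>) \<partial>M) \<le> (W.bellman h ^^ n) f 0"
proof -
  have "(\<integral>\<omega>. f (walk h \<sigma> (k + j) \<omega>) \<partial>M) \<le> (\<integral>\<omega>. (W.bellman h ^^ j) f (walk h \<sigma> k \<omega>) \<partial>M)" for k j
  proof (induction j arbitrary: k)
    case (Suc j)
    let ?v = "(W.bellman h ^^ j) f"
    note v = W.bellman_iter_bounded_lipschitz[OF f, of j h]
    have "(\<integral>\<omega>. f (walk h \<sigma> (k + Suc j) \<omega>) \<partial>M) \<le> (\<integral>\<omega>. ?v (walk h \<sigma> (Suc k) \<omega>) \<partial>M)"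
      using Suc[of "Suc k"] by simp
    also have "\<dots> = (\<integral>\<omega>. W.step (\<sigma> (Suc k) \<omega> * sqrt h) ?v (walk h \<sigma> k \<omega>) \<partial>M)"
      by (rule expectation_walk_Suc(1)[OF v \<sigma>])
    also have "\<dots> \<le> (\<integral>\<omega>. W.bellman h ?v (walk h \<sigma> k \<omega>) \<partial>M)"
    proof (rule integral_mono)
      show "integrable M (\<lambda>\<omega>. W.bellman h ?v (walk h \<sigma> k \<omega>))"
        by (intro integrable_bounded_lipschitz_comp[OF W.bellman_bounded_lipschitz[OF v]]
            measurable_from_natural_filtration[OF walk_measurable[OF \<sigma>]])
      show "W.step (\<sigma> (Suc k) \<omega> * sqrt h) ?v (walk h \<sigma> k \<omega>) \<le> W.bellman h ?v (walk h \<sigma> k \<omega>)"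
        if "\<omega> \<in> space M" for \<omega>
        using W.step_le_bellman[OF v predictableD(2)[OF \<sigma> that]] .
    qed (rule expectation_walk_Suc(2)[OF v \<sigma>])
    finally show ?case by simp
  qed simp
  from this[of 0 n] show ?thesis by (simp add: walk_def prob_space)
qed

end

section \<open>Near-optimal feedback controls\<close>

context controlled_walk
begin

text \<open>A measurable selection theorem is avoided: maximisers are chosen at the points of a grid
  and used on the whole cell. The Lipschitz bounds turn the mesh size into an error of at most
  \<open>e\<close>.\<close>

lemma measurable_feedback:
  assumes v: "bounded_lipschitz B L v" and e: "0 < e"
  obtains g where "g \<in> borel_measurable borel" "\<And>x. g x \<in> {lo..hi}"
    "\<And>x. bellman h v x \<le> step (g x * sqrt h) v x + e"
proof -
  have L: "0 \<le> L" using bounded_lipschitzD(6)[OF v] .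
  \<comment> \<open>Moving within a cell is paid for twice, in \<open>bellman h v\<close> and in
    \<open>step\<close>, hence half of \<open>e\<close> each time.\<close>
  define d where "d = e / (2 * (L + 1))"
  have d: "0 < d" using e L by (simp add: d_def)
  obtain s where s: "\<And>y. s y \<in> {lo..hi}" "\<And>y. bellman h v y = step (s y * sqrt h) v y"
    using bellman_attained[OF v] by metis
  define g where "g = (\<lambda>x. s (d * of_int \<lfloor>x / d\<rfloor>))"
  show thesis
  proof (rule that[of g])
    show "g \<in> borel_measurable borel" unfolding g_def by measurable
    show "g x \<in> {lo..hi}" for x unfolding g_def by (rule s(1))
    fix x
    define y where "y = d * of_int \<lfloor>x / d\<rfloor>"
    have "d * of_int \<lfloor>x / d\<rfloor> \<le> d * (x / d)" "d * (x / d) \<le> d * (of_int \<lfloor>x / d\<rfloor> + 1)"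
      using d by (intro mult_left_mono; linarith)+
    then have "d * of_int \<lfloor>x / d\<rfloor> \<le> x" "x \<le> d * of_int \<lfloor>x / d\<rfloor> + d"
      using d by (simp_all add: distrib_left)
    then have "\<bar>x - y\<bar> \<le> d" using d unfolding y_def abs_le_iff by linarith
    then have "L * \<bar>x - y\<bar> \<le> L * d" using L by (rule mult_left_mono)
    also have "\<dots> \<le> (L + 1) * d" using d by simp
    also have "\<dots> = e / 2" using L by (simp add: d_def field_simps)
    finally have Lxy: "L * \<bar>x - y\<bar> \<le> e / 2" .
    have "bellman h v x \<le> bellman h v y + L * \<bar>x - y\<bar>"
      by (rule bounded_lipschitzD(7)[OF bellman_bounded_lipschitz[OF v]])
    moreover have "step (g x * sqrt h) v y \<le> step (g x * sqrt h) v x + L * \<bar>x - y\<bar>"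
      using bounded_lipschitzD(7)[OF shifted_mean_bounded_lipschitz[OF v], of "g x * sqrt h" y x]
      by (simp add: abs_minus_commute)
    moreover have "bellman h v y = step (g x * sqrt h) v y" using s(2) by (simp add: g_def y_def)
    ultimately show "bellman h v x \<le> step (g x * sqrt h) v x + e" using Lxy by linarith
  qed
qed

end

context iid_noise
begin

text \<open>The walk is built before the control, since a feedback control reads the position of the
  very walk that it drives.\<close>

fun feedback_walk :: "real \<Rightarrow> (nat \<Rightarrow> real \<Rightarrow> real) \<Rightarrow> nat \<Rightarrow> 'a \<Rightarrow> real" where
  "feedback_walk h g 0 \<omega> = 0"
| "feedback_walk h g (Suc k) \<omega> =
    feedback_walk h g k \<omega> + g k (feedback_walk h g k \<omega>) * sqrt h * \<epsilon> (Suc k) \<omega>"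

lemma feedback_walk_measurable:
  assumes [measurable]: "\<And>k. g k \<in> borel_measurable borel"
  shows "feedback_walk h g k \<in> borel_measurable (natural_filtration M \<epsilon> k)"
proof (induction k)
  case 0
  have "feedback_walk h g 0 = (\<lambda>_. 0)" by auto
  then show ?case by simp
next
  case (Suc k)
  have [measurable]: "feedback_walk h g k \<in> borel_measurable (natural_filtration M \<epsilon> (Suc k))"
    using natural_filtration_mono[of k "Suc k"] Suc by auto
  have [measurable]: "\<epsilon> (Suc k) \<in> borel_measurable (natural_filtration M \<epsilon> (Suc k))"
    by (rule noise_measurable_natural_filtration) auto
  have "feedback_walk h g (Suc k) = (\<lambda>\<omega>. feedback_walk h g k \<omega> + g k (feedback_walk h g k \<omega>) * sqrt h * \<epsilon> (Suc k) \<omega>)"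
    by auto
  then show ?case by simp
qed

text \<open>Near-optimal feedback functions, one for each step, combine to a predictable control
  whose total loss is at most the sum of the losses per step.\<close>

lemma expectation_walk_ge:
  assumes f: "bounded_lipschitz B L f" and e: "0 < e"
  obtains \<sigma> where "\<sigma> \<in> predictable_seqs M \<epsilon> lo hi"
    "(W.bellman h ^^ n) f 0 \<le> (\<integral>\<omega>. f (walk h \<sigma> n \<omega>) \<partial>M) + e"
proof -
  define d where "d = e / (real n + 1)"
  have d: "0 < d" using e by (simp add: d_def)
  define v where "v = (\<lambda>j. (W.bellman h ^^ j) f)"
  have v: "bounded_lipschitz B L (v j)" for j
    unfolding v_def by (rule W.bellman_iter_bounded_lipschitz[OF f])
  \<comment> \<open>\<open>g k\<close> steers step k + 1, after which \<open>n - Suc k\<close> steps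
    remain.\<close>
  have "\<forall>k. \<exists>g. g \<in> borel_measurable borel \<and> (\<forall>x. g x \<in> {lo..hi}) \<and>
      (\<forall>x. W.bellman h (v (n - Suc k)) x \<le> W.step (g x * sqrt h) (v (n - Suc k)) x + d)"
    using W.measurable_feedback[OF v d] by metis
  then obtain g where g [measurable]: "\<And>k. g k \<in> borel_measurable borel"
    and g_range: "\<And>k x. g k x \<in> {lo..hi}"
    and g_opt: "\<And>k x. W.bellman h (v (n - Suc k)) x \<le> W.step (g k x * sqrt h) (v (n - Suc k)) x + d"
    by metis
  \<comment> \<open>The control for step i reads the walk after i - 1 steps, which makes it
    predictable.\<close>
  define \<sigma> where "\<sigma> = (\<lambda>i \<omega>. g (i - 1) (feedback_walk h g (i - 1) \<omega>))"
  have \<sigma>: "\<sigma> \<in> predictable_seqs M \<epsilon> lo hi"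
    unfolding predictable_seqs_def
  proof (intro CollectI allI impI conjI ballI)
    fix i :: nat assume "1 \<le> i"
    have [measurable]: "feedback_walk h g (i - 1) \<in> borel_measurable (natural_filtration M \<epsilon> (i - 1))"
      by (rule feedback_walk_measurable) measurable
    show "\<sigma> i \<in> borel_measurable (natural_filtration M \<epsilon> (i - 1))" unfolding \<sigma>_def by measurable
    show "\<sigma> i \<omega> \<in> {lo..hi}" for \<omega> unfolding \<sigma>_def by (rule g_range)
  qed
  have walk: "walk h \<sigma> k = feedback_walk h g k" for k
  proof (induction k)
    case (Suc k)
    then show ?case by (auto simp: walk_Suc \<sigma>_def)
  qed (auto simp: walk_def)
  have "j \<le> n \<Longrightarrow> (\<integral>\<omega>. v j (walk h \<sigma> (n - j) \<omega>) \<partial>M) \<le> (\<integral>\<omega>. f (walk h \<sigma> n \<omega>) \<partial>M) + real j * d" for j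
  proof (induction j)
    case (Suc j)
    define k where "k = n - Suc j"
    have k: "n - j = Suc k" "n - Suc k = j" using Suc by (auto simp: k_def)
    have "(\<integral>\<omega>. v (Suc j) (walk h \<sigma> k \<omega>) \<partial>M) \<le> (\<integral>\<omega>. W.step (\<sigma> (Suc k) \<omega> * sqrt h) (v j) (walk h \<sigma> k \<omega>) + d \<partial>M)"
    proof (rule integral_mono)
      show "integrable M (\<lambda>\<omega>. v (Suc j) (walk h \<sigma> k \<omega>))"
        by (intro integrable_bounded_lipschitz_comp[OF v]
            measurable_from_natural_filtration[OF walk_measurable[OF \<sigma>]])
      show "integrable M (\<lambda>\<omega>. W.step (\<sigma> (Suc k) \<omega> * sqrt h) (v j) (walk h \<sigma> k \<omega>) + d)"
        using expectation_walk_Suc(2)[OF v \<sigma>] by simp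
      show "v (Suc j) (walk h \<sigma> k \<omega>) \<le> W.step (\<sigma> (Suc k) \<omega> * sqrt h) (v j) (walk h \<sigma> k \<omega>) + d" for \<omega>
        using g_opt[of k "feedback_walk h g k \<omega>"] unfolding walk by (simp add: k v_def \<sigma>_def)
    qed
    also have "\<dots> = (\<integral>\<omega>. W.step (\<sigma> (Suc k) \<omega> * sqrt h) (v j) (walk h \<sigma> k \<omega>) \<partial>M) + d"
      using expectation_walk_Suc(2)[OF v \<sigma>] by (simp add: prob_space)
    also have "\<dots> = (\<integral>\<omega>. v j (walk h \<sigma> (Suc k) \<omega>) \<partial>M) + d"
      by (simp add: expectation_walk_Suc(1)[OF v \<sigma>])
    finally show ?case using Suc by (simp add: k k_def algebra_simps)
  qed (simp add: v_def)
  from this[of n] have "(W.bellman h ^^ n) f 0 \<le> (\<integral>\<omega>. f (walk h \<sigma> n \<omega>) \<partial>M) + real n * d"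
    by (simp add: v_def walk_def prob_space)
  moreover have "real n * d \<le> e" using e by (simp add: d_def field_simps)
  ultimately show thesis using \<sigma> by (intro that) auto
qed

definition sup_prob :: "(real \<Rightarrow> bool) \<Rightarrow> nat \<Rightarrow> real" where
  "sup_prob P n = (SUP \<sigma>\<in>predictable_seqs M \<epsilon> lo hi. \<integral>\<omega>. of_bool (P (walk (1 / real n) \<sigma> n \<omega>)) \<partial>M)"

lemma one_sided_sup_eq: "one_sided_sup M \<epsilon> lo hi c = sup_prob (\<lambda>x. c < x)"
  by (simp add: fun_eq_iff one_sided_sup_def sup_prob_def walk_eq_sample_mean)

lemma two_sided_sup_eq: "two_sided_sup M \<epsilon> lo hi c = sup_prob (\<lambda>x. c < \<bar>x\<bar>)"
  by (simp add: fun_eq_iff two_sided_sup_def sup_prob_def walk_eq_sample_mean abs_mult)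

lemma integrable_walk_event:
  assumes "\<sigma> \<in> predictable_seqs M \<epsilon> lo hi" "{x. P x} \<in> sets borel"
  shows "integrable M (\<lambda>\<omega>. of_bool (P (walk h \<sigma> n \<omega>)) :: real)"
proof (rule integrable_const_bound[where B = 1])
  have [measurable]: "walk h \<sigma> n \<in> borel_measurable M"
    by (rule measurable_from_natural_filtration[OF walk_measurable[OF assms(1)]])
  have [measurable]: "Measurable.pred borel P" using assms(2) by (simp add: pred_def)
  show "(\<lambda>\<omega>. of_bool (P (walk h \<sigma> n \<omega>)) :: real) \<in> borel_measurable M" by measurable
qed auto

lemma predictable_const: "(\<lambda>_ _. hi) \<in> predictable_seqs M \<epsilon> lo hi"
  using range by (auto simp: predictable_seqs_def)

lemma expectation_le_sup_prob:
  assumes "\<sigma> \<in> predictable_seqs M \<epsilon> lo hi" "{x. P x} \<in> sets borel"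
  shows "(\<integral>\<omega>. of_bool (P (walk (1 / real n) \<sigma> n \<omega>)) \<partial>M) \<le> sup_prob P n"
  unfolding sup_prob_def
proof (rule cSUP_upper[OF assms(1) bdd_aboveI2])
  fix \<sigma> assume \<sigma>: "\<sigma> \<in> predictable_seqs M \<epsilon> lo hi"
  show "(\<integral>\<omega>. of_bool (P (walk (1 / real n) \<sigma> n \<omega>)) \<partial>M) \<le> (1 :: real)"
    by (rule integral_le_const[OF integrable_walk_event[OF \<sigma> assms(2)]]) auto
qed

lemma sup_prob_le_bellman:
  assumes f: "bounded_lipschitz B L f" and P: "{x. P x} \<in> sets borel" and le: "\<And>x. of_bool (P x) \<le> f x"
  shows "sup_prob P n \<le> (W.bellman (1 / real n) ^^ n) f 0"
  unfolding sup_prob_def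
proof (rule cSUP_least)
  show "predictable_seqs M \<epsilon> lo hi \<noteq> {}" using predictable_const by auto
  fix \<sigma> assume \<sigma>: "\<sigma> \<in> predictable_seqs M \<epsilon> lo hi"
  have "(\<integral>\<omega>. of_bool (P (walk (1 / real n) \<sigma> n \<omega>)) \<partial>M) \<le> (\<integral>\<omega>. f (walk (1 / real n) \<sigma> n \<omega>) \<partial>M)"
    using le by (intro integral_mono integrable_walk_event \<sigma> P integrable_bounded_lipschitz_comp[OF f]
        measurable_from_natural_filtration[OF walk_measurable[OF \<sigma>]]) auto
  then show "(\<integral>\<omega>. of_bool (P (walk (1 / real n) \<sigma> n \<omega>)) \<partial>M) \<le> (W.bellman (1 / real n) ^^ n) f 0"
    using expectation_walk_le[OF f \<sigma>, of "1 / real n" n] by simp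
qed

text \<open>Controls are only known to approach the dynamic programming value up to any
  \<open>e > 0\<close>, hence the passage through \<open>field_le_epsilon\<close>.\<close>

lemma bellman_le_sup_prob:
  assumes f: "bounded_lipschitz B L f" and P: "{x. P x} \<in> sets borel" and le: "\<And>x. f x \<le> of_bool (P x)"
  shows "(W.bellman (1 / real n) ^^ n) f 0 \<le> sup_prob P n"
proof (rule field_le_epsilon)
  fix e :: real assume "0 < e"
  then obtain \<sigma> where \<sigma>: "\<sigma> \<in> predictable_seqs M \<epsilon> lo hi"
    and opt: "(W.bellman (1 / real n) ^^ n) f 0 \<le> (\<integral>\<omega>. f (walk (1 / real n) \<sigma> n \<omega>) \<partial>M) + e"
    by (rule expectation_walk_ge[OF f])
  have "(\<integral>\<omega>. f (walk (1 / real n) \<sigma> n \<omega>) \<partial>M) \<le> (\<integral>\<omega>. of_bool (P (walk (1 / real n) \<sigma> n \<omega>)) \<partial>M)"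
    using le by (intro integral_mono integrable_walk_event \<sigma> P integrable_bounded_lipschitz_comp[OF f]
        measurable_from_natural_filtration[OF walk_measurable[OF \<sigma>]]) auto
  then show "(W.bellman (1 / real n) ^^ n) f 0 \<le> sup_prob P n + e"
    using opt expectation_le_sup_prob[OF \<sigma> P, of n] by simp
qed

end

subsection \<open>Bounds for the iterated operator\<close>

text \<open>Lipschitz substitute for the indicator of a half-line; composed with
  \<open>s * x\<close> or |x| it covers all tail events that occur.\<close>

definition ramp :: "real \<Rightarrow> real \<Rightarrow> real \<Rightarrow> real" where
  "ramp a b x = max 0 (min 1 ((x - a) / (b - a)))"

lemma ramp_bounds: "0 \<le> ramp a b x" "ramp a b x \<le> 1"
  by (auto simp: ramp_def)

lemma ramp_eq_0:
  assumes "a < b" "x \<le> a" shows "ramp a b x = 0"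
proof -
  have "(x - a) / (b - a) \<le> 0" using assms by (intro divide_nonpos_pos) auto
  then show ?thesis by (simp add: ramp_def)
qed

lemma ramp_eq_1: "a < b \<Longrightarrow> b \<le> x \<Longrightarrow> ramp a b x = 1"
  by (auto simp: ramp_def max_def min_def field_simps)

lemma bounded_lipschitz_ramp:
  assumes ab: "a < b" and g: "\<And>x y. \<bar>g x - g y\<bar> \<le> \<bar>x - y\<bar>"
  shows "bounded_lipschitz 1 (1 / (b - a)) (\<lambda>x. ramp a b (g x))"
  unfolding bounded_lipschitz_def
proof (intro conjI allI)
  show "\<bar>ramp a b (g x)\<bar> \<le> 1" for x using ramp_bounds[of a b "g x"] by simp
  fix x y
  have "\<bar>ramp a b (g x) - ramp a b (g y)\<bar> \<le> \<bar>(g x - a) / (b - a) - (g y - a) / (b - a)\<bar>"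
    by (simp add: ramp_def max_def min_def)
  also have "\<dots> = \<bar>g x - g y\<bar> / (b - a)" using ab by (simp add: diff_divide_distrib[symmetric])
  also have "\<dots> \<le> \<bar>x - y\<bar> / (b - a)" using ab g by (intro divide_right_mono) auto
  finally show "\<bar>ramp a b (g x) - ramp a b (g y)\<bar> \<le> 1 / (b - a) * \<bar>x - y\<bar>" by simp
qed

context controlled_walk
begin

text \<open>The front is centred at \<open>c\<close> while \<open>f\<close> lives beyond
  \<open>c + \<eta>\<close>. At the initial time \<open>\<delta>\<close> the front has risen there
  to within \<open>1 - Phi (\<eta> / sqrt \<delta> / hi)\<close> of 1; the other terms are the
  supersolution defect and the discretisation error.\<close>

lemma front_upper:
  assumes f: "bounded_lipschitz B L f" and le: "\<And>x. f x \<le> of_bool (c + \<eta> < s * x)"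
    and l: "0 < l" "lo \<le> l" "l \<le> hi" and \<delta>: "0 < \<delta>" and \<eta>: "0 \<le> \<eta>" and s: "s\<^sup>2 = 1"
    and h: "0 < h" "h \<le> 1" and n: "real n * h \<le> 1"
  shows "(bellman h ^^ n) f x \<le> volatility_pair.profile hi l ((s * x - c) / sqrt (\<delta> + real n * h))
    + (1 - Phi (\<eta> / sqrt \<delta> / hi)) + (l\<^sup>2 - lo\<^sup>2) / (l * \<delta> * hi)
    + volatility_pair.front_bound hi l \<delta> * (third * hi ^ 3 + 1) * sqrt h"
proof -
  interpret V: volatility_pair hi l using l by unfold_locales auto
  have "(bellman h ^^ n) f x \<le> V.front s c (\<delta> + real n * h) x + (1 - Phi (\<eta> / sqrt \<delta> / hi))
      + (l\<^sup>2 - lo\<^sup>2) / (l * \<delta> * hi) + V.front_bound \<delta> * (third * hi ^ 3 + 1) * sqrt h"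
  proof (rule parabolic_upper[OF V.front_parabolic[OF \<delta> s] f])
    fix x
    show "f x \<le> V.front s c \<delta> x + (1 - Phi (\<eta> / sqrt \<delta> / hi))"
    proof (cases "c + \<eta> < s * x")
      case True
      then have "\<eta> / sqrt \<delta> \<le> (s * x - c) / sqrt \<delta>" using \<delta> by (intro divide_right_mono) auto
      then have "V.profile (\<eta> / sqrt \<delta>) \<le> V.front s c \<delta> x" unfolding V.front_def by (rule V.profile_mono)
      moreover have "1 - V.profile (\<eta> / sqrt \<delta>) \<le> 1 - Phi (\<eta> / sqrt \<delta> / hi)"
        using \<delta> \<eta> by (intro V.one_minus_profile_le) simp
      ultimately show ?thesis using le[of x] True by simp
    next
      case False
      then show ?thesis
        using le[of x] V.profile_nonneg Phi_le_1[of "\<eta> / sqrt \<delta> / hi"] by (simp add: V.front_def add_nonneg_nonneg order_trans)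
    qed
  next
    fix \<tau> x \<sigma> assume "\<delta> \<le> \<tau>" "\<sigma> \<in> {lo..hi}"
    then show "\<sigma>\<^sup>2 * V.front2 s c \<tau> x / 2 \<le> V.front_t s c \<tau> x + (l\<^sup>2 - lo\<^sup>2) / (l * \<delta> * hi)"
      using V.front_super[OF \<delta>, of \<tau> lo \<sigma> s c x] l lo_nonneg by auto
  next
    show "0 \<le> (l\<^sup>2 - lo\<^sup>2) / (l * \<delta> * hi)"
      using l \<delta> hi_pos lo_nonneg by (auto intro!: divide_nonneg_pos power_mono)
  qed (use h n in auto)
  then show ?thesis by (simp add: V.front_def)
qed

text \<open>Mirror image of \<open>front_upper\<close>: now \<open>f\<close> is at least 1 already
  from \<open>c - \<eta>\<close> on. The volatility \<open>vol\<close> built into the front is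
  admissible and gives equality in the equation, so no defect term appears.\<close>

lemma front_lower:
  assumes f: "bounded_lipschitz B L f" and ge: "\<And>x. of_bool (c - \<eta> \<le> s * x) \<le> f x"
    and l: "0 < l" "lo \<le> l" "l \<le> hi" and \<delta>: "0 < \<delta>" and s: "s\<^sup>2 = 1"
    and h: "0 < h" "h \<le> 1" and n: "real n * h \<le> 1"
  shows "volatility_pair.profile hi l ((s * x - c) / sqrt (\<delta> + real n * h)) \<le> (bellman h ^^ n) f x
    + 2 * Phi (- \<eta> / sqrt \<delta> / hi) + volatility_pair.front_bound hi l \<delta> * (third * hi ^ 3 + 1) * sqrt h"
proof -
  interpret V: volatility_pair hi l using l by unfold_locales auto
  have "V.front s c (\<delta> + real n * h) x \<le> (bellman h ^^ n) f x
      + 2 * Phi (- \<eta> / sqrt \<delta> / hi) + V.front_bound \<delta> * (third * hi ^ 3 + 1) * sqrt h"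
  proof (rule parabolic_lower[OF V.front_parabolic[OF \<delta> s] f])
    fix x
    show "V.front s c \<delta> x \<le> f x + 2 * Phi (- \<eta> / sqrt \<delta> / hi)"
    proof (cases "c - \<eta> \<le> s * x")
      case True
      then show ?thesis
        using ge[of x] V.profile_le_1[of "(s * x - c) / sqrt \<delta>"] Phi_nonneg[of "- \<eta> / sqrt \<delta> / hi"]
        unfolding V.front_def by simp
    next
      case False
      then have "(s * x - c) / sqrt \<delta> \<le> - \<eta> / sqrt \<delta>" using \<delta> by (intro divide_right_mono) auto
      then have "V.front s c \<delta> x \<le> V.profile (- \<eta> / sqrt \<delta>)" unfolding V.front_def by (rule V.profile_mono)
      also have "\<dots> \<le> 2 * hi / (hi + l) * Phi (- \<eta> / sqrt \<delta> / hi)" by (rule V.profile_le_Phi)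
      also have "\<dots> \<le> 2 * Phi (- \<eta> / sqrt \<delta> / hi)"
        using l hi_pos Phi_nonneg by (intro mult_right_mono) (auto simp: divide_le_eq)
      finally show ?thesis using ge[of x] False by simp
    qed
  next
    fix \<tau> x
    show "\<exists>\<sigma>\<in>{lo..hi}. V.front_t s c \<tau> x \<le> \<sigma>\<^sup>2 * V.front2 s c \<tau> x / 2"
      using V.vol_bounds[of "s * x - c"] l by (intro bexI[of _ "V.vol (s * x - c)"]) (auto simp: V.front_t_def)
  qed (use h n in auto)
  then show ?thesis by (simp add: V.front_def)
qed

text \<open>Near the levels \<open>\<plusminus>c\<close> the sum of the two fronts fails to be a subsolution only by the curvature
  of the remote front, which is Gaussian small; the quadratic corrector absorbs this defect at a
  total cost controlled by Chebyshev's inequality.\<close>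

lemma two_fronts_lower:
  assumes f: "bounded_lipschitz B L f" and ge: "\<And>x. of_bool (c - \<eta> \<le> \<bar>x\<bar>) \<le> f x"
    and l: "0 < l" "lo \<le> l" "l \<le> hi" and \<delta>: "0 < \<delta>" "\<delta> \<le> 1" and \<eta>: "0 \<le> \<eta>" "\<eta> \<le> c" and c: "2 * hi \<le> c"
  defines "w \<equiv> 2 * c / (hi * sqrt (\<delta> + 1))"
  defines "K \<equiv> 2 / (hi + l) * hi / (4 * c\<^sup>2) * (w ^ 3 * std_normal_density w)"
  shows "\<exists>C. \<forall>n>0. 2 * volatility_pair.profile hi l (- c / sqrt (\<delta> + 1)) - (hi\<^sup>2 - l\<^sup>2) / 2 * K * hi\<^sup>2 / (2 * c\<^sup>2)
    \<le> (bellman (1 / real n) ^^ n) f 0 + 4 * Phi (- \<eta> / sqrt \<delta> / hi) + C * sqrt (1 / real n)"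
proof -
  interpret V: volatility_pair hi l using l by unfold_locales auto
  have c0: "0 < c" using c hi_pos by simp
  define k where "k = (hi\<^sup>2 - l\<^sup>2) / 2 * K"
  have w: "0 < w" using c0 hi_pos \<delta> by (simp add: w_def)
  \<comment> \<open>Makes \<open>v ^ 3 * std_normal_density v\<close> decreasing from
    \<open>w\<close> on; here \<open>2 * hi \<le> c\<close> and \<open>\<delta> \<le> 1\<close>
    enter.\<close>
  have w3: "3 \<le> w\<^sup>2"
  proof -
    have "3 * (hi\<^sup>2 * (\<delta> + 1)) \<le> 3 * (hi\<^sup>2 * 2)" using \<delta> by (intro mult_left_mono) auto
    also have "\<dots> \<le> (2 * (2 * hi))\<^sup>2" by (simp add: power2_eq_square)
    also have "\<dots> \<le> (2 * c)\<^sup>2" using c hi_pos by (intro power_mono) auto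
    finally have "3 \<le> (2 * c)\<^sup>2 / (hi\<^sup>2 * (\<delta> + 1))" using hi_pos \<delta> by (simp add: pos_le_divide_eq)
    then show ?thesis using \<delta> by (simp add: w_def power_divide power_mult_distrib)
  qed
  have K: "0 \<le> K" using l hi_pos w by (simp add: K_def)
  have k: "0 \<le> k" using l K by (auto simp: k_def intro!: mult_nonneg_nonneg power_mono)
  have dec: "v ^ 3 * std_normal_density v \<le> w ^ 3 * std_normal_density w" if "w \<le> v" for v
  proof (rule DERIV_nonpos_imp_nonincreasing[OF that])
    fix x assume x: "w \<le> x"
    have "((\<lambda>v. v ^ 3 * std_normal_density v) has_real_derivative
        (3 * x\<^sup>2) * std_normal_density x + - x * std_normal_density x * x ^ 3) (at x)"
      by (rule DERIV_mult[OF _ DERIV_std_normal_density]) (auto intro!: derivative_eq_intros)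
    moreover have "(3 * x\<^sup>2) * std_normal_density x + - x * std_normal_density x * x ^ 3
        = (3 - x\<^sup>2) * (x\<^sup>2 * std_normal_density x)"
      by (simp add: power2_eq_square power3_eq_cube algebra_simps)
    moreover have "w\<^sup>2 \<le> x\<^sup>2" using x w by (intro power_mono) auto
    then have "(3 - x\<^sup>2) * (x\<^sup>2 * std_normal_density x) \<le> 0"
      using w3 by (intro mult_nonpos_nonneg) auto
    ultimately show "\<exists>y. ((\<lambda>v. v ^ 3 * std_normal_density v) has_real_derivative y) (at x) \<and> y \<le> 0"
      by metis
  qed
  \<comment> \<open>Beyond the level on one side, the centre of the other front is at distance at
    least 2c. There that front is convex, uses \<open>hi\<close>, and has curvature at most
    \<open>K\<close>.\<close>
  have remote: "V.front2 s c \<tau> x \<le> K" and remote_t: "V.front_t s c \<tau> x = hi\<^sup>2 * V.front2 s c \<tau> x / 2"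
    if "s * x \<le> - c" "\<delta> \<le> \<tau>" "\<tau> \<le> \<delta> + 1" for s x \<tau>
  proof -
    have \<tau>: "0 < \<tau>" using that \<delta> by simp
    define y where "y = s * x - c"
    have y: "y \<le> - 2 * c" using that(1) by (simp add: y_def)
    then have vol: "V.vol y = hi" "V.vol (y / sqrt \<tau>) = hi" using c0 \<tau> V.vol_scale[of "sqrt \<tau>" y] by (auto simp: V.vol_def)
    show "V.front_t s c \<tau> x = hi\<^sup>2 * V.front2 s c \<tau> x / 2"
      using vol by (simp add: V.front_t_def y_def[symmetric])
    define v where "v = - y / sqrt \<tau> / hi"
    have v: "2 * c / (hi * sqrt \<tau>) \<le> v"
    proof -
      have "2 * c / sqrt \<tau> / hi \<le> - y / sqrt \<tau> / hi"
        using y hi_pos \<tau> by (intro divide_right_mono) auto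
      then show ?thesis by (simp add: v_def mult.commute)
    qed
    have "w \<le> 2 * c / (hi * sqrt \<tau>)"
      unfolding w_def using that c0 hi_pos \<tau> by (intro divide_left_mono mult_left_mono) auto
    then have wv: "w \<le> v" "0 < v" using v w by auto
    have "(2 * c / (hi * sqrt \<tau>))\<^sup>2 \<le> v\<^sup>2" using v c0 hi_pos \<tau> by (intro power_mono) auto
    then have "4 * c\<^sup>2 / (hi\<^sup>2 * \<tau>) \<le> v\<^sup>2" using \<tau> by (simp add: power_divide power_mult_distrib)
    \<comment> \<open>Trading \<open>1 / \<tau>\<close> for a multiple of \<open>v\<^sup>2\<close>
      removes the time, so that one decreasing function of \<open>v\<close> bounds the curvature at
      all times up to \<open>\<delta> + 1\<close>.\<close>
    then have inv: "1 / \<tau> \<le> hi\<^sup>2 / (4 * c\<^sup>2) * v\<^sup>2" using \<tau> hi_pos c0 by (simp add: field_simps)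
    have "hermite1 (y / sqrt \<tau> / hi) = - (v * std_normal_density v)"
      by (simp add: hermite1_def v_def)
    then have "V.front2 s c \<tau> x = 2 / (hi + l) / hi * (v * std_normal_density v) * (1 / \<tau>)"
      using vol by (simp add: V.front2_def V.profile2_def y_def[symmetric])
    also have "\<dots> \<le> 2 / (hi + l) / hi * (v * std_normal_density v) * (hi\<^sup>2 / (4 * c\<^sup>2) * v\<^sup>2)"
      using inv hi_pos l wv by (intro mult_left_mono) auto
    also have "\<dots> = 2 / (hi + l) * hi / (4 * c\<^sup>2) * (v ^ 3 * std_normal_density v)"
      using hi_pos by (simp add: power2_eq_square power3_eq_cube)
    also have "\<dots> \<le> K"
      unfolding K_def using dec[OF wv(1)] hi_pos l c0 by (intro mult_left_mono) auto
    finally show "V.front2 s c \<tau> x \<le> K" .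
  qed
  \<comment> \<open>As in Chebyshev's inequality, \<open>q * x\<^sup>2\<close> is at least the
    largest defect \<open>k\<close> once |x| \<ge> c.\<close>
  define q where "q = k / c\<^sup>2"
  have q: "0 \<le> q" using k by (simp add: q_def)
  \<comment> \<open>Chosen so that \<open>Zt\<close> equals
    \<open>hi\<^sup>2 * Z2 / 2 - q * x\<^sup>2\<close>, with \<open>Z = 0\<close> at time
    \<open>\<delta>\<close>. After unit time its value at 0 is \<open>- q * hi\<^sup>2 / 2\<close>,
    the loss in the statement.\<close>
  define Z where "Z = (\<lambda>\<tau> x. - q * (x\<^sup>2 * (\<tau> - \<delta>) + hi\<^sup>2 * (\<tau> - \<delta>)\<^sup>2 / 2))"
  define Z1 where "Z1 = (\<lambda>\<tau> x. - q * (2 * x * (\<tau> - \<delta>)))"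
  define Z2 where "Z2 = (\<lambda>\<tau> (x::real). - q * (2 * (\<tau> - \<delta>)))"
  define Zt where "Zt = (\<lambda>\<tau> x. - q * (x\<^sup>2 + hi\<^sup>2 * (\<tau> - \<delta>)))"
  have Z: "parabolic_regular \<delta> (q * hi\<^sup>2) Z Z1 Z2 Zt"
    unfolding parabolic_regular_def
  proof (intro conjI allI impI)
    fix \<tau> \<tau>' x y
    show "(Z \<tau> has_real_derivative Z1 \<tau> x) (at x)" "(Z1 \<tau> has_real_derivative Z2 \<tau> x) (at x)"
      unfolding Z_def Z1_def Z2_def by (auto intro!: derivative_eq_intros)
    show "((\<lambda>\<tau>. Z \<tau> x) has_real_derivative Zt \<tau> x) (at \<tau>)"
      unfolding Z_def Zt_def by (rule derivative_eq_intros refl | simp)+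
    show "\<bar>Z2 \<tau> x - Z2 \<tau> y\<bar> \<le> q * hi\<^sup>2 * \<bar>x - y\<bar>" using q by (simp add: Z2_def)
    have "Zt \<tau> x - Zt \<tau>' x = - (q * hi\<^sup>2 * (\<tau> - \<tau>'))" by (simp add: Zt_def algebra_simps)
    then show "\<bar>Zt \<tau> x - Zt \<tau>' x\<bar> \<le> q * hi\<^sup>2 * \<bar>\<tau> - \<tau>'\<bar>" using q by (simp add: abs_mult)
  qed
  let ?V = "\<lambda>\<tau> x. V.front 1 c \<tau> x + V.front (- 1) c \<tau> x + Z \<tau> x"
  let ?V2 = "\<lambda>\<tau> x. V.front2 1 c \<tau> x + V.front2 (- 1) c \<tau> x + Z2 \<tau> x"
  let ?Vt = "\<lambda>\<tau> x. V.front_t 1 c \<tau> x + V.front_t (- 1) c \<tau> x + Zt \<tau> x"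
  define C where "C = (V.front_bound \<delta> + V.front_bound \<delta> + q * hi\<^sup>2) * (third * hi ^ 3 + 1)"
  note reg = parabolic_regular_add[OF parabolic_regular_add[OF V.front_parabolic[OF \<delta>(1), of 1 c] V.front_parabolic[OF \<delta>(1), of "-1" c]] Z]
  have init: "?V \<delta> x \<le> f x + 4 * Phi (- \<eta> / sqrt \<delta> / hi)" for x
  proof -
    define t where "t = 2 * Phi (- \<eta> / sqrt \<delta> / hi)"
    have t: "0 \<le> t" using Phi_nonneg by (simp add: t_def)
    have small: "V.front s c \<delta> x \<le> t" if "s * x \<le> c - \<eta>" for s
    proof -
      have "(s * x - c) / sqrt \<delta> \<le> - \<eta> / sqrt \<delta>" using \<delta> that by (intro divide_right_mono) auto
      then have "V.front s c \<delta> x \<le> V.profile (- \<eta> / sqrt \<delta>)" unfolding V.front_def by (rule V.profile_mono)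
      also have "\<dots> \<le> 2 * hi / (hi + l) * Phi (- \<eta> / sqrt \<delta> / hi)" by (rule V.profile_le_Phi)
      also have "\<dots> \<le> t" unfolding t_def
        using l hi_pos Phi_nonneg by (intro mult_right_mono) (auto simp: divide_le_eq)
      finally show ?thesis .
    qed
    have one: "V.front s c \<delta> x \<le> 1" for s unfolding V.front_def by (rule V.profile_le_1)
    have f0: "0 \<le> f x" using ge[of x] by (auto simp: of_bool_def split: if_splits)
    \<comment> \<open>At most one of the two fronts is not small, as \<open>c - \<eta>\<close> is
      nonnegative; a small one costs \<open>t\<close>.\<close>
    have "V.front 1 c \<delta> x + V.front (- 1) c \<delta> x \<le> f x + (t + t)"
    proof (cases "c - \<eta> \<le> \<bar>x\<bar>")
      case True
      then have f1: "1 \<le> f x" using ge[of x] by simp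
      show ?thesis
      proof (cases "0 \<le> x")
        case True
        then have "V.front (- 1) c \<delta> x \<le> t" using \<eta> by (intro small) auto
        then show ?thesis using one[of 1] f1 t by linarith
      next
        case False
        then have "V.front 1 c \<delta> x \<le> t" using \<eta> by (intro small) auto
        then show ?thesis using one[of "- 1"] f1 t by linarith
      qed
    next
      case False
      then have "V.front 1 c \<delta> x \<le> t" "V.front (- 1) c \<delta> x \<le> t" by (auto intro!: small)
      then show ?thesis using f0 by simp
    qed
    then show ?thesis by (simp add: Z_def t_def)
  qed
  have sub: "\<exists>\<sigma>\<in>{lo..hi}. ?Vt \<tau> x \<le> \<sigma>\<^sup>2 * ?V2 \<tau> x / 2" if \<tau>: "\<delta> \<le> \<tau>" "\<tau> \<le> \<delta> + 1" for \<tau> x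
  proof -
    \<comment> \<open>The near front is concave here and takes the volatility \<open>l\<close>; the
      far one would prefer \<open>hi\<close>, which costs at most \<open>k\<close>, and the decrease
      of \<open>Z\<close> pays for it.\<close>
    have far: "?Vt \<tau> x \<le> l\<^sup>2 * ?V2 \<tau> x / 2" if sx: "c < s * x" and s: "s = 1 \<or> s = - 1" for s
    proof -
      have "V.vol (s * x - c) = l" using sx by (simp add: V.vol_def)
      then have 1: "V.front_t s c \<tau> x = l\<^sup>2 * V.front2 s c \<tau> x / 2" by (simp add: V.front_t_def)
      have sx': "- s * x \<le> - c" using sx by simp
      have "(hi\<^sup>2 - l\<^sup>2) / 2 * V.front2 (- s) c \<tau> x \<le> (hi\<^sup>2 - l\<^sup>2) / 2 * K"
        using remote[OF sx' \<tau>] l by (intro mult_left_mono) (auto intro!: power_mono)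
      then have 2: "V.front_t (- s) c \<tau> x \<le> l\<^sup>2 * V.front2 (- s) c \<tau> x / 2 + k"
        unfolding remote_t[OF sx' \<tau>] k_def by (simp add: left_diff_distrib diff_divide_distrib)
      have "c\<^sup>2 \<le> x\<^sup>2"
      proof -
        have "c\<^sup>2 \<le> (s * x)\<^sup>2" using sx c0 by (intro power_mono) auto
        then show ?thesis using s by auto
      qed
      then have "q * c\<^sup>2 \<le> q * x\<^sup>2" using q by (rule mult_left_mono)
      then have kx: "k \<le> q * x\<^sup>2" using c0 by (simp add: q_def)
      have "l\<^sup>2 \<le> hi\<^sup>2" using l by (intro power_mono) auto
      then have "q * (\<tau> - \<delta>) * l\<^sup>2 \<le> q * (\<tau> - \<delta>) * hi\<^sup>2" using q \<tau> by (intro mult_left_mono) auto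
      then have 3: "Zt \<tau> x + k \<le> l\<^sup>2 * Z2 \<tau> x / 2"
        using kx by (simp add: Zt_def Z2_def algebra_simps)
      have "V.front_t s c \<tau> x + V.front_t (- s) c \<tau> x + Zt \<tau> x
          \<le> l\<^sup>2 * V.front2 s c \<tau> x / 2 + l\<^sup>2 * V.front2 (- s) c \<tau> x / 2 + l\<^sup>2 * Z2 \<tau> x / 2"
        using 1 2 3 by linarith
      then show ?thesis using s by (auto simp: algebra_simps add_divide_distrib)
    qed
    show ?thesis
    proof (cases "\<bar>x\<bar> \<le> c")
      \<comment> \<open>Between the levels both fronts are convex and agree on
        \<open>hi\<close>.\<close>
      case True
      then have "V.vol (1 * x - c) = hi" "V.vol (- 1 * x - c) = hi" by (auto simp: V.vol_def)
      then have "V.front_t 1 c \<tau> x = hi\<^sup>2 * V.front2 1 c \<tau> x / 2" "V.front_t (- 1) c \<tau> x = hi\<^sup>2 * V.front2 (- 1) c \<tau> x / 2"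
        by (simp_all add: V.front_t_def)
      moreover have "Zt \<tau> x \<le> hi\<^sup>2 * Z2 \<tau> x / 2" using q by (simp add: Zt_def Z2_def algebra_simps)
      ultimately have "?Vt \<tau> x \<le> hi\<^sup>2 * ?V2 \<tau> x / 2" by (simp add: algebra_simps add_divide_distrib)
      then show ?thesis using lo_le_hi by (intro bexI[of _ hi]) auto
    next
      case False
      then have "c < 1 * x \<or> c < - 1 * x" by auto
      then have "?Vt \<tau> x \<le> l\<^sup>2 * ?V2 \<tau> x / 2" using far by blast
      then show ?thesis using l by (intro bexI[of _ l]) auto
    qed
  qed
  show ?thesis
  proof (intro exI allI impI)
    fix n :: nat assume n: "0 < n"
    have "?V (\<delta> + real n * (1 / real n)) 0 \<le> (bellman (1 / real n) ^^ n) f 0 + 4 * Phi (- \<eta> / sqrt \<delta> / hi)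
        + (V.front_bound \<delta> + V.front_bound \<delta> + q * hi\<^sup>2) * (third * hi ^ 3 + 1) * sqrt (1 / real n)"
      by (rule parabolic_lower[OF reg f init sub]) (use n in auto)
    then show "2 * V.profile (- c / sqrt (\<delta> + 1)) - (hi\<^sup>2 - l\<^sup>2) / 2 * K * hi\<^sup>2 / (2 * c\<^sup>2)
        \<le> (bellman (1 / real n) ^^ n) f 0 + 4 * Phi (- \<eta> / sqrt \<delta> / hi) + C * sqrt (1 / real n)"
      using n by (simp add: V.front_def Z_def C_def q_def k_def)
  qed
qed

text \<open>A Gaussian of variance \<open>hi\<^sup>2 * \<tau>\<close> spreads fast enough where it
  is convex; where it is concave the volatility is still at least \<open>lo\<close>, which allows
  the height to decay like \<open>\<tau> powr (- p)\<close>. For \<open>lo > 0\<close> the bound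
  vanishes with \<open>\<eta>\<close>: little mass can be concentrated near a level.\<close>

lemma bump_upper:
  assumes f: "bounded_lipschitz B L f" and le: "\<And>x. f x \<le> of_bool (\<bar>x - c\<bar> \<le> \<eta>)" and \<eta>: "0 < \<eta>"
  shows "\<exists>C. \<forall>n>0. (bellman (1 / real n) ^^ n) f 0
    \<le> exp (1 / (2 * hi\<^sup>2)) * \<eta>\<^sup>2 powr (lo\<^sup>2 / (2 * hi\<^sup>2)) + C * sqrt (1 / real n)"
proof -
  define p where "p = lo\<^sup>2 / (2 * hi\<^sup>2)"
  define \<delta> where "\<delta> = \<eta>\<^sup>2"
  have \<delta>: "0 < \<delta>" using \<eta> by (simp add: \<delta>_def)
  have lohi2: "lo\<^sup>2 \<le> hi\<^sup>2" using lo_nonneg lo_le_hi by (intro power_mono) auto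
  have "lo\<^sup>2 \<le> 2 * hi\<^sup>2" using lohi2 zero_le_power2[of hi] by linarith
  then have p: "0 \<le> p" "p \<le> 1" using hi_pos by (auto simp: p_def divide_le_eq)
  \<comment> \<open>Normalised to make the barrier at least 1 for |x - c| \<le> \<eta> at the
    initial time \<open>\<delta> = \<eta>\<^sup>2\<close>, where the exponent is at least
    \<open>- 1 / (2 * hi\<^sup>2)\<close>.\<close>
  define A where "A = exp (1 / (2 * hi\<^sup>2)) * \<delta> powr p"
  have A: "0 \<le> A" by (simp add: A_def)
  define y where "y = (\<lambda>x. (x - c) / hi)"
  define e where "e = (\<lambda>\<tau> x. exp (- (y x)\<^sup>2 / (2 * \<tau>)))"
  define V where "V = (\<lambda>\<tau> x. A * \<tau> powr (- p) * e \<tau> x)"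
  define V1 where "V1 = (\<lambda>\<tau> x. A * \<tau> powr (- p) * (- y x / (hi * \<tau>) * e \<tau> x))"
  define V2 where "V2 = (\<lambda>\<tau> x. A * \<tau> powr (- p) * (((y x)\<^sup>2 / \<tau> - 1) / (hi\<^sup>2 * \<tau>) * e \<tau> x))"
  \<comment> \<open>\<open>V3\<close> and \<open>Vtt\<close> serve to bound the Lipschitz constants
    of \<open>V2\<close> in space and of \<open>Vt\<close> in time.\<close>
  define V3 where "V3 = (\<lambda>\<tau> x. A * \<tau> powr (- p) * ((3 * y x / \<tau> - (y x) ^ 3 / \<tau>\<^sup>2) / (hi ^ 3 * \<tau>) * e \<tau> x))"
  define Vt where "Vt = (\<lambda>\<tau> x. A * \<tau> powr (- p) * (((y x)\<^sup>2 / (2 * \<tau>\<^sup>2) - p / \<tau>) * e \<tau> x))"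
  define Vtt where "Vtt = (\<lambda>\<tau> x. A * \<tau> powr (- p) *
    ((((y x)\<^sup>2 / (2 * \<tau>\<^sup>2) - p / \<tau>)\<^sup>2 + p / \<tau>\<^sup>2 - (y x)\<^sup>2 / \<tau> ^ 3) * e \<tau> x))"
  have dy: "(y has_real_derivative 1 / hi) (at x)" for x
    unfolding y_def by (rule DERIV_cdivide) (auto intro!: derivative_eq_intros)
  have de: "(e \<tau> has_real_derivative - y x / (hi * \<tau>) * e \<tau> x) (at x)" if "0 < \<tau>" for \<tau> x
    unfolding e_def using that hi_pos by (auto intro!: derivative_eq_intros dy simp: field_simps)
  have det: "((\<lambda>\<tau>. e \<tau> x) has_real_derivative (y x)\<^sup>2 / (2 * \<tau>\<^sup>2) * e \<tau> x) (at \<tau>)" if "0 < \<tau>" for \<tau> x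
    unfolding e_def using that by (auto intro!: derivative_eq_intros simp: field_simps power2_eq_square)
  have dV: "(V \<tau> has_real_derivative V1 \<tau> x) (at x)" if "0 < \<tau>" for \<tau> x
    unfolding V_def V1_def by (intro DERIV_cmult de that)
  have dV1: "(V1 \<tau> has_real_derivative V2 \<tau> x) (at x)" if "0 < \<tau>" for \<tau> x
  proof -
    have "((\<lambda>x. - y x / (hi * \<tau>) * e \<tau> x) has_real_derivative
        - (1 / hi) / (hi * \<tau>) * e \<tau> x + - y x / (hi * \<tau>) * e \<tau> x * (- y x / (hi * \<tau>))) (at x)"
      by (intro DERIV_mult DERIV_cdivide DERIV_minus dy de that)
    then have "((\<lambda>x. - y x / (hi * \<tau>) * e \<tau> x) has_real_derivative ((y x)\<^sup>2 / \<tau> - 1) / (hi\<^sup>2 * \<tau>) * e \<tau> x) (at x)"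
      by (rule DERIV_cong) (use that hi_pos in \<open>simp add: power2_eq_square divide_simps; simp add: algebra_simps\<close>)
    then show ?thesis unfolding V1_def V2_def by (rule DERIV_cmult)
  qed
  have dV2: "(V2 \<tau> has_real_derivative V3 \<tau> x) (at x)" if "0 < \<tau>" for \<tau> x
  proof -
    have "((\<lambda>x. ((y x)\<^sup>2 / \<tau> - 1) / (hi\<^sup>2 * \<tau>)) has_real_derivative (2 * y x * (1 / hi) / \<tau> - 0) / (hi\<^sup>2 * \<tau>)) (at x)"
      by (intro DERIV_cdivide DERIV_diff DERIV_const DERIV_cong[OF DERIV_power[OF dy]]) simp
    from DERIV_mult[OF this de[OF that]]
    have "((\<lambda>x. ((y x)\<^sup>2 / \<tau> - 1) / (hi\<^sup>2 * \<tau>) * e \<tau> x) has_real_derivative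
        (3 * y x / \<tau> - (y x) ^ 3 / \<tau>\<^sup>2) / (hi ^ 3 * \<tau>) * e \<tau> x) (at x)"
      by (rule DERIV_cong) (use that hi_pos in \<open>simp add: power2_eq_square power3_eq_cube divide_simps; simp add: algebra_simps\<close>)
    then show ?thesis unfolding V2_def V3_def by (rule DERIV_cmult)
  qed
  have dpow: "((\<lambda>\<tau>. A * \<tau> powr (- p)) has_real_derivative A * \<tau> powr (- p) * (- p / \<tau>)) (at \<tau>)" if "0 < \<tau>" for \<tau>
    using that by (auto intro!: derivative_eq_intros simp: powr_diff)
  have dVt: "((\<lambda>\<tau>. V \<tau> x) has_real_derivative Vt \<tau> x) (at \<tau>)" if "0 < \<tau>" for \<tau> x
    unfolding V_def Vt_def
    by (rule DERIV_cong[OF DERIV_mult[OF dpow[OF that] det[OF that]]]) (simp add: algebra_simps)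
  have dVtt: "((\<lambda>\<tau>. Vt \<tau> x) has_real_derivative Vtt \<tau> x) (at \<tau>)" if "0 < \<tau>" for \<tau> x
  proof -
    have "((\<lambda>\<tau>. (y x)\<^sup>2 / (2 * \<tau>\<^sup>2) - p / \<tau>) has_real_derivative - (y x)\<^sup>2 / \<tau> ^ 3 + p / \<tau>\<^sup>2) (at \<tau>)"
    proof (rule DERIV_cong)
      have "((\<lambda>\<tau>. 2 * \<tau>\<^sup>2) has_real_derivative 4 * \<tau>) (at \<tau>)" by (auto intro!: derivative_eq_intros)
      then show "((\<lambda>\<tau>. (y x)\<^sup>2 / (2 * \<tau>\<^sup>2) - p / \<tau>) has_real_derivative
          (0 * (2 * \<tau>\<^sup>2) - (y x)\<^sup>2 * (4 * \<tau>)) / (2 * \<tau>\<^sup>2 * (2 * \<tau>\<^sup>2)) - (0 * \<tau> - p * 1) / (\<tau> * \<tau>)) (at \<tau>)"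
        using that by (intro DERIV_diff DERIV_divide DERIV_const DERIV_ident) auto
    qed (use that in \<open>simp add: power2_eq_square power3_eq_cube\<close>)
    note DERIV_mult[OF dpow[OF that] DERIV_mult[OF this det[OF that, of x]]]
    moreover have "P * (- b) * ((a - b) * E) + ((- c + d) * E + a * E * (a - b)) * P = P * (((a - b)\<^sup>2 + d - c) * E)"
      for P a b c d E :: real by (simp add: power2_eq_square algebra_simps)
    ultimately show ?thesis unfolding Vt_def Vtt_def by (simp only: minus_divide_left[symmetric])
  qed
  have e_scale: "e \<tau> x = exp (- (y x / sqrt \<tau>)\<^sup>2 / 2)" if "0 < \<tau>" for \<tau> x
    using that by (simp add: e_def power_divide)
  have pow: "\<tau> powr (- p) \<le> \<delta> powr (- p)" if "\<delta> \<le> \<tau>" for \<tau>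
    using that \<delta> p by (intro powr_mono2') auto
  have Apow: "0 \<le> A * \<tau> powr (- p)" "A * \<tau> powr (- p) \<le> A * \<delta> powr (- p)" if "\<delta> \<le> \<tau>" for \<tau>
    using A pow[OF that] by (auto intro: mult_left_mono)
  define K3 where "K3 = A * \<delta> powr (- p) * (8 / (hi ^ 3 * \<delta> * sqrt \<delta>))"
  define Kt where "Kt = A * \<delta> powr (- p) * (8 / \<delta>\<^sup>2)"
  have b3: "\<bar>V3 \<tau> x\<bar> \<le> K3" if \<tau>: "\<delta> \<le> \<tau>" for \<tau> x
  proof -
    have \<tau>0: "0 < \<tau>" using \<tau> \<delta> by simp
    define z where "z = y x / sqrt \<tau>"
    have yz: "y x = z * sqrt \<tau>" using \<tau>0 by (simp add: z_def)
    have "(3 * y x / \<tau> - (y x) ^ 3 / \<tau>\<^sup>2) / (hi ^ 3 * \<tau>) * e \<tau> x = (3 * z - z ^ 3) * exp (- z\<^sup>2 / 2) / (hi ^ 3 * \<tau> * sqrt \<tau>)"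
    proof -
      have "3 * y x / \<tau> - (y x) ^ 3 / \<tau>\<^sup>2 = (3 * z - z ^ 3) / sqrt \<tau>"
      proof -
        have "y x / \<tau> = z / sqrt \<tau>" using \<tau>0 by (simp add: z_def)
        moreover have "(y x) ^ 3 / \<tau>\<^sup>2 = z ^ 3 / sqrt \<tau>"
          using \<tau>0 by (simp add: yz power_mult_distrib power3_eq_cube power2_eq_square field_simps)
        ultimately show ?thesis by (simp add: diff_divide_distrib)
      qed
      then show ?thesis using e_scale[OF \<tau>0] by (simp add: z_def[symmetric])
    qed
    also have "\<bar>\<dots>\<bar> \<le> 8 / (hi ^ 3 * \<tau> * sqrt \<tau>)"
    proof -
      have "\<bar>3 * z - z ^ 3\<bar> \<le> 3 * \<bar>z\<bar> + \<bar>z\<bar> ^ 3"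
        by (rule order_trans[OF abs_triangle_ineq4]) (simp add: abs_mult power_abs)
      then have "\<bar>3 * z - z ^ 3\<bar> * exp (- z\<^sup>2 / 2) \<le> (3 * \<bar>z\<bar> + \<bar>z\<bar> ^ 3) * exp (- z\<^sup>2 / 2)"
        by (intro mult_right_mono) auto
      also have "\<dots> \<le> 8" using gauss_moment_bounds(3,4)[of z] by (simp add: distrib_right)
      finally have "\<bar>(3 * z - z ^ 3) * exp (- z\<^sup>2 / 2)\<bar> \<le> 8" by (simp add: abs_mult)
      then have "\<bar>(3 * z - z ^ 3) * exp (- z\<^sup>2 / 2)\<bar> / (hi ^ 3 * \<tau> * sqrt \<tau>) \<le> 8 / (hi ^ 3 * \<tau> * sqrt \<tau>)"
        using \<tau>0 hi_pos by (intro divide_right_mono) auto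
      then show ?thesis using \<tau>0 hi_pos by (simp only: abs_divide) (simp add: abs_mult)
    qed
    also have "\<dots> \<le> 8 / (hi ^ 3 * \<delta> * sqrt \<delta>)"
      using \<tau> \<delta> hi_pos by (intro divide_left_mono mult_mono) auto
    finally have "\<bar>(3 * y x / \<tau> - (y x) ^ 3 / \<tau>\<^sup>2) / (hi ^ 3 * \<tau>) * e \<tau> x\<bar> \<le> 8 / (hi ^ 3 * \<delta> * sqrt \<delta>)" .
    then have "(A * \<tau> powr (- p)) * \<bar>(3 * y x / \<tau> - (y x) ^ 3 / \<tau>\<^sup>2) / (hi ^ 3 * \<tau>) * e \<tau> x\<bar> \<le> K3"
      unfolding K3_def by (rule mult_mono[OF Apow(2)[OF \<tau>]]) (use A in auto)
    then show ?thesis unfolding V3_def abs_mult[of "A * \<tau> powr (- p)"] abs_of_nonneg[OF Apow(1)[OF \<tau>]] .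
  qed
  have btt: "\<bar>Vtt \<tau> x\<bar> \<le> Kt" if \<tau>: "\<delta> \<le> \<tau>" for \<tau> x
  proof -
    have \<tau>0: "0 < \<tau>" using \<tau> \<delta> by simp
    define z where "z = y x / sqrt \<tau>"
    have yz: "(y x)\<^sup>2 = z\<^sup>2 * \<tau>" using \<tau>0 by (simp add: z_def power_divide)
    have "(((y x)\<^sup>2 / (2 * \<tau>\<^sup>2) - p / \<tau>)\<^sup>2 + p / \<tau>\<^sup>2 - (y x)\<^sup>2 / \<tau> ^ 3) * e \<tau> x
        = ((z\<^sup>2 / 2 - p)\<^sup>2 + p - z\<^sup>2) * exp (- z\<^sup>2 / 2) / \<tau>\<^sup>2"
    proof -
      have "(y x)\<^sup>2 / (2 * \<tau>\<^sup>2) - p / \<tau> = (z\<^sup>2 / 2 - p) / \<tau>"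
        unfolding yz using \<tau>0 by (simp add: power2_eq_square diff_divide_distrib)
      moreover have "(y x)\<^sup>2 / \<tau> ^ 3 = z\<^sup>2 / \<tau>\<^sup>2"
        unfolding yz using \<tau>0 by (simp add: power2_eq_square power3_eq_cube)
      moreover have "e \<tau> x = exp (- z\<^sup>2 / 2)" unfolding z_def by (rule e_scale[OF \<tau>0])
      ultimately have "(((y x)\<^sup>2 / (2 * \<tau>\<^sup>2) - p / \<tau>)\<^sup>2 + p / \<tau>\<^sup>2 - (y x)\<^sup>2 / \<tau> ^ 3) * e \<tau> x
          = (((z\<^sup>2 / 2 - p) / \<tau>)\<^sup>2 + p / \<tau>\<^sup>2 - z\<^sup>2 / \<tau>\<^sup>2) * exp (- z\<^sup>2 / 2)"
        by (simp only:)
      also have "((z\<^sup>2 / 2 - p) / \<tau>)\<^sup>2 + p / \<tau>\<^sup>2 - z\<^sup>2 / \<tau>\<^sup>2 = ((z\<^sup>2 / 2 - p)\<^sup>2 + p - z\<^sup>2) / \<tau>\<^sup>2"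
        unfolding power_divide add_divide_distrib[symmetric] diff_divide_distrib[symmetric] ..
      finally show ?thesis by simp
    qed
    also have "\<bar>\<dots>\<bar> \<le> 8 / \<tau>\<^sup>2"
    proof -
      have "(z\<^sup>2 / 2 - p)\<^sup>2 \<le> z ^ 4 / 4 + 1"
      proof -
        have "(z\<^sup>2 / 2 - p)\<^sup>2 = z ^ 4 / 4 - z\<^sup>2 * p + p\<^sup>2"
          by (simp add: power2_eq_square power4_eq_xxxx algebra_simps)
        moreover have "p\<^sup>2 \<le> 1" using p by (simp add: power_le_one)
        moreover have "0 \<le> z\<^sup>2 * p" using p by simp
        ultimately show ?thesis by linarith
      qed
      moreover have "0 \<le> (z\<^sup>2 / 2 - p)\<^sup>2" "0 \<le> z\<^sup>2" by simp_all
      ultimately have "\<bar>(z\<^sup>2 / 2 - p)\<^sup>2 + p - z\<^sup>2\<bar> \<le> z ^ 4 / 4 + z\<^sup>2 + 2" using p unfolding abs_le_iff by linarith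
      then have "\<bar>(z\<^sup>2 / 2 - p)\<^sup>2 + p - z\<^sup>2\<bar> * exp (- z\<^sup>2 / 2) \<le> (z ^ 4 / 4 + z\<^sup>2 + 2) * exp (- z\<^sup>2 / 2)"
        by (intro mult_right_mono) auto
      also have "\<dots> = z ^ 4 * exp (- z\<^sup>2 / 2) / 4 + z\<^sup>2 * exp (- z\<^sup>2 / 2) + 2 * exp (- z\<^sup>2 / 2)"
        by (simp add: distrib_right)
      also have "\<dots> \<le> 8 / 4 + 1 + 2 * 1"
        using gauss_moment_bounds(1,2)[of z] by (intro add_mono divide_right_mono mult_left_mono) auto
      finally have "\<bar>((z\<^sup>2 / 2 - p)\<^sup>2 + p - z\<^sup>2) * exp (- z\<^sup>2 / 2)\<bar> \<le> 8" by (simp add: abs_mult)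
      then have "\<bar>((z\<^sup>2 / 2 - p)\<^sup>2 + p - z\<^sup>2) * exp (- z\<^sup>2 / 2)\<bar> / \<tau>\<^sup>2 \<le> 8 / \<tau>\<^sup>2"
        by (rule divide_right_mono) simp
      then show ?thesis by (simp only: abs_divide) simp
    qed
    also have "\<dots> \<le> 8 / \<delta>\<^sup>2" using \<tau> \<delta> by (intro divide_left_mono power_mono) auto
    finally have "\<bar>(((y x)\<^sup>2 / (2 * \<tau>\<^sup>2) - p / \<tau>)\<^sup>2 + p / \<tau>\<^sup>2 - (y x)\<^sup>2 / \<tau> ^ 3) * e \<tau> x\<bar> \<le> 8 / \<delta>\<^sup>2" .
    then have "(A * \<tau> powr (- p)) * \<bar>(((y x)\<^sup>2 / (2 * \<tau>\<^sup>2) - p / \<tau>)\<^sup>2 + p / \<tau>\<^sup>2 - (y x)\<^sup>2 / \<tau> ^ 3) * e \<tau> x\<bar> \<le> Kt"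
      unfolding Kt_def by (rule mult_mono[OF Apow(2)[OF \<tau>]]) (use A in auto)
    then show ?thesis unfolding Vtt_def abs_mult[of "A * \<tau> powr (- p)"] abs_of_nonneg[OF Apow(1)[OF \<tau>]] .
  qed
  have K0: "0 \<le> K3" "0 \<le> Kt" using A \<delta> hi_pos by (auto simp: K3_def Kt_def)
  have reg: "parabolic_regular \<delta> (K3 + Kt) V V1 V2 Vt"
    unfolding parabolic_regular_def
  proof (intro conjI allI impI)
    fix \<tau> \<tau>' u x assume \<tau>: "\<delta> \<le> \<tau>"
    then have \<tau>0: "0 < \<tau>" using \<delta> by simp
    show "(V \<tau> has_real_derivative V1 \<tau> x) (at x)" "(V1 \<tau> has_real_derivative V2 \<tau> x) (at x)"
      "((\<lambda>\<tau>. V \<tau> x) has_real_derivative Vt \<tau> x) (at \<tau>)"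
      using dV dV1 dVt \<tau>0 by auto
    have "\<bar>V2 \<tau> x - V2 \<tau> u\<bar> \<le> K3 * \<bar>x - u\<bar>"
      by (rule lipschitz_from_derivative[where S = UNIV, OF dV2[OF \<tau>0] b3[OF \<tau>]]) auto
    also have "\<dots> \<le> (K3 + Kt) * \<bar>x - u\<bar>" using K0 by (intro mult_right_mono) auto
    finally show "\<bar>V2 \<tau> x - V2 \<tau> u\<bar> \<le> (K3 + Kt) * \<bar>x - u\<bar>" .
    assume \<tau>': "\<delta> \<le> \<tau>'"
    have "\<bar>Vt \<tau> x - Vt \<tau>' x\<bar> \<le> Kt * \<bar>\<tau> - \<tau>'\<bar>"
      by (rule lipschitz_from_derivative[where S = "{\<delta>..}" and f = "\<lambda>\<tau>. Vt \<tau> x" and f' = "\<lambda>\<tau>. Vtt \<tau> x"])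
        (use dVtt btt \<tau> \<tau>' \<delta> in auto)
    also have "\<dots> \<le> (K3 + Kt) * \<bar>\<tau> - \<tau>'\<bar>" using K0 by (intro mult_right_mono) auto
    finally show "\<bar>Vt \<tau> x - Vt \<tau>' x\<bar> \<le> (K3 + Kt) * \<bar>\<tau> - \<tau>'\<bar>" .
  qed
  have init: "f x \<le> V \<delta> x + 0" for x
  proof (cases "\<bar>x - c\<bar> \<le> \<eta>")
    case True
    have "(x - c)\<^sup>2 \<le> \<delta>" unfolding \<delta>_def using power_mono[OF True, of 2] by simp
    then have "(y x)\<^sup>2 \<le> \<delta> / hi\<^sup>2" by (simp add: y_def power_divide divide_right_mono)
    then have "(y x)\<^sup>2 / (2 * \<delta>) \<le> \<delta> / hi\<^sup>2 / (2 * \<delta>)" using \<delta> by (intro divide_right_mono) auto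
    then have "exp (- (1 / (2 * hi\<^sup>2))) \<le> e \<delta> x" using \<delta> by (simp add: e_def)
    then have "A * \<delta> powr (- p) * exp (- (1 / (2 * hi\<^sup>2))) \<le> V \<delta> x"
      unfolding V_def using A by (intro mult_left_mono) auto
    moreover have "A * \<delta> powr (- p) * exp (- (1 / (2 * hi\<^sup>2))) = 1"
    proof -
      have "A * \<delta> powr (- p) * exp (- (1 / (2 * hi\<^sup>2))) =
          (exp (1 / (2 * hi\<^sup>2)) * exp (- (1 / (2 * hi\<^sup>2)))) * (\<delta> powr p * \<delta> powr (- p))"
        by (simp add: A_def mult_ac)
      also have "\<dots> = 1" using \<delta> by (simp add: exp_add[symmetric] powr_add[symmetric])
      finally show ?thesis .
    qed
    ultimately show ?thesis using le[of x] True by simp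
  next
    case False
    then show ?thesis using le[of x] A by (simp add: V_def e_def order_trans)
  qed
  \<comment> \<open>The terms with the square of \<open>y\<close> compare by \<sigma> \<le> hi,
    those in \<open>1 / \<tau>\<close> by \<sigma> \<ge> lo; the latter comparison determines
    \<open>p\<close>.\<close>
  have super: "\<sigma>\<^sup>2 * V2 \<tau> x / 2 \<le> Vt \<tau> x + 0" if \<tau>: "\<delta> \<le> \<tau>" and \<sigma>: "\<sigma> \<in> {lo..hi}" for \<tau> x \<sigma>
  proof -
    have \<tau>0: "0 < \<tau>" using \<tau> \<delta> by simp
    have s: "\<sigma>\<^sup>2 \<le> hi\<^sup>2" "lo\<^sup>2 \<le> \<sigma>\<^sup>2" using \<sigma> lo_nonneg by (auto intro: power_mono)
    have "\<sigma>\<^sup>2 * (((y x)\<^sup>2 / \<tau> - 1) / (hi\<^sup>2 * \<tau>)) / 2 = (\<sigma>\<^sup>2 / hi\<^sup>2) * ((y x)\<^sup>2 / (2 * \<tau>\<^sup>2)) - \<sigma>\<^sup>2 / (2 * hi\<^sup>2) / \<tau>"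
      using \<tau>0 hi_pos by (simp add: power2_eq_square diff_divide_distrib right_diff_distrib mult_ac)
    also have "\<dots> \<le> (y x)\<^sup>2 / (2 * \<tau>\<^sup>2) - p / \<tau>"
    proof (rule diff_mono)
      show "(\<sigma>\<^sup>2 / hi\<^sup>2) * ((y x)\<^sup>2 / (2 * \<tau>\<^sup>2)) \<le> (y x)\<^sup>2 / (2 * \<tau>\<^sup>2)"
        using s hi_pos by (intro mult_left_le_one_le) (auto simp: divide_le_eq)
      show "p / \<tau> \<le> \<sigma>\<^sup>2 / (2 * hi\<^sup>2) / \<tau>"
        unfolding p_def using s \<tau>0 by (intro divide_right_mono) auto
    qed
    finally have "A * \<tau> powr (- p) * e \<tau> x * (\<sigma>\<^sup>2 * (((y x)\<^sup>2 / \<tau> - 1) / (hi\<^sup>2 * \<tau>)) / 2)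
        \<le> A * \<tau> powr (- p) * e \<tau> x * ((y x)\<^sup>2 / (2 * \<tau>\<^sup>2) - p / \<tau>)"
      using Apow(1)[OF \<tau>] by (intro mult_left_mono) (auto simp: e_def)
    then show ?thesis by (simp add: V2_def Vt_def mult_ac)
  qed
  have V0: "V (\<delta> + 1) 0 \<le> A"
  proof -
    have "(\<delta> + 1) powr (- p) \<le> 1" using \<delta> p by (simp add: powr_minus_divide ge_one_powr_ge_zero)
    moreover have "e (\<delta> + 1) 0 \<le> 1" using \<delta> by (simp add: e_def)
    ultimately have "(\<delta> + 1) powr (- p) * e (\<delta> + 1) 0 \<le> 1" by (intro mult_le_one) (auto simp: e_def)
    then have "A * ((\<delta> + 1) powr (- p) * e (\<delta> + 1) 0) \<le> A * 1" using A by (rule mult_left_mono)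
    then show ?thesis by (simp add: V_def mult.assoc)
  qed
  show ?thesis
  proof (intro exI allI impI)
    fix n :: nat assume n: "0 < n"
    have "(bellman (1 / real n) ^^ n) f 0 \<le> V (\<delta> + real n * (1 / real n)) 0 + 0 + 0
        + (K3 + Kt) * (third * hi ^ 3 + 1) * sqrt (1 / real n)"
      by (rule parabolic_upper[OF reg f init super]) (use n in auto)
    then show "(bellman (1 / real n) ^^ n) f 0 \<le> exp (1 / (2 * hi\<^sup>2)) * \<eta>\<^sup>2 powr (lo\<^sup>2 / (2 * hi\<^sup>2))
        + (K3 + Kt) * (third * hi ^ 3 + 1) * sqrt (1 / real n)"
      using V0 n by (simp add: A_def \<delta>_def p_def)
  qed
qed

end

subsection \<open>Limits of the tail probabilities\<close>

lemma sqrt_inverse_tendsto_0: "(\<lambda>n. C * sqrt (1 / real n)) \<longlonglongrightarrow> 0"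
  using tendsto_mult_left[OF tendsto_real_sqrt[OF lim_1_over_n], of C] by simp

text \<open>The constant \<open>C\<close> may depend on \<open>\<delta>\<close>, so n tends to
  infinity first and \<open>\<delta>\<close> to 0 afterwards.\<close>

lemma LIMSEQ_ge_param:
  fixes a :: "nat \<Rightarrow> real" and low :: "real \<Rightarrow> real"
  assumes a: "a \<longlonglongrightarrow> A"
    and lower: "\<forall>\<^sub>F \<delta> in at_right 0. \<exists>C. \<forall>n>0. low \<delta> \<le> a n + C * sqrt (1 / real n)"
    and low: "(low \<longlongrightarrow> p) (at_right 0)"
  shows "p \<le> A"
proof (rule tendsto_upperbound[OF low])
  show "\<forall>\<^sub>F \<delta> in at_right 0. low \<delta> \<le> A"
    using lower
  proof eventually_elim
    case (elim \<delta>)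
    then obtain C where C: "\<And>n. 0 < n \<Longrightarrow> low \<delta> \<le> a n + C * sqrt (1 / real n)" by blast
    have "(\<lambda>n. a n + C * sqrt (1 / real n)) \<longlonglongrightarrow> A + 0"
      by (intro tendsto_add a sqrt_inverse_tendsto_0)
    moreover have "\<forall>\<^sub>F n in sequentially. low \<delta> \<le> a n + C * sqrt (1 / real n)"
      using eventually_gt_at_top[of 0] by eventually_elim (rule C)
    ultimately have "low \<delta> \<le> A + 0" by (rule tendsto_lowerbound) simp
    then show ?case by simp
  qed
qed simp

lemma LIMSEQ_le_param:
  fixes a :: "nat \<Rightarrow> real" and up :: "real \<Rightarrow> real"
  assumes a: "a \<longlonglongrightarrow> A"
    and upper: "\<forall>\<^sub>F \<delta> in at_right 0. \<exists>C. \<forall>n>0. a n \<le> up \<delta> + C * sqrt (1 / real n)"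
    and up: "(up \<longlongrightarrow> p) (at_right 0)"
  shows "A \<le> p"
proof -
  have "\<forall>\<^sub>F \<delta> in at_right 0. \<exists>C. \<forall>n>0. - up \<delta> \<le> - a n + C * sqrt (1 / real n)"
    using upper
  proof eventually_elim
    case (elim \<delta>)
    then obtain C where C: "\<And>n. 0 < n \<Longrightarrow> a n \<le> up \<delta> + C * sqrt (1 / real n)" by blast
    have "- up \<delta> \<le> - a n + C * sqrt (1 / real n)" if "0 < n" for n using C[OF that] by simp
    then show ?case by blast
  qed
  then have "- p \<le> - A" by (rule LIMSEQ_ge_param[OF tendsto_minus[OF a] _ tendsto_minus[OF up]])
  then show ?thesis by simp
qed

text \<open>In contrast to the two lemmas above, convergence is concluded and not assumed; the
  common limit \<open>p\<close> of both bounds makes this possible.\<close>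

lemma LIMSEQ_squeeze_param:
  fixes a :: "nat \<Rightarrow> real" and low up :: "real \<Rightarrow> real"
  assumes upper: "\<forall>\<^sub>F \<delta> in at_right 0. \<exists>C. \<forall>n>0. a n \<le> up \<delta> + C * sqrt (1 / real n)"
    and lower: "\<forall>\<^sub>F \<delta> in at_right 0. \<exists>C. \<forall>n>0. low \<delta> \<le> a n + C * sqrt (1 / real n)"
    and up: "(up \<longlongrightarrow> p) (at_right 0)" and low: "(low \<longlongrightarrow> p) (at_right 0)"
  shows "a \<longlonglongrightarrow> p"
proof (rule LIMSEQ_I)
  fix e :: real assume e: "0 < e"
  have "\<forall>\<^sub>F \<delta> in at_right 0. up \<delta> < p + e / 2" "\<forall>\<^sub>F \<delta> in at_right 0. p - e / 2 < low \<delta>"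
    using order_tendstoD(2)[OF up, of "p + e / 2"] order_tendstoD(1)[OF low, of "p - e / 2"] e by auto
  with upper lower have "\<forall>\<^sub>F \<delta> in at_right (0::real). \<exists>C D. \<forall>n>0. a n \<le> p + e / 2 + C * sqrt (1 / real n)
      \<and> p - e / 2 \<le> a n + D * sqrt (1 / real n)"
  proof eventually_elim
    case (elim \<delta>)
    obtain C where C: "\<And>n. 0 < n \<Longrightarrow> a n \<le> up \<delta> + C * sqrt (1 / real n)" using elim(1) by blast
    obtain D where D: "\<And>n. 0 < n \<Longrightarrow> low \<delta> \<le> a n + D * sqrt (1 / real n)" using elim(2) by blast
    have "a n \<le> p + e / 2 + C * sqrt (1 / real n) \<and> p - e / 2 \<le> a n + D * sqrt (1 / real n)" if "0 < n" for n
      using C[OF that] D[OF that] elim(3,4) by linarith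
    then show ?case by blast
  qed
  then have "\<exists>C D. \<forall>n>0. a n \<le> p + e / 2 + C * sqrt (1 / real n) \<and> p - e / 2 \<le> a n + D * sqrt (1 / real n)"
    using eventually_happens[of _ "at_right (0::real)"] by (simp add: trivial_limit_at_right_real)
  then obtain C D where CD: "\<And>n. 0 < n \<Longrightarrow> a n \<le> p + e / 2 + C * sqrt (1 / real n)"
    "\<And>n. 0 < n \<Longrightarrow> p - e / 2 \<le> a n + D * sqrt (1 / real n)" by blast
  have "\<forall>\<^sub>F n in sequentially. C * sqrt (1 / real n) < e / 2" "\<forall>\<^sub>F n in sequentially. D * sqrt (1 / real n) < e / 2"
    using order_tendstoD(2)[OF sqrt_inverse_tendsto_0[of C], of "e / 2"]
      order_tendstoD(2)[OF sqrt_inverse_tendsto_0[of D], of "e / 2"] e by simp_all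
  then have "\<forall>\<^sub>F n in sequentially. norm (a n - p) < e"
    using eventually_gt_at_top[of 0]
  proof eventually_elim
    case (elim n)
    show ?case using CD[OF elim(3)] elim(1,2) unfolding real_norm_def by linarith
  qed
  then show "\<exists>no. \<forall>n\<ge>no. norm (a n - p) < e" by (simp add: eventually_sequentially)
qed

text \<open>The Cauchy criterion needs no candidate for the limit. This suits the two-sided tail,
  which is enclosed by convergent sequences for Lipschitz data but has no closed form.\<close>

lemma convergent_sandwich:
  fixes a :: "nat \<Rightarrow> real"
  assumes "\<And>e. 0 < e \<Longrightarrow> \<exists>b. convergent b \<and> (\<forall>\<^sub>F n in sequentially. b n \<le> a n \<and> a n \<le> b n + e)"
  shows "convergent a"
proof -
  have "Cauchy a"
  proof (rule metric_CauchyI)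
    fix e :: real assume e: "0 < e"
    obtain b where b: "convergent b" "\<forall>\<^sub>F n in sequentially. b n \<le> a n \<and> a n \<le> b n + e / 4"
      using assms[of "e / 4"] e by auto
    obtain l where l: "b \<longlonglongrightarrow> l" using b(1) by (auto simp: convergent_def)
    have "\<forall>\<^sub>F n in sequentially. dist (b n) l < e / 4" using tendstoD[OF l, of "e / 4"] e by simp
    with b(2) have "\<forall>\<^sub>F n in sequentially. dist (a n) l < e / 2"
    proof eventually_elim
      case (elim n)
      then show ?case unfolding dist_real_def by linarith
    qed
    then obtain N where "\<And>n. N \<le> n \<Longrightarrow> dist (a n) l < e / 2" by (auto simp: eventually_sequentially)
    then show "\<exists>N. \<forall>m\<ge>N. \<forall>n\<ge>N. dist (a m) (a n) < e"
      by (intro exI[of _ N]) (blast intro: dist_triangle_half_l)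
  qed
  then show ?thesis by (simp add: Cauchy_convergent_iff)
qed

context iid_noise
begin

text \<open>The fourth root of \<open>\<delta>\<close> tends to 0, yet is large compared with
  \<open>sqrt \<delta>\<close>, the width scale of the fronts at the initial time.\<close>

definition margin :: "real \<Rightarrow> real" where "margin \<delta> = sqrt (sqrt \<delta>)"

text \<open>The inner volatility of the fronts must be positive, so for \<open>lo = 0\<close> it is sent to \<open>0\<close> with \<open>\<delta>\<close>.\<close>
definition inner :: "real \<Rightarrow> real" where "inner \<delta> = (if lo = 0 then \<delta>\<^sup>2 else lo)"

lemma inner_bounds: "\<forall>\<^sub>F \<delta> in at_right 0. 0 < inner \<delta> \<and> lo \<le> inner \<delta> \<and> inner \<delta> \<le> hi"
proof -
  have "\<forall>\<^sub>F \<delta> in at_right (0::real). \<delta>\<^sup>2 < hi"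
    using range by (intro order_tendstoD(2)[of _ 0]) (auto intro!: tendsto_eq_intros)
  with eventually_at_right_less[of 0] show ?thesis
    by eventually_elim (use range in \<open>auto simp: inner_def\<close>)
qed

lemma inner_tendsto: "(inner \<longlongrightarrow> lo) (at_right 0)"
  unfolding inner_def[abs_def] by (cases "lo = 0") (auto intro!: tendsto_eq_intros)

lemma margin_tendsto: "(margin \<longlongrightarrow> 0) (at_right 0)"
  unfolding margin_def[abs_def] by real_asymp

lemma margin_ratio: "filterlim (\<lambda>\<delta>. margin \<delta> / sqrt \<delta> / hi) at_top (at_right 0)"
  unfolding margin_def using range(3) by real_asymp

lemma margin_Phi: "((\<lambda>\<delta>. Phi (- margin \<delta> / sqrt \<delta> / hi)) \<longlongrightarrow> 0) (at_right 0)"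
  "((\<lambda>\<delta>. 1 - Phi (margin \<delta> / sqrt \<delta> / hi)) \<longlongrightarrow> 0) (at_right 0)"
proof -
  have "filterlim (\<lambda>\<delta>. - (margin \<delta> / sqrt \<delta> / hi)) at_bot (at_right 0)"
    using margin_ratio by (simp add: filterlim_uminus_at_bot)
  from filterlim_compose[OF Phi_at_bot this]
  show "((\<lambda>\<delta>. Phi (- margin \<delta> / sqrt \<delta> / hi)) \<longlongrightarrow> 0) (at_right 0)" by simp
  have "((\<lambda>\<delta>. 1 - Phi (margin \<delta> / sqrt \<delta> / hi)) \<longlongrightarrow> 1 - 1) (at_right 0)"
    by (intro tendsto_diff tendsto_const filterlim_compose[OF Phi_at_top margin_ratio])
  then show "((\<lambda>\<delta>. 1 - Phi (margin \<delta> / sqrt \<delta> / hi)) \<longlongrightarrow> 0) (at_right 0)" by simp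
qed

text \<open>The front with centre c \<ge> 0 and inner volatility \<open>lo\<close>, read at time 1
  and x = 0. For \<open>lo = 0\<close> the formula gives twice a Gaussian tail, as in the reflection
  principle.\<close>

definition tail1 :: "real \<Rightarrow> real" where "tail1 c = 2 * hi / (hi + lo) * Phi (- c / hi)"

lemma front_value_tendsto:
  "((\<lambda>\<delta>. 2 * hi / (hi + inner \<delta>) * Phi (- (c + k * margin \<delta>) / sqrt (\<delta> + 1) / hi)) \<longlongrightarrow> tail1 c) (at_right 0)"
proof -
  have "((\<lambda>\<delta>. - (c + k * margin \<delta>) / sqrt (\<delta> + 1) / hi) \<longlongrightarrow> - (c + k * 0) / sqrt (0 + 1) / hi) (at_right 0)"
    using range by (intro tendsto_intros margin_tendsto) auto
  then have "((\<lambda>\<delta>. Phi (- (c + k * margin \<delta>) / sqrt (\<delta> + 1) / hi)) \<longlongrightarrow> Phi (- c / hi)) (at_right 0)"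
    by (intro isCont_tendsto_compose[OF isCont_Phi]) simp
  then show ?thesis unfolding tail1_def
    using range by (intro tendsto_intros inner_tendsto) auto
qed

text \<open>\<open>front_upper\<close> with centre \<open>c - 2 * margin \<delta>\<close>: the ramp
  starts one margin before \<open>c\<close>, and the front needs another margin to have risen
  there.\<close>

definition upper1 :: "real \<Rightarrow> real \<Rightarrow> real" where
  "upper1 c \<delta> = 2 * hi / (hi + inner \<delta>) * Phi (- (c + - 2 * margin \<delta>) / sqrt (\<delta> + 1) / hi)
    + (1 - Phi (margin \<delta> / sqrt \<delta> / hi)) + ((inner \<delta>)\<^sup>2 - lo\<^sup>2) / (inner \<delta> * \<delta> * hi)"

lemma upper1_tendsto: "(upper1 c \<longlongrightarrow> tail1 c) (at_right 0)"
proof -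
  \<comment> \<open>For \<open>lo = 0\<close> the quotient is \<open>\<delta> / hi\<close>. This is
    why \<open>inner\<close> is the square of \<open>\<delta>\<close>: with \<open>\<delta>\<close>
    itself the quotient would be \<open>1 / hi\<close>.\<close>
  have "((\<lambda>\<delta>. ((inner \<delta>)\<^sup>2 - lo\<^sup>2) / (inner \<delta> * \<delta> * hi)) \<longlongrightarrow> 0) (at_right 0)"
  proof (cases "lo = 0")
    case True
    have "((\<lambda>\<delta>. ((\<delta>\<^sup>2)\<^sup>2 - 0\<^sup>2) / (\<delta>\<^sup>2 * \<delta> * hi)) \<longlongrightarrow> 0) (at_right 0)" using range(3) by real_asymp
    moreover have "inner = (\<lambda>\<delta>. \<delta>\<^sup>2)" unfolding inner_def using True by simp
    ultimately show ?thesis by (simp only: True)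
  qed (simp add: inner_def)
  from tendsto_add[OF tendsto_add[OF front_value_tendsto[of c "- 2"] margin_Phi(2)] this]
  show ?thesis unfolding upper1_def[abs_def] by (simp only: add_0_right)
qed

lemma abs_scale_diff:
  fixes s x y :: real assumes "s\<^sup>2 = 1" shows "\<bar>s * x - s * y\<bar> \<le> \<bar>x - y\<bar>"
proof -
  have "\<bar>s\<bar> = 1" using assms by (simp add: abs_square_eq_1)
  then show ?thesis by (simp add: right_diff_distrib[symmetric] abs_mult)
qed

lemma ramp_upper:
  assumes s: "s\<^sup>2 = 1"
  shows "\<forall>\<^sub>F \<delta> in at_right 0. \<exists>C. \<forall>n>0.
    (W.bellman (1 / real n) ^^ n) (\<lambda>x. ramp (c - margin \<delta>) c (s * x)) 0 \<le> upper1 c \<delta> + C * sqrt (1 / real n)"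
  using inner_bounds eventually_at_right_less[of 0]
proof eventually_elim
  case (elim \<delta>)
  define l where "l = inner \<delta>"
  define \<eta> where "\<eta> = margin \<delta>"
  have l: "0 < l" "lo \<le> l" "l \<le> hi" using elim by (auto simp: l_def)
  interpret V: volatility_pair hi l using l by unfold_locales auto
  have \<eta>: "0 < \<eta>" using elim by (simp add: \<eta>_def margin_def)
  define f where "f = (\<lambda>x. ramp (c - \<eta>) c (s * x))"
  have f: "bounded_lipschitz 1 (1 / (c - (c - \<eta>))) f"
    unfolding f_def using \<eta> by (intro bounded_lipschitz_ramp abs_scale_diff s) auto
  have le: "f x \<le> of_bool (c - 2 * \<eta> + \<eta> < s * x)" for x
    using ramp_bounds[of "c - \<eta>" c "s * x"] ramp_eq_0[of "c - \<eta>" c "s * x"] \<eta> by (auto simp: f_def not_less)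
  define C where "C = V.front_bound \<delta> * (W.third * hi ^ 3 + 1)"
  show ?case
  proof (intro exI allI impI)
    fix n :: nat assume n: "0 < n"
    have "(W.bellman (1 / real n) ^^ n) f 0 \<le> V.profile ((s * 0 - (c - 2 * \<eta>)) / sqrt (\<delta> + real n * (1 / real n)))
        + (1 - Phi (\<eta> / sqrt \<delta> / hi)) + (l\<^sup>2 - lo\<^sup>2) / (l * \<delta> * hi) + C * sqrt (1 / real n)"
      unfolding C_def by (rule W.front_upper[OF f le l _ _ s]) (use elim \<eta> n in auto)
    also have "V.profile ((s * 0 - (c - 2 * \<eta>)) / sqrt (\<delta> + real n * (1 / real n)))
        \<le> 2 * hi / (hi + l) * Phi ((s * 0 - (c - 2 * \<eta>)) / sqrt (\<delta> + real n * (1 / real n)) / hi)"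
      by (rule V.profile_le_Phi)
    finally show "(W.bellman (1 / real n) ^^ n) (\<lambda>x. ramp (c - margin \<delta>) c (s * x)) 0 \<le> upper1 c \<delta> + C * sqrt (1 / real n)"
      using n by (simp add: upper1_def f_def l_def \<eta>_def)
  qed
qed

lemma borel_gt: "{x::real. c < x} \<in> sets borel" "{x::real. c < \<bar>x\<bar>} \<in> sets borel"
  by measurable

theorem one_sided_limit:
  assumes c: "0 \<le> c" shows "one_sided_sup M \<epsilon> lo hi c \<longlonglongrightarrow> tail1 c"
proof (rule LIMSEQ_squeeze_param)
  show "(upper1 c \<longlongrightarrow> tail1 c) (at_right 0)" by (rule upper1_tendsto)
  define low where "low = (\<lambda>\<delta>. 2 * hi / (hi + inner \<delta>) * Phi (- (c + 2 * margin \<delta>) / sqrt (\<delta> + 1) / hi)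
      - 2 * Phi (- margin \<delta> / sqrt \<delta> / hi))"
  show "(low \<longlongrightarrow> tail1 c) (at_right 0)"
    unfolding low_def using tendsto_diff[OF front_value_tendsto[of c 2] tendsto_mult_left[OF margin_Phi(1), of 2]]
    by (simp only: mult_zero_right diff_zero)
  show "\<forall>\<^sub>F \<delta> in at_right 0. \<exists>C. \<forall>n>0. one_sided_sup M \<epsilon> lo hi c n \<le> upper1 c \<delta> + C * sqrt (1 / real n)"
    using ramp_upper[of 1 c, OF power_one] eventually_at_right_less[of 0]
  proof eventually_elim
    case (elim \<delta>)
    then obtain C where C: "\<And>n. 0 < n \<Longrightarrow> (W.bellman (1 / real n) ^^ n) (\<lambda>x. ramp (c - margin \<delta>) c (1 * x)) 0
        \<le> upper1 c \<delta> + C * sqrt (1 / real n)" by blast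
    have m: "0 < margin \<delta>" using elim(2) by (simp add: margin_def)
    have "sup_prob (\<lambda>x. c < x) n \<le> (W.bellman (1 / real n) ^^ n) (\<lambda>x. ramp (c - margin \<delta>) c (1 * x)) 0" for n
    proof (rule sup_prob_le_bellman[OF bounded_lipschitz_ramp borel_gt(1)])
      show "of_bool (c < x) \<le> ramp (c - margin \<delta>) c (1 * x)" for x
        using m ramp_eq_1[of "c - margin \<delta>" c x] ramp_bounds by auto
    qed (use m in auto)
    then have "\<forall>n>0. one_sided_sup M \<epsilon> lo hi c n \<le> upper1 c \<delta> + C * sqrt (1 / real n)"
      using C order_trans unfolding one_sided_sup_eq by blast
    then show ?case ..
  qed
  show "\<forall>\<^sub>F \<delta> in at_right 0. \<exists>C. \<forall>n>0. low \<delta> \<le> one_sided_sup M \<epsilon> lo hi c n + C * sqrt (1 / real n)"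
    using inner_bounds eventually_at_right_less[of 0]
  proof eventually_elim
    case (elim \<delta>)
    define l where "l = inner \<delta>"
    define \<eta> where "\<eta> = margin \<delta>"
    have l: "0 < l" "lo \<le> l" "l \<le> hi" using elim by (auto simp: l_def)
    interpret V: volatility_pair hi l using l by unfold_locales auto
    have \<eta>: "0 < \<eta>" using elim by (simp add: \<eta>_def margin_def)
    define f where "f = (\<lambda>x. ramp c (c + \<eta>) x)"
    have f: "bounded_lipschitz 1 (1 / (c + \<eta> - c)) f"
      unfolding f_def using \<eta> by (intro bounded_lipschitz_ramp) auto
    have ge: "of_bool (c + 2 * \<eta> - \<eta> \<le> 1 * x) \<le> f x" for x
      using ramp_eq_1[of c "c + \<eta>" x] ramp_bounds \<eta> by (auto simp: f_def)
    have f_le: "f x \<le> of_bool (c < x)" for x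
      using ramp_bounds[of c "c + \<eta>" x] ramp_eq_0[of c "c + \<eta>" x] \<eta> by (auto simp: f_def not_less)
    define C where "C = V.front_bound \<delta> * (W.third * hi ^ 3 + 1)"
    show ?case
    proof (intro exI allI impI)
      fix n :: nat assume n: "0 < n"
      have "V.profile ((1 * 0 - (c + 2 * \<eta>)) / sqrt (\<delta> + real n * (1 / real n))) \<le> (W.bellman (1 / real n) ^^ n) f 0
          + 2 * Phi (- \<eta> / sqrt \<delta> / hi) + C * sqrt (1 / real n)"
        unfolding C_def by (rule W.front_lower[OF f ge l]) (use elim n in auto)
      moreover have "V.profile (- (c + 2 * \<eta>) / sqrt (\<delta> + 1)) = 2 * hi / (hi + l) * Phi (- (c + 2 * \<eta>) / sqrt (\<delta> + 1) / hi)"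
      proof -
        \<comment> \<open>With c \<ge> 0 the origin lies on the convex branch of the profile, the
          one that carries the formula of \<open>tail1\<close>.\<close>
        have "- (c + 2 * \<eta>) / sqrt (\<delta> + 1) \<le> 0" using c \<eta> elim by (intro divide_nonpos_nonneg) auto
        then show ?thesis by (simp add: V.profile_def)
      qed
      moreover have "(W.bellman (1 / real n) ^^ n) f 0 \<le> one_sided_sup M \<epsilon> lo hi c n"
        unfolding one_sided_sup_eq by (rule bellman_le_sup_prob[OF f borel_gt(1) f_le])
      ultimately show "low \<delta> \<le> one_sided_sup M \<epsilon> lo hi c n + C * sqrt (1 / real n)"
        using n by (simp add: low_def l_def \<eta>_def)
    qed
  qed
qed

lemma bounded_lipschitz_ramp_abs:
  "a < b \<Longrightarrow> bounded_lipschitz 1 (1 / (b - a)) (\<lambda>x. ramp a b \<bar>x\<bar>)"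
  by (rule bounded_lipschitz_ramp) auto

lemma two_sided_le_ramp:
  assumes "a < c" shows "two_sided_sup M \<epsilon> lo hi c n \<le> (W.bellman (1 / real n) ^^ n) (\<lambda>x. ramp a c \<bar>x\<bar>) 0"
  unfolding two_sided_sup_eq
proof (rule sup_prob_le_bellman[OF bounded_lipschitz_ramp_abs[OF assms] borel_gt(2)])
  show "of_bool (c < \<bar>x\<bar>) \<le> ramp a c \<bar>x\<bar>" for x
    using ramp_eq_1[OF assms, of "\<bar>x\<bar>"] ramp_bounds[of a c "\<bar>x\<bar>"] by auto
qed

lemma ramp_le_two_sided:
  assumes "c < b" shows "(W.bellman (1 / real n) ^^ n) (\<lambda>x. ramp c b \<bar>x\<bar>) 0 \<le> two_sided_sup M \<epsilon> lo hi c n"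
  unfolding two_sided_sup_eq
proof (rule bellman_le_sup_prob[OF bounded_lipschitz_ramp_abs[OF assms] borel_gt(2)])
  show "ramp c b \<bar>x\<bar> \<le> of_bool (c < \<bar>x\<bar>)" for x
    using ramp_eq_0[OF assms, of "\<bar>x\<bar>"] ramp_bounds[of c b "\<bar>x\<bar>"] by (auto simp: not_less)
qed

text \<open>Subadditivity: the ramp in |x| is at most the sum of the ramps in x and - x, each
  governed by a front.\<close>

lemma two_sided_le_twice:
  "\<forall>\<^sub>F \<delta> in at_right 0. \<exists>C. \<forall>n>0. two_sided_sup M \<epsilon> lo hi c n \<le> 2 * upper1 c \<delta> + C * sqrt (1 / real n)"
proof -
  have minus1: "(- 1 :: real)\<^sup>2 = 1" by simp
  show ?thesis
    using ramp_upper[of 1 c, OF power_one] ramp_upper[of "- 1" c, OF minus1] eventually_at_right_less[of 0]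
  proof eventually_elim
    case (elim \<delta>)
    let ?f = "\<lambda>s x. ramp (c - margin \<delta>) c (s * x)"
    obtain C D where CD: "\<And>n. 0 < n \<Longrightarrow> (W.bellman (1 / real n) ^^ n) (?f 1) 0 \<le> upper1 c \<delta> + C * sqrt (1 / real n)"
      "\<And>n. 0 < n \<Longrightarrow> (W.bellman (1 / real n) ^^ n) (?f (- 1)) 0 \<le> upper1 c \<delta> + D * sqrt (1 / real n)"
      using elim(1,2) by blast
    have m: "c - margin \<delta> < c" using elim by (simp add: margin_def)
    have f: "bounded_lipschitz 1 (1 / (c - (c - margin \<delta>))) (?f s)" if "s\<^sup>2 = 1" for s
      by (rule bounded_lipschitz_ramp[OF m abs_scale_diff[OF that]])
    show ?case
    proof (intro exI allI impI)
      fix n :: nat assume n: "0 < n"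
      have "(W.bellman (1 / real n) ^^ n) (\<lambda>x. ramp (c - margin \<delta>) c \<bar>x\<bar>) 0
          \<le> (W.bellman (1 / real n) ^^ n) (\<lambda>x. ?f 1 x + ?f (- 1) x) 0"
      proof (rule W.bellman_iter_mono[OF bounded_lipschitz_ramp_abs[OF m] bounded_lipschitz_add[OF f f]])
        show "ramp (c - margin \<delta>) c \<bar>x\<bar> \<le> ?f 1 x + ?f (- 1) x" for x
          using ramp_bounds[of "c - margin \<delta>" c x] ramp_bounds[of "c - margin \<delta>" c "- x"]
          by (cases "0 \<le> x") auto
      qed auto
      also have "\<dots> \<le> (W.bellman (1 / real n) ^^ n) (?f 1) 0 + (W.bellman (1 / real n) ^^ n) (?f (- 1)) 0"
        by (rule W.bellman_iter_add[OF f f]) auto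
      finally show "two_sided_sup M \<epsilon> lo hi c n \<le> 2 * upper1 c \<delta> + (C + D) * sqrt (1 / real n)"
        using two_sided_le_ramp[OF m, of n] CD[OF n] by (simp add: algebra_simps)
    qed
  qed
qed

text \<open>The loss in \<open>two_fronts_lower\<close> in the limit \<open>\<delta>\<close> to 0,
  with \<open>l\<close> replaced by \<open>lo\<close> and \<open>w\<close> by
  \<open>2 * c / hi\<close>.\<close>

definition defect :: "real \<Rightarrow> real" where
  "defect c = (hi\<^sup>2 - lo\<^sup>2) / 2 * (2 / (hi + lo) * hi / (4 * c\<^sup>2) * ((2 * c / hi) ^ 3 * std_normal_density (2 * c / hi)))
    * hi\<^sup>2 / (2 * c\<^sup>2)"

text \<open>The fronts sit at \<open>c + 2 * margin \<delta>\<close>, and the corrector loss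
  survives the limit as \<open>defect c\<close>. The limit \<open>A\<close> is assumed here; its
  existence is shown below by different means.\<close>

lemma two_sided_bounds:
  assumes lim: "two_sided_sup M \<epsilon> lo hi c \<longlonglongrightarrow> A" and c: "2 * hi \<le> c"
  shows "A \<le> 2 * tail1 c" and "2 * tail1 c - defect c \<le> A"
proof -
  show "A \<le> 2 * tail1 c"
    by (rule LIMSEQ_le_param[OF lim two_sided_le_twice]) (intro tendsto_mult tendsto_const upper1_tendsto)
  have c0: "0 < c" using c range by simp
  define d where "d = (\<lambda>\<delta>. c + 2 * margin \<delta>)"
  define w where "w = (\<lambda>\<delta>. 2 * d \<delta> / (hi * sqrt (\<delta> + 1)))"
  define low where "low = (\<lambda>\<delta>. 2 * (2 * hi / (hi + inner \<delta>) * Phi (- (c + 2 * margin \<delta>) / sqrt (\<delta> + 1) / hi))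
      - (hi\<^sup>2 - (inner \<delta>)\<^sup>2) / 2 * (2 / (hi + inner \<delta>) * hi / (4 * (d \<delta>)\<^sup>2) * ((w \<delta>) ^ 3 * std_normal_density (w \<delta>)))
        * hi\<^sup>2 / (2 * (d \<delta>)\<^sup>2)
      - 4 * Phi (- margin \<delta> / sqrt \<delta> / hi))"
  have d: "(d \<longlongrightarrow> c) (at_right 0)"
    using tendsto_add[OF tendsto_const tendsto_mult_left[OF margin_tendsto, of 2], of c] by (simp add: d_def)
  have w: "(w \<longlongrightarrow> 2 * c / (hi * sqrt (0 + 1))) (at_right 0)"
    unfolding w_def using range by (intro tendsto_intros d) auto
  have nw: "((\<lambda>\<delta>. std_normal_density (w \<delta>)) \<longlongrightarrow> std_normal_density (2 * c / (hi * sqrt (0 + 1)))) (at_right 0)"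
    using w DERIV_isCont[OF DERIV_std_normal_density] by (rule isCont_tendsto_compose[rotated])
  have "(low \<longlongrightarrow> 2 * tail1 c - (hi\<^sup>2 - lo\<^sup>2) / 2 * (2 / (hi + lo) * hi / (4 * c\<^sup>2) *
      ((2 * c / (hi * sqrt (0 + 1))) ^ 3 * std_normal_density (2 * c / (hi * sqrt (0 + 1))))) * hi\<^sup>2 / (2 * c\<^sup>2) - 4 * 0) (at_right 0)"
    unfolding low_def using c0 range
    by (intro tendsto_intros front_value_tendsto inner_tendsto d w nw margin_Phi) auto
  then have low: "(low \<longlongrightarrow> 2 * tail1 c - defect c) (at_right 0)" by (simp add: defect_def)
  show "2 * tail1 c - defect c \<le> A"
  proof (rule LIMSEQ_ge_param[OF lim _ low])
    have "\<forall>\<^sub>F \<delta> in at_right 0. margin \<delta> < c" using order_tendstoD(2)[OF margin_tendsto c0] .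
    moreover have "\<forall>\<^sub>F \<delta> in at_right (0::real). \<delta> < 1"
      by (intro order_tendstoD(2)[of _ 0]) (auto intro!: tendsto_eq_intros)
    ultimately show "\<forall>\<^sub>F \<delta> in at_right 0. \<exists>C. \<forall>n>0. low \<delta> \<le> two_sided_sup M \<epsilon> lo hi c n + C * sqrt (1 / real n)"
      using inner_bounds eventually_at_right_less[of 0]
    proof eventually_elim
      case (elim \<delta>)
      define l where "l = inner \<delta>"
      define \<eta> where "\<eta> = margin \<delta>"
      have l: "0 < l" "lo \<le> l" "l \<le> hi" using elim by (auto simp: l_def)
      interpret V: volatility_pair hi l using l by unfold_locales auto
      have \<eta>: "0 < \<eta>" using elim by (simp add: \<eta>_def margin_def)
      have d': "d \<delta> = c + 2 * \<eta>" by (simp add: d_def \<eta>_def)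
      define f where "f = (\<lambda>x. ramp c (c + \<eta>) \<bar>x\<bar>)"
      have f: "bounded_lipschitz 1 (1 / (c + \<eta> - c)) f"
        unfolding f_def using \<eta> by (intro bounded_lipschitz_ramp_abs) auto
      have ge: "of_bool (d \<delta> - \<eta> \<le> \<bar>x\<bar>) \<le> f x" for x
        using ramp_eq_1[of c "c + \<eta>" "\<bar>x\<bar>"] ramp_bounds \<eta> by (auto simp: f_def d')
      have "\<exists>C. \<forall>n>0. 2 * V.profile (- d \<delta> / sqrt (\<delta> + 1)) - (hi\<^sup>2 - l\<^sup>2) / 2 *
          (2 / (hi + l) * hi / (4 * (d \<delta>)\<^sup>2) * ((w \<delta>) ^ 3 * std_normal_density (w \<delta>))) * hi\<^sup>2 / (2 * (d \<delta>)\<^sup>2)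
          \<le> (W.bellman (1 / real n) ^^ n) f 0 + 4 * Phi (- \<eta> / sqrt \<delta> / hi) + C * sqrt (1 / real n)"
        unfolding w_def by (rule W.two_fronts_lower[OF f ge l]) (use elim \<eta> c c0 in \<open>auto simp: d'\<close>)
      then obtain C where C: "\<And>n. 0 < n \<Longrightarrow> 2 * V.profile (- d \<delta> / sqrt (\<delta> + 1)) - (hi\<^sup>2 - l\<^sup>2) / 2 *
          (2 / (hi + l) * hi / (4 * (d \<delta>)\<^sup>2) * ((w \<delta>) ^ 3 * std_normal_density (w \<delta>))) * hi\<^sup>2 / (2 * (d \<delta>)\<^sup>2)
          \<le> (W.bellman (1 / real n) ^^ n) f 0 + 4 * Phi (- \<eta> / sqrt \<delta> / hi) + C * sqrt (1 / real n)" by blast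
      have "- d \<delta> / sqrt (\<delta> + 1) \<le> 0" using c0 \<eta> elim by (intro divide_nonpos_nonneg) (auto simp: d')
      then have prof: "V.profile (- d \<delta> / sqrt (\<delta> + 1)) = 2 * hi / (hi + l) * Phi (- (c + 2 * \<eta>) / sqrt (\<delta> + 1) / hi)"
        by (simp add: V.profile_def d')
      have "(W.bellman (1 / real n) ^^ n) f 0 \<le> two_sided_sup M \<epsilon> lo hi c n" for n
        unfolding f_def using \<eta> by (intro ramp_le_two_sided) auto
      note le = this
      have "low \<delta> \<le> two_sided_sup M \<epsilon> lo hi c n + C * sqrt (1 / real n)" if "0 < n" for n
        using C[OF that, unfolded prof] le[of n]
        unfolding low_def l_def[symmetric] \<eta>_def[symmetric] by linarith
      then show ?case by blast
    qed
  qed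
qed

end

section \<open>Existence of the two-sided limit and the relative error\<close>

context iid_noise
begin

lemma sup_prob_bounds:
  assumes P: "{x. P x} \<in> sets borel" shows "0 \<le> sup_prob P n" "sup_prob P n \<le> 1"
proof -
  have "0 \<le> (\<integral>\<omega>. of_bool (P (walk (1 / real n) (\<lambda>_ _. hi) n \<omega>)) \<partial>M :: real)" by simp
  also have "\<dots> \<le> sup_prob P n" by (rule expectation_le_sup_prob[OF predictable_const P])
  finally show "0 \<le> sup_prob P n" .
  show "sup_prob P n \<le> 1"
    unfolding sup_prob_def
  proof (rule cSUP_least)
    show "predictable_seqs M \<epsilon> lo hi \<noteq> {}" using predictable_const by auto
    fix \<sigma> assume "\<sigma> \<in> predictable_seqs M \<epsilon> lo hi"
    from integrable_walk_event[OF this P]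
    show "(\<integral>\<omega>. of_bool (P (walk (1 / real n) \<sigma> n \<omega>)) \<partial>M) \<le> (1 :: real)"
      by (rule integral_le_const) auto
  qed
qed

text \<open>The ramps that enclose the indicator differ only near \<open>c\<close> and
  \<open>- c\<close>, where two bumps dominate the difference; for \<open>lo > 0\<close> the bumps
  have small value. The lower ramp has convergent iterates.\<close>

lemma two_sided_convergent_nondegenerate:
  assumes lo: "0 < lo" shows "convergent (two_sided_sup M \<epsilon> lo hi c)"
proof (rule convergent_sandwich)
  fix e :: real assume e: "0 < e"
  define p where "p = lo\<^sup>2 / (2 * hi\<^sup>2)"
  have p: "0 < p" using lo range by (simp add: p_def)
  define A where "A = (\<lambda>\<eta>. exp (1 / (2 * hi\<^sup>2)) * (2 * \<eta>)\<^sup>2 powr p)"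
  have "(A \<longlongrightarrow> exp (1 / (2 * hi\<^sup>2)) * 0) (at_right 0)"
    unfolding A_def
  proof (intro tendsto_mult tendsto_const)
    have "((\<lambda>\<eta>. ((2 * \<eta>)\<^sup>2) powr p) \<longlongrightarrow> ((2 * 0)\<^sup>2) powr p) (at_right (0::real))"
      using p by (intro tendsto_powr2 tendsto_intros) auto
    then show "((\<lambda>\<eta>. (2 * \<eta>)\<^sup>2 powr p) \<longlongrightarrow> 0) (at_right (0::real))" by simp
  qed
  then have "\<forall>\<^sub>F \<eta> in at_right 0. A \<eta> < e / 4" using e by (intro order_tendstoD(2)[of A 0]) auto
  then have "\<forall>\<^sub>F \<eta> in at_right 0. A \<eta> < e / 4 \<and> 0 < \<eta>"
    using eventually_at_right_less[of 0] by eventually_elim simp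
  then obtain \<eta> where \<eta>: "A \<eta> < e / 4" "0 < \<eta>"
    using eventually_happens[of _ "at_right (0::real)"] by (auto simp: trivial_limit_at_right_real)
  define f where "f = (\<lambda>x. ramp c (c + \<eta>) \<bar>x\<bar>)"
  \<comment> \<open>A plateau: 1 within \<open>\<eta>\<close> of \<open>d\<close> and 0 beyond
    \<open>2 * \<eta>\<close>.\<close>
  define g where "g = (\<lambda>d x. ramp (- (2 * \<eta>)) (- \<eta>) (- \<bar>x - d\<bar>))"
  have f: "bounded_lipschitz 1 (1 / (c + \<eta> - c)) f"
    unfolding f_def using \<eta> by (intro bounded_lipschitz_ramp_abs) simp
  have g: "bounded_lipschitz 1 (1 / (- \<eta> - - (2 * \<eta>))) (g d)" for d
    unfolding g_def using \<eta> by (intro bounded_lipschitz_ramp) auto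
  note gg = bounded_lipschitz_add[OF g g]
  have bump: "\<exists>C. \<forall>n>0. (W.bellman (1 / real n) ^^ n) (g d) 0 \<le> A \<eta> + C * sqrt (1 / real n)" for d
    unfolding A_def p_def
  proof (rule W.bump_upper[OF g])
    show "g d x \<le> of_bool (\<bar>x - d\<bar> \<le> 2 * \<eta>)" for x
      using ramp_bounds ramp_eq_0[of "- (2 * \<eta>)" "- \<eta>" "- \<bar>x - d\<bar>"] \<eta> by (auto simp: g_def not_le)
  qed (use \<eta> in simp)
  obtain C where C: "\<And>n. 0 < n \<Longrightarrow> (W.bellman (1 / real n) ^^ n) (g c) 0 \<le> A \<eta> + C * sqrt (1 / real n)"
    using bump by blast
  obtain D where D: "\<And>n. 0 < n \<Longrightarrow> (W.bellman (1 / real n) ^^ n) (g (- c)) 0 \<le> A \<eta> + D * sqrt (1 / real n)"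
    using bump by blast
  define b where "b = (\<lambda>n. (W.bellman (1 / real n) ^^ n) f 0)"
  have conv: "convergent b" unfolding b_def by (rule W.bellman_convergent[OF f])
  have lower: "b n \<le> two_sided_sup M \<epsilon> lo hi c n" for n
    unfolding b_def f_def using \<eta> by (intro ramp_le_two_sided) simp
  have upper: "two_sided_sup M \<epsilon> lo hi c n \<le> b n + (2 * A \<eta> + (C + D) * sqrt (1 / real n))" if n: "0 < n" for n
  proof -
    have m: "c - \<eta> < c" using \<eta> by simp
    have "two_sided_sup M \<epsilon> lo hi c n \<le> (W.bellman (1 / real n) ^^ n) (\<lambda>x. ramp (c - \<eta>) c \<bar>x\<bar>) 0"
      by (rule two_sided_le_ramp[OF m])
    also have "\<dots> \<le> (W.bellman (1 / real n) ^^ n) (\<lambda>x. f x + (g c x + g (- c) x)) 0"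
    proof (rule W.bellman_iter_mono[OF bounded_lipschitz_ramp_abs[OF m] bounded_lipschitz_add[OF f gg]])
      fix x
      have nn: "0 \<le> f x" "0 \<le> g c x" "0 \<le> g (- c) x" by (simp_all add: f_def g_def ramp_bounds)
      consider "\<bar>x\<bar> \<le> c - \<eta>" | "c + \<eta> \<le> \<bar>x\<bar>" | "\<bar>x - c\<bar> \<le> \<eta>" | "\<bar>x - - c\<bar> \<le> \<eta>" by linarith
      then show "ramp (c - \<eta>) c \<bar>x\<bar> \<le> f x + (g c x + g (- c) x)"
      proof cases
        case 1
        then show ?thesis using nn ramp_eq_0[OF m] by simp
      next
        case 2
        then have "f x = 1" using \<eta> by (simp add: f_def ramp_eq_1)
        then show ?thesis using nn ramp_bounds(2)[of "c - \<eta>" c "\<bar>x\<bar>"] by linarith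
      next
        case 3
        then have "g c x = 1" using \<eta> by (simp add: g_def ramp_eq_1)
        then show ?thesis using nn ramp_bounds(2)[of "c - \<eta>" c "\<bar>x\<bar>"] by linarith
      next
        case 4
        then have "g (- c) x = 1" using \<eta> unfolding g_def by (intro ramp_eq_1) auto
        then show ?thesis using nn ramp_bounds(2)[of "c - \<eta>" c "\<bar>x\<bar>"] by linarith
      qed
    qed
    also have "\<dots> \<le> b n + (W.bellman (1 / real n) ^^ n) (\<lambda>x. g c x + g (- c) x) 0"
      unfolding b_def by (rule W.bellman_iter_add[OF f gg])
    also have "(W.bellman (1 / real n) ^^ n) (\<lambda>x. g c x + g (- c) x) 0
        \<le> (W.bellman (1 / real n) ^^ n) (g c) 0 + (W.bellman (1 / real n) ^^ n) (g (- c)) 0"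
      by (rule W.bellman_iter_add[OF g g])
    finally show ?thesis using C[OF n] D[OF n] by (simp add: algebra_simps)
  qed
  have "\<forall>\<^sub>F n in sequentially. (C + D) * sqrt (1 / real n) < e / 2"
    using order_tendstoD(2)[OF sqrt_inverse_tendsto_0, of "e / 2"] e by simp
  then have small: "\<forall>\<^sub>F n in sequentially. 2 * A \<eta> + (C + D) * sqrt (1 / real n) \<le> e \<and> 0 < n"
    using eventually_gt_at_top[of 0] by eventually_elim (use \<eta> in auto)
  show "\<exists>b. convergent b \<and> (\<forall>\<^sub>F n in sequentially. b n \<le> two_sided_sup M \<epsilon> lo hi c n \<and> two_sided_sup M \<epsilon> lo hi c n \<le> b n + e)"
  proof (intro exI[of _ b] conjI)
    have "b n \<le> two_sided_sup M \<epsilon> lo hi c n \<and> two_sided_sup M \<epsilon> lo hi c n \<le> b n + e"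
      if "2 * A \<eta> + (C + D) * sqrt (1 / real n) \<le> e \<and> 0 < n" for n
      using lower[of n] upper[of n] that by simp
    with small show "\<forall>\<^sub>F n in sequentially. b n \<le> two_sided_sup M \<epsilon> lo hi c n \<and> two_sided_sup M \<epsilon> lo hi c n \<le> b n + e"
      by (rule eventually_mono)
  qed (rule conv)
qed

text \<open>For \<open>lo = 0\<close> the walk may stop at will. Once it is within \<open>\<eta>\<close> of the levels \<open>\<plusminus>c\<close>, a short push
  crosses them with probability close to \<open>1\<close>; the time spent on the push is paid for by rescaling
  the level, which costs less than \<open>\<eta>\<close>.\<close>

lemma push_probability_tendsto:
  assumes c: "0 < c"
  shows "((\<lambda>\<eta>. 2 * hi / (hi + \<eta>) * Phi (- 3 * \<eta> / sqrt (\<eta> / (4 * c) / 2) / hi) - 2 * Phi (- \<eta> / sqrt (\<eta> ^ 4) / hi)) \<longlongrightarrow> 1)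
    (at_right 0)"
proof -
  have hi: "0 < hi" using range by simp
  \<comment> \<open>The distance over the square root of the push time is of order
    \<open>sqrt \<eta>\<close>, so the push starts practically at the level and \<open>Phi\<close>
    tends to 1/2; the small inner volatility supplies the prefactor 2.\<close>
  have "((\<lambda>\<eta>. - 3 * \<eta> / sqrt (\<eta> / (4 * c) / 2) / hi) \<longlongrightarrow> 0) (at_right 0)" using c hi by real_asymp
  then have 1: "((\<lambda>\<eta>. Phi (- 3 * \<eta> / sqrt (\<eta> / (4 * c) / 2) / hi)) \<longlongrightarrow> Phi 0) (at_right 0)"
    by (rule isCont_tendsto_compose[OF isCont_Phi])
  have "filterlim (\<lambda>\<eta>. - \<eta> / sqrt (\<eta> ^ 4) / hi) at_bot (at_right 0)" using hi by real_asymp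
  then have 2: "((\<lambda>\<eta>. Phi (- \<eta> / sqrt (\<eta> ^ 4) / hi)) \<longlongrightarrow> 0) (at_right 0)"
    by (rule filterlim_compose[OF Phi_at_bot])
  have "((\<lambda>\<eta>. 2 * hi / (hi + \<eta>) * Phi (- 3 * \<eta> / sqrt (\<eta> / (4 * c) / 2) / hi) - 2 * Phi (- \<eta> / sqrt (\<eta> ^ 4) / hi))
      \<longlongrightarrow> 2 * hi / (hi + 0) * Phi 0 - 2 * 0) (at_right 0)"
    using hi by (intro tendsto_intros 1 2) auto
  then show ?thesis using hi by (simp add: Phi_0)
qed

lemma push_lower:
  assumes lo0: "lo = 0" and c: "0 < c" and \<eta>: "0 < \<eta>" "\<eta> \<le> c" "\<eta> \<le> hi"
  defines "q \<equiv> 2 * hi / (hi + \<eta>) * Phi (- 3 * \<eta> / sqrt (\<eta> / (4 * c) / 2) / hi) - 2 * Phi (- \<eta> / sqrt (\<eta> ^ 4) / hi)"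
  shows "\<exists>C. \<forall>n. 2 \<le> n \<longrightarrow> 4 * c / \<eta> \<le> real n \<longrightarrow> (\<exists>N\<ge>n. (q - C * sqrt (1 / real N)) * two_sided_sup M \<epsilon> lo hi c n
    \<le> (W.bellman (1 / real N) ^^ N) (\<lambda>x. ramp c (c + \<eta>) \<bar>x\<bar>) 0)"
proof -
  \<comment> \<open>As \<open>lo = 0\<close>, the value \<open>\<eta>\<close> itself is an
    admissible inner volatility.\<close>
  interpret V: volatility_pair hi \<eta> using \<eta> by unfold_locales auto
  \<comment> \<open>Duration of the push relative to the first phase, chosen so that the rescaling,
    rounding included, lowers the level \<open>c\<close> by at most
    \<open>\<eta> / 2\<close>.\<close>
  define s where "s = \<eta> / (4 * c)"
  define \<delta> where "\<delta> = \<eta> ^ 4"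
  have s: "0 < s" "s \<le> 1 / 4" using \<eta> c by (auto simp: s_def divide_le_eq)
  have \<delta>: "0 < \<delta>" using \<eta> by (simp add: \<delta>_def)
  define C where "C = V.front_bound \<delta> * (W.third * hi ^ 3 + 1)"
  define f where "f = (\<lambda>x. ramp c (c + \<eta>) \<bar>x\<bar>)"
  have f: "bounded_lipschitz 1 (1 / (c + \<eta> - c)) f"
    unfolding f_def using \<eta> by (intro bounded_lipschitz_ramp_abs) simp
  have f0: "0 \<le> f x" for x by (simp add: f_def ramp_bounds)
  show ?thesis
  proof (intro exI[of _ C] allI impI)
    fix n :: nat assume n: "2 \<le> n" "4 * c / \<eta> \<le> real n"
    define m where "m = nat \<lceil>s * real n\<rceil>"
    have m: "s * real n \<le> real m" "real m \<le> s * real n + 1"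
      using s unfolding m_def by (auto simp: of_nat_nat)
    \<comment> \<open>\<open>n\<close> steps of the original walk are followed by \<open>m\<close>
      steps of push, all with the common step duration \<open>1 / N\<close>.\<close>
    define N where "N = n + m"
    have N: "n \<le> N" "0 < N" using n by (auto simp: N_def)
    define Q where "Q = q - C * sqrt (1 / real N)"
    define h where "h = 1 / real N"
    have h: "0 < h" "h \<le> 1" using N by (auto simp: h_def)
    have "s * real n \<le> 1 / 4 * real n" using s by (intro mult_right_mono) auto
    then have mn: "real m \<le> real n" using m n by linarith
    have mh: "real m * h \<le> 1" "s / 2 \<le> real m * h"
    proof -
      show "real m * h \<le> 1" using N(2) by (simp add: h_def N_def divide_le_eq)
      have "s * real N \<le> s * (2 * real n)" using s mn by (intro mult_left_mono) (auto simp: N_def)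
      then have "s * real N \<le> 2 * real m" using m by linarith
      then show "s / 2 \<le> real m * h" using N by (simp add: h_def field_simps)
    qed
    define g where "g = (\<lambda>x. ramp (c - \<eta>) (c - \<eta> / 2) \<bar>x\<bar>)"
    have g: "bounded_lipschitz 1 (1 / (c - \<eta> / 2 - (c - \<eta>))) g"
      unfolding g_def using \<eta> by (intro bounded_lipschitz_ramp_abs) simp
    have push: "Q * g x \<le> (W.bellman h ^^ m) f x" for x
    proof (cases "c - \<eta> < \<bar>x\<bar>")
      case False
      then have "g x = 0" using \<eta> by (simp add: g_def ramp_eq_0)
      then show ?thesis using W.bellman_iter_ge_const[OF f f0] by simp
    next
      case True
      define r :: real where "r = (if 0 \<le> x then 1 else - 1)"
      have r: "r\<^sup>2 = 1" "r * x = \<bar>x\<bar>" by (auto simp: r_def)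
      have ge: "of_bool (c + 2 * \<eta> - \<eta> \<le> r * y) \<le> f y" for y
      proof -
        have "r * y \<le> \<bar>y\<bar>" by (auto simp: r_def)
        then show ?thesis using ramp_eq_1[of c "c + \<eta>" "\<bar>y\<bar>"] ramp_bounds \<eta> by (auto simp: f_def)
      qed
      have "V.profile ((r * x - (c + 2 * \<eta>)) / sqrt (\<delta> + real m * h)) \<le> (W.bellman h ^^ m) f x
          + 2 * Phi (- \<eta> / sqrt \<delta> / hi) + C * sqrt h"
        unfolding C_def by (rule W.front_lower[OF f ge]) (use \<eta> lo0 \<delta> r h mh in auto)
      moreover have "V.profile (- 3 * \<eta> / sqrt (s / 2)) \<le> V.profile ((r * x - (c + 2 * \<eta>)) / sqrt (\<delta> + real m * h))"
      proof (rule V.profile_mono)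
        have D: "s / 2 \<le> \<delta> + real m * h" using mh \<delta> by simp
        have "3 * \<eta> / sqrt (\<delta> + real m * h) \<le> 3 * \<eta> / sqrt (s / 2)"
          using D s \<eta> by (intro divide_left_mono) auto
        moreover have "- (3 * \<eta>) / sqrt (\<delta> + real m * h) \<le> (r * x - (c + 2 * \<eta>)) / sqrt (\<delta> + real m * h)"
          using True D s r by (intro divide_right_mono) auto
        ultimately show "- 3 * \<eta> / sqrt (s / 2) \<le> (r * x - (c + 2 * \<eta>)) / sqrt (\<delta> + real m * h)" by simp
      qed
      moreover have "V.profile (- 3 * \<eta> / sqrt (s / 2)) = 2 * hi / (hi + \<eta>) * Phi (- 3 * \<eta> / sqrt (s / 2) / hi)"
        using \<eta> s by (simp add: V.profile_def)
      ultimately have "Q \<le> (W.bellman h ^^ m) f x" by (simp add: Q_def q_def s_def \<delta>_def h_def)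
      \<comment> \<open>\<open>Q\<close> may be negative for small \<open>N\<close>; the claim then
        follows from nonnegativity of the iterate.\<close>
      moreover have "0 \<le> g x" "g x \<le> 1" by (simp_all add: g_def ramp_bounds)
      then have "Q * g x \<le> max Q 0"
        using mult_left_le[of "g x" Q] mult_nonpos_nonneg[of Q "g x"] by (cases "0 \<le> Q") auto
      moreover have "0 \<le> (W.bellman h ^^ m) f x" by (rule W.bellman_iter_ge_const[OF f f0])
      ultimately show ?thesis by linarith
    qed
    have g0: "0 \<le> (W.bellman h ^^ n) g 0" by (rule W.bellman_iter_ge_const[OF g]) (simp add: g_def ramp_bounds)
    have f_N: "(W.bellman h ^^ N) f = (W.bellman h ^^ n) ((W.bellman h ^^ m) f)"
      by (simp add: N_def funpow_add)
    have a: "0 \<le> two_sided_sup M \<epsilon> lo hi c n" "two_sided_sup M \<epsilon> lo hi c n \<le> 1"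
      unfolding two_sided_sup_eq by (intro sup_prob_bounds borel_gt)+
    have "Q * two_sided_sup M \<epsilon> lo hi c n \<le> (W.bellman h ^^ N) f 0"
    proof (cases "0 \<le> Q")
      case False
      then have "Q * two_sided_sup M \<epsilon> lo hi c n \<le> 0" using a by (intro mult_nonpos_nonneg) auto
      also have "0 \<le> (W.bellman h ^^ N) f 0" by (rule W.bellman_iter_ge_const[OF f f0])
      finally show ?thesis .
    next
      case True
      \<comment> \<open>A walk with step duration \<open>1 / n\<close>, contracted by
        \<open>\<kappa>\<close>, is one with step duration \<open>1 / N\<close>. A position beyond
        \<open>c\<close> in absolute value is still beyond \<open>c - \<eta> / 2\<close> after the
        contraction.\<close>
      define \<kappa> where "\<kappa> = sqrt (real n / real N)"
      have \<kappa>: "0 < \<kappa>" "\<kappa> \<le> 1" using n N by (auto simp: \<kappa>_def)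
      have \<kappa>2: "\<kappa>\<^sup>2 = real n / real N" by (simp add: \<kappa>_def)
      have "two_sided_sup M \<epsilon> lo hi c n \<le> (W.bellman (1 / real n) ^^ n) (\<lambda>x. g (\<kappa> * x)) 0"
        unfolding two_sided_sup_eq g_def
      proof (rule sup_prob_le_bellman[OF bounded_lipschitz_ramp borel_gt(2)])
        show "c - \<eta> < c - \<eta> / 2" using \<eta> by simp
        show "\<bar>\<bar>\<kappa> * x\<bar> - \<bar>\<kappa> * y\<bar>\<bar> \<le> \<bar>x - y\<bar>" for x y
        proof -
          have "\<bar>\<bar>\<kappa> * x\<bar> - \<bar>\<kappa> * y\<bar>\<bar> \<le> \<bar>\<kappa> * x - \<kappa> * y\<bar>" by (rule abs_triangle_ineq3)
          also have "\<dots> = \<kappa> * \<bar>x - y\<bar>" using \<kappa> by (simp add: right_diff_distrib[symmetric] abs_mult)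
          also have "\<dots> \<le> \<bar>x - y\<bar>" using \<kappa> by (intro mult_left_le_one_le) auto
          finally show ?thesis .
        qed
        fix x
        show "of_bool (c < \<bar>x\<bar>) \<le> ramp (c - \<eta>) (c - \<eta> / 2) \<bar>\<kappa> * x\<bar>"
        proof (cases "c < \<bar>x\<bar>")
          case True
          have "\<kappa>\<^sup>2 \<le> \<kappa>" using \<kappa> by (simp add: power2_eq_square mult_left_le)
          moreover have "c - \<eta> / 2 \<le> \<kappa>\<^sup>2 * c"
          proof -
            have "real m / real N \<le> real m / real n" using N n by (intro divide_left_mono) auto
            also have "\<dots> \<le> (s * real n + 1) / real n" using m by (intro divide_right_mono) auto
            also have "\<dots> = s + 1 / real n" using n by (simp add: add_divide_distrib)
            also have "1 / real n \<le> \<eta> / (4 * c)" using n c \<eta> by (simp add: field_simps)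
            finally have "real m / real N \<le> \<eta> / (2 * c)" by (simp add: s_def)
            then have "real m / real N * c \<le> \<eta> / (2 * c) * c" using c by (intro mult_right_mono) auto
            moreover have "\<kappa>\<^sup>2 = 1 - real m / real N"
            proof -
              have "real N = real n + real m" by (simp add: N_def)
              then have "real N / real N = real n / real N + real m / real N" by (simp only: add_divide_distrib)
              then show ?thesis unfolding \<kappa>2 using N by simp
            qed
            ultimately show ?thesis using c by (simp add: left_diff_distrib)
          qed
          ultimately have "c - \<eta> / 2 \<le> \<kappa> * c" using mult_right_mono[of "\<kappa>\<^sup>2" \<kappa> c] c by linarith
          also have "\<dots> \<le> \<bar>\<kappa> * x\<bar>" using True \<kappa> by (simp add: abs_mult)
          finally have "ramp (c - \<eta>) (c - \<eta> / 2) \<bar>\<kappa> * x\<bar> = 1" using \<eta> by (intro ramp_eq_1) auto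
          then show ?thesis by simp
        qed (simp add: ramp_bounds)
      qed
      also have "\<dots> = (W.bellman h ^^ n) g 0"
        using W.bellman_iter_dilate[OF \<kappa>(1), where h = "1 / real n" and n = n and f = g and x = 0] n by (simp add: \<kappa>2 h_def)
      finally have "Q * two_sided_sup M \<epsilon> lo hi c n \<le> Q * (W.bellman h ^^ n) g 0"
        using True by (rule mult_left_mono)
      also have "\<dots> \<le> (W.bellman h ^^ n) (\<lambda>x. Q * g x) 0"
        by (rule W.bellman_iter_scale[OF g True])
      also have "\<dots> \<le> (W.bellman h ^^ N) f 0"
        unfolding f_N
        by (rule W.bellman_iter_mono[OF bounded_lipschitz_scale[OF g True] W.bellman_iter_bounded_lipschitz[OF f] push])
      finally show ?thesis .
    qed
    then show "\<exists>N\<ge>n. (q - C * sqrt (1 / real N)) * two_sided_sup M \<epsilon> lo hi c n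
        \<le> (W.bellman (1 / real N) ^^ N) (\<lambda>x. ramp c (c + \<eta>) \<bar>x\<bar>) 0"
      using N unfolding Q_def h_def f_def by blast
  qed
qed

text \<open>With a(n) the two-sided supremum and b(n) the iterates of the lower ramp, (1 - e/2) a(n)
  \<le> b(N) for some N \<ge> n once n is large, and convergence of b lets N be replaced by
  n.\<close>

lemma two_sided_convergent_degenerate:
  assumes lo0: "lo = 0" and c: "0 < c" shows "convergent (two_sided_sup M \<epsilon> lo hi c)"
proof (rule convergent_sandwich)
  fix e :: real assume e: "0 < e"
  let ?a = "two_sided_sup M \<epsilon> lo hi c"
  define q where "q = (\<lambda>\<eta>. 2 * hi / (hi + \<eta>) * Phi (- 3 * \<eta> / sqrt (\<eta> / (4 * c) / 2) / hi) - 2 * Phi (- \<eta> / sqrt (\<eta> ^ 4) / hi))"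
  have "\<forall>\<^sub>F \<eta> in at_right 0. 1 - e / 4 < q \<eta>"
    unfolding q_def using e by (intro order_tendstoD(1)[OF push_probability_tendsto[OF c]]) simp
  moreover have "\<forall>\<^sub>F \<eta> in at_right (0::real). \<eta> < min c hi"
    using c range by (intro order_tendstoD(2)[of _ 0]) auto
  ultimately have "\<forall>\<^sub>F \<eta> in at_right 0. 1 - e / 4 < q \<eta> \<and> \<eta> < min c hi \<and> 0 < \<eta>"
    using eventually_at_right_less[of 0] by eventually_elim simp
  then have "\<exists>\<eta>. 1 - e / 4 < q \<eta> \<and> \<eta> < min c hi \<and> 0 < \<eta>"
    by (rule eventually_happens'[rotated]) simp
  then obtain \<eta> where \<eta>: "1 - e / 4 < q \<eta>" "0 < \<eta>" "\<eta> \<le> c" "\<eta> \<le> hi"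
    by (auto intro: less_imp_le)
  define b where "b = (\<lambda>n. (W.bellman (1 / real n) ^^ n) (\<lambda>x. ramp c (c + \<eta>) \<bar>x\<bar>) 0)"
  have "bounded_lipschitz 1 (1 / (c + \<eta> - c)) (\<lambda>x. ramp c (c + \<eta>) \<bar>x\<bar>)"
    using \<eta> by (intro bounded_lipschitz_ramp_abs) simp
  then have conv: "convergent b" unfolding b_def by (rule W.bellman_convergent)
  obtain L where L: "b \<longlonglongrightarrow> L" using conv by (auto simp: convergent_def)
  obtain C where C: "\<And>n. 2 \<le> n \<Longrightarrow> 4 * c / \<eta> \<le> real n \<Longrightarrow> \<exists>N\<ge>n. (q \<eta> - C * sqrt (1 / real N)) * ?a n \<le> b N"
    using push_lower[OF lo0 c \<eta>(2-4)] unfolding q_def b_def by blast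
  have "\<forall>\<^sub>F n in sequentially. dist (b n) L < e / 8" using tendstoD[OF L, of "e / 8"] e by simp
  moreover have "\<forall>\<^sub>F n in sequentially. C * sqrt (1 / real n) < e / 4"
    using order_tendstoD(2)[OF sqrt_inverse_tendsto_0, of "e / 4"] e by simp
  ultimately have "\<forall>\<^sub>F n in sequentially. dist (b n) L < e / 8 \<and> C * sqrt (1 / real n) < e / 4"
    by eventually_elim simp
  then obtain n0 where n0: "\<And>n. n0 \<le> n \<Longrightarrow> dist (b n) L < e / 8 \<and> C * sqrt (1 / real n) < e / 4"
    by (auto simp: eventually_sequentially)
  have "b n \<le> ?a n \<and> ?a n \<le> b n + e" if n: "max (max n0 2) (nat \<lceil>4 * c / \<eta>\<rceil>) \<le> n" for n
  proof
    show "b n \<le> ?a n" unfolding b_def using \<eta> by (intro ramp_le_two_sided) simp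
    have "4 * c / \<eta> \<le> real n" using n by linarith
    then obtain N where N: "n \<le> N" "(q \<eta> - C * sqrt (1 / real N)) * ?a n \<le> b N" using C[of n] n by auto
    have a: "0 \<le> ?a n" "?a n \<le> 1"
      unfolding two_sided_sup_eq by (intro sup_prob_bounds borel_gt)+
    have "1 - e / 2 \<le> q \<eta> - C * sqrt (1 / real N)" using \<eta>(1) n0[of N] N n by auto
    then have "(1 - e / 2) * ?a n \<le> b N"
      using N(2) mult_right_mono[OF _ a(1)] order_trans by blast
    moreover have "e / 2 * ?a n \<le> e / 2" using e a by (simp add: mult_left_le)
    moreover have "\<bar>b N - L\<bar> < e / 8" "\<bar>b n - L\<bar> < e / 8"
      using n0[of N] n0[of n] N n by (auto simp: dist_real_def)
    ultimately show "?a n \<le> b n + e" using e unfolding left_diff_distrib mult_1 by linarith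
  qed
  then have "\<forall>\<^sub>F n in sequentially. b n \<le> ?a n \<and> ?a n \<le> b n + e"
    unfolding eventually_sequentially by blast
  with conv show "\<exists>b. convergent b \<and> (\<forall>\<^sub>F n in sequentially. b n \<le> ?a n \<and> ?a n \<le> b n + e)" by blast
qed

theorem two_sided_convergent:
  assumes c: "0 \<le> c" shows "convergent (two_sided_sup M \<epsilon> lo hi c)"
proof -
  consider "0 < lo" | "lo = 0" "0 < c" | "lo = 0" "c = 0" using c range by linarith
  then show ?thesis
  proof cases
    \<comment> \<open>The push argument divides by \<open>c\<close>. For \<open>lo = 0\<close> and
      \<open>c = 0\<close> the one-sided limit is already 1, which forces the two-sided one.\<close>
    case 3
    have "tail1 0 = 1" unfolding tail1_def using 3 range by (simp add: Phi_0)
    then have lim: "one_sided_sup M \<epsilon> lo hi c \<longlonglongrightarrow> 1" using one_sided_limit[of 0] 3 by simp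
    have "two_sided_sup M \<epsilon> lo hi c \<longlonglongrightarrow> 1"
    proof (rule tendsto_sandwich[OF _ _ lim tendsto_const])
      show "\<forall>\<^sub>F n in sequentially. two_sided_sup M \<epsilon> lo hi c n \<le> 1"
        unfolding two_sided_sup_eq by (intro always_eventually allI sup_prob_bounds(2) borel_gt)
      have "sup_prob (\<lambda>x. c < x) n \<le> sup_prob (\<lambda>x. c < \<bar>x\<bar>) n" for n
      proof -
        have "sup_prob (\<lambda>x. c < x) n = (SUP \<sigma>\<in>predictable_seqs M \<epsilon> lo hi. \<integral>\<omega>. of_bool (c < walk (1 / real n) \<sigma> n \<omega>) \<partial>M)"
          by (simp add: sup_prob_def)
        also have "\<dots> \<le> sup_prob (\<lambda>x. c < \<bar>x\<bar>) n"
        proof (rule cSUP_least)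
          show "predictable_seqs M \<epsilon> lo hi \<noteq> {}" using predictable_const by auto
          fix \<sigma> assume \<sigma>: "\<sigma> \<in> predictable_seqs M \<epsilon> lo hi"
          have "(\<integral>\<omega>. of_bool (c < walk (1 / real n) \<sigma> n \<omega>) \<partial>M :: real) \<le> (\<integral>\<omega>. of_bool (c < \<bar>walk (1 / real n) \<sigma> n \<omega>\<bar>) \<partial>M)"
            using integrable_walk_event[OF \<sigma> borel_gt(1), of c "1 / real n" n]
              integrable_walk_event[OF \<sigma> borel_gt(2), of c "1 / real n" n]
            by (intro integral_mono) auto
          then show "(\<integral>\<omega>. of_bool (c < walk (1 / real n) \<sigma> n \<omega>) \<partial>M) \<le> sup_prob (\<lambda>x. c < \<bar>x\<bar>) n"
            using expectation_le_sup_prob[OF \<sigma> borel_gt(2), of c n] by simp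
        qed
        finally show ?thesis .
      qed
      then show "\<forall>\<^sub>F n in sequentially. one_sided_sup M \<epsilon> lo hi c n \<le> two_sided_sup M \<epsilon> lo hi c n"
        unfolding one_sided_sup_eq two_sided_sup_eq by simp
    qed
    then show ?thesis by (rule convergentI)
  qed (use two_sided_convergent_nondegenerate two_sided_convergent_degenerate in blast)+
qed

text \<open>With v = c / hi the density at 2v is the one at v times
  \<open>exp (- (3 * v\<^sup>2 / 2))\<close>. The Mills ratio bound replaces the density at v by
  \<open>v * Phi (- v)\<close> up to the factor 1 + 1/v^2, and \<open>Phi (- v)\<close> cancels
  against \<open>tail1\<close>.\<close>

lemma defect_ratio:
  assumes c: "0 < c"
  shows "defect c / (2 * tail1 c) \<le> (1 + hi\<^sup>2 / c\<^sup>2) * ((1 - lo\<^sup>2 / hi\<^sup>2) / 4 * exp (- (3 * c\<^sup>2 / (2 * hi\<^sup>2))))"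
proof -
  define v where "v = c / hi"
  have hi: "0 < hi" using range by simp
  have v: "0 < v" using c hi by (simp add: v_def)
  have P: "0 < Phi (- v)" by (rule Phi_pos)
  define E where "E = exp (- (3 * v\<^sup>2 / 2))"
  have nd2: "std_normal_density (2 * v) = std_normal_density v * E"
  proof -
    have "exp (- (2 * v - 0)\<^sup>2 / (2 * 1\<^sup>2)) = exp (- (v - 0)\<^sup>2 / (2 * 1\<^sup>2)) * E"
      unfolding E_def exp_add[symmetric] by (simp add: power2_eq_square)
    then show ?thesis unfolding normal_density_def by (simp only: mult.assoc)
  qed
  have cv: "c = v * hi" using hi by (simp add: v_def)
  have S: "hi + lo \<noteq> 0" using range by simp
  have "defect c = (1 - lo\<^sup>2 / hi\<^sup>2) / 4 * E * (2 * (2 * hi / (hi + lo)) * (std_normal_density v / v))"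
    unfolding defect_def cv using hi v S nd2 by (simp add: mult.commute divide_simps; simp add: power2_eq_square power3_eq_cube power4_eq_xxxx algebra_simps)
  also have "\<dots> = (1 - lo\<^sup>2 / hi\<^sup>2) / 4 * E * (std_normal_density v / (v * Phi (- v))) * (2 * tail1 c)"
    unfolding tail1_def using P v by (simp add: v_def mult_ac)
  finally have eq: "defect c = (1 - lo\<^sup>2 / hi\<^sup>2) / 4 * E * (std_normal_density v / (v * Phi (- v))) * (2 * tail1 c)" .
  have "0 < tail1 c" unfolding tail1_def using P hi range by (simp add: v_def)
  then have "defect c / (2 * tail1 c) = (1 - lo\<^sup>2 / hi\<^sup>2) / 4 * E * (std_normal_density v / (v * Phi (- v)))"
    unfolding eq by simp
  also have "\<dots> \<le> (1 - lo\<^sup>2 / hi\<^sup>2) / 4 * E * (1 + 1 / v\<^sup>2)"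
  proof (rule mult_left_mono)
    have "std_normal_density v * v \<le> Phi (- v) * (1 + v\<^sup>2)"
      using Phi_mills_lower[OF v] add_pos_nonneg[OF zero_less_one zero_le_power2[of v]] by (simp add: pos_divide_le_eq)
    then have "std_normal_density v \<le> Phi (- v) * (1 + v\<^sup>2) / v" using v by (simp add: pos_le_divide_eq)
    also have "\<dots> = (1 + 1 / v\<^sup>2) * (v * Phi (- v))" using v by (simp add: power2_eq_square field_simps)
    finally have "std_normal_density v \<le> (1 + 1 / v\<^sup>2) * (v * Phi (- v))" .
    then show "std_normal_density v / (v * Phi (- v)) \<le> 1 + 1 / v\<^sup>2"
      using P v by (simp add: pos_divide_le_eq)
    have "lo\<^sup>2 \<le> hi\<^sup>2" using range by (intro power_mono) auto
    then show "0 \<le> (1 - lo\<^sup>2 / hi\<^sup>2) / 4 * E" using hi by (simp add: E_def divide_le_eq)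
  qed
  finally show ?thesis using hi by (simp add: v_def E_def power_divide mult.commute)
qed

lemma tail_capacity1_eq: "0 \<le> c \<Longrightarrow> tail_capacity1 M \<epsilon> lo hi c = tail1 c"
  unfolding tail_capacity1_def by (rule limI[OF one_sided_limit])

lemma tail_capacity2_bounds:
  assumes "2 * hi \<le> c"
  shows "tail_capacity2 M \<epsilon> lo hi c \<le> 2 * tail1 c" "2 * tail1 c - defect c \<le> tail_capacity2 M \<epsilon> lo hi c"
proof -
  have "0 \<le> c" using assms range by simp
  from two_sided_convergent[OF this]
  have "two_sided_sup M \<epsilon> lo hi c \<longlonglongrightarrow> tail_capacity2 M \<epsilon> lo hi c"
    unfolding tail_capacity2_def by (simp add: convergent_LIMSEQ_iff)
  from two_sided_bounds[OF this assms]
  show "tail_capacity2 M \<epsilon> lo hi c \<le> 2 * tail1 c" "2 * tail1 c - defect c \<le> tail_capacity2 M \<epsilon> lo hi c" .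
qed

lemma relative_error:
  assumes c: "2 * hi \<le> c"
  shows "\<bar>tail_capacity2 M \<epsilon> lo hi c - 2 * tail_capacity1 M \<epsilon> lo hi c\<bar> / (2 * tail_capacity1 M \<epsilon> lo hi c)
    \<le> (1 + hi\<^sup>2 / c\<^sup>2) * ((1 - lo\<^sup>2 / hi\<^sup>2) / 4 * exp (- (3 * c\<^sup>2 / (2 * hi\<^sup>2))))"
proof -
  have c0: "0 < c" using c range by simp
  have t: "0 < tail1 c" unfolding tail1_def using Phi_pos range by simp
  have "\<bar>tail_capacity2 M \<epsilon> lo hi c - 2 * tail1 c\<bar> \<le> defect c" using tail_capacity2_bounds[OF c] by simp
  then have "\<bar>tail_capacity2 M \<epsilon> lo hi c - 2 * tail1 c\<bar> / (2 * tail1 c) \<le> defect c / (2 * tail1 c)"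
    using t by (intro divide_right_mono) auto
  also note defect_ratio[OF c0]
  finally show ?thesis using c0 by (simp add: tail_capacity1_eq)
qed

end

theorem corollary4:
  fixes M :: "'a measure" and \<epsilon> :: "nat \<Rightarrow> 'a \<Rightarrow> real" and lo hi :: real
  defines "p1 \<equiv> tail_capacity1 M \<epsilon> lo hi"
    and "p2 \<equiv> tail_capacity2 M \<epsilon> lo hi"
  assumes "prob_space M"
    and "iid_standard M \<epsilon>"
    and "0 \<le> lo" and "lo \<le> hi" and "0 < hi"
  shows "(\<forall>c\<ge>0. convergent (one_sided_sup M \<epsilon> lo hi c) \<and> convergent (two_sided_sup M \<epsilon> lo hi c)) \<and>
    p2 \<sim>[at_top] (\<lambda>c. 2 * p1 c) \<and>
    (\<lambda>c. \<bar>p2 c - 2 * p1 c\<bar> / (2 * p1 c))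
      \<lesssim> (\<lambda>c. (1 - lo\<^sup>2 / hi\<^sup>2) / 4 * exp (- (3 * c\<^sup>2 / (2 * hi\<^sup>2))))"
proof -
  interpret iid_noise M \<epsilon> lo hi
    using assms by (simp add: iid_noise_def iid_noise_axioms_def)
  define bound where "bound = (\<lambda>c. (1 + hi\<^sup>2 / c\<^sup>2) * ((1 - lo\<^sup>2 / hi\<^sup>2) / 4 * exp (- (3 * c\<^sup>2 / (2 * hi\<^sup>2)))))"
  have err: "\<forall>\<^sub>F c in at_top. \<bar>p2 c - 2 * p1 c\<bar> / (2 * p1 c) \<le> bound c"
    using eventually_ge_at_top[of "2 * hi"]
    by eventually_elim (simp only: bound_def p1_def p2_def relative_error)
  have pos: "0 < p1 c" if "0 \<le> c" for c
    unfolding p1_def tail_capacity1_eq[OF that] tail1_def using Phi_pos assms by simp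
  have b: "(bound \<longlongrightarrow> 0) at_top" unfolding bound_def using \<open>0 < hi\<close> by real_asymp
  have "((\<lambda>c. p2 c / (2 * p1 c) - 1) \<longlongrightarrow> 0) at_top"
  proof (rule Lim_null_comparison[OF _ b])
    show "\<forall>\<^sub>F c in at_top. norm (p2 c / (2 * p1 c) - 1) \<le> bound c"
      using err eventually_ge_at_top[of 0]
    proof eventually_elim
      case (elim c)
      have "p2 c / (2 * p1 c) - 1 = (p2 c - 2 * p1 c) / (2 * p1 c)" using pos[OF elim(2)] by (simp add: field_simps)
      then show ?case using elim(1) pos[OF elim(2)] by (simp add: abs_divide)
    qed
  qed
  then have "((\<lambda>c. p2 c / (2 * p1 c)) \<longlongrightarrow> 1) at_top" by (simp add: Lim_null[symmetric] LIM_zero_cancel)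
  then have "p2 \<sim>[at_top] (\<lambda>c. 2 * p1 c)" by (rule asymp_equivI')
  moreover have "(\<lambda>c. \<bar>p2 c - 2 * p1 c\<bar> / (2 * p1 c)) \<lesssim> (\<lambda>c. (1 - lo\<^sup>2 / hi\<^sup>2) / 4 * exp (- (3 * c\<^sup>2 / (2 * hi\<^sup>2))))"
    unfolding asymp_less_def
  proof (intro exI conjI)
    \<comment> \<open>The o(1) term is the correction left by the Mills ratio bound.\<close>
    show "(\<lambda>c. hi\<^sup>2 / c\<^sup>2) \<in> o[at_top](\<lambda>_. 1)" by real_asymp
    show "\<forall>\<^sub>F c in at_top. \<bar>p2 c - 2 * p1 c\<bar> / (2 * p1 c)
        \<le> (1 + hi\<^sup>2 / c\<^sup>2) * ((1 - lo\<^sup>2 / hi\<^sup>2) / 4 * exp (- (3 * c\<^sup>2 / (2 * hi\<^sup>2))))"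
      using err by (simp only: bound_def)
  qed
  ultimately show ?thesis
    using one_sided_limit two_sided_convergent by (auto intro: convergentI)
qed

end
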